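(* Let $\mathcal{R}_{a,b,c}$ be the lattice of congruent triangles with sides $a,b,c$ and opposite angles $\alpha,\beta,\gamma$ (as defined in the context), where the triangles are acute or right. Let $\mathcal{C}$ be a half disc with radius $r$, with support function $s$, satisfying $\max_{0\le\phi<2\pi}c^*(\phi)\le c$, where $$c^*(\phi)=s(\phi)\csc\alpha+s(\phi+\alpha+\beta)\csc\beta+s(\phi+\alpha+\pi)(\cot\alpha+\cot\beta).$$ Put $u=(\pi+2)r$, $F=\pi r^2/2$, $Q=ab\sin\gamma$. Then the probabilities $p(i)$ that the randomly thrown half disc $\mathcal{C}$ hits exactly $i$ triangles of $\mathcal{R}_{a,b,c}$ are $$p(1)=1-\frac{(a+b+c)u}{\pi Q}+\frac{(a^2+b^2+c^2)r^2}{Q^2}+\frac{4(ab+bc+ca)r^2}{\pi Q^2}-\frac{(\alpha a^2+\beta b^2+\gamma c^2)r^2}{2\pi Q^2}+\frac{(\alpha bc+\beta ca+\gamma ab)r^2}{\pi Q^2}-\frac{9r^2}{2\pi Q},$$ $$p(2)=\frac{(a+b+c)u}{\pi Q}-\frac{13(a^2+b^2+c^2)r^2}{4Q^2}-\frac{(8-\pi)(ab+bc+ca)r^2}{\pi Q^2}+\frac{5(\alpha a^2+\beta b^2+\gamma c^2)r^2}{2\pi Q^2}-\frac{3(\alpha bc+\beta ca+\gamma ab)r^2}{\pi Q^2}+\frac{33r^2}{2\pi Q},$$ $$p(3)=\frac{7(a^2+b^2+c^2)r^2}{2Q^2}+\frac{(4-2\pi)(ab+bc+ca)r^2}{\pi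 Q^2}-\frac{7(\alpha a^2+\beta b^2+\gamma c^2)r^2}{2\pi Q^2}+\frac{3(\alpha bc+\beta ca+\gamma ab)r^2}{\pi Q^2}-\frac{39r^2}{2\pi Q},$$ $$p(4)=\frac{(ab+bc+ca)r^2}{Q^2}-\frac{5(a^2+b^2+c^2)r^2}{4Q^2}+\frac{3(\alpha a^2+\beta b^2+\gamma c^2)r^2}{2\pi Q^2}-\frac{(\alpha bc+\beta ca+\gamma ab)r^2}{\pi Q^2}+\frac{15r^2}{2\pi Q}-\frac{F}{Q},$$ $$p(5)=0,\qquad p(6)=\frac{F}{Q}.$$
   Context: Lattice. Fix a triangle with sides $a,b,c$ and opposite angles $\alpha,\beta,\gamma$, and altitudes $h_a=b\sin\gamma=c\sin\beta$, $h_b=a\sin\gamma=c\sin\alpha$, $h_c=a\sin\beta=b\sin\alpha$. The lattice $\mathcal{R}_{a,b,c}$ is the union of the three families of parallel lines $\{x\sin\beta+y\cos\beta=kh_a\}$, $\{x\sin\alpha-y\cos\alpha=kh_b\}$, $\{y=kh_c\}$, $k\in\mathbb{Z}$, in $\mathbb{R}^2$. These lines cut the plane into triangles ("the triangles of $\mathcal{R}_{a,b,c}$"), all congruent to $\mathcal{T}=\{(x,y): 0\le y\le h_c,\ y\cot\alpha\le x\le c-y\cot\beta\}$. Two triangles form a parallelogram congruent to $\mathcal{Q}=\{(x,y): 0\le y\le h_c,\ y\cot\alpha\le x\le c+y\cot\alpha\}$, whose area is $Q=ab\sin\gamma=ac\sin\beta=bc\sin\alpha$. Body. The planar convex body $\mathcal{C}$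 is provided with a fixed reference point $O$ in $\mathcal{C}$ and a fixed oriented line segment $\sigma$ starting in $O$, both moving rigidly with $\mathcal{C}$. Support function $s:\mathbb{R}\to\mathbb{R}$: place $\mathcal{C}$ with $O$ at the origin of a Cartesian coordinate system and rotated so that the (counterclockwise) angle from the positive $x$-axis to $\sigma$ is $\phi$; then $s(\phi)$ is the distance from the origin to the support line of $\mathcal{C}$ perpendicular to the $x$-axis on the side of the positive $x$-axis, i.e. $s(\phi)$ is the maximal $x$-coordinate of the points of $\mathcal{C}$ in this position. Random throw of $\mathcal{C}$ onto $\mathcal{R}_{a,b,c}$: only rotations and translations of $\mathcal{C}$ are used; the position $(x,y)$ of $O$ is uniformly distributed in $\mathcal{Q}$ (so $y$ is uniform in $[0,h_c]$ and, given $y$, $x$ is uniform in $[y\cot\alpha,\,h_b\csc\alpha+y\cot\alpha]$, where $h_b\csc\alpha=c$), and the angle $\phi$ from a fixed direction perpendicular to the sides $b$ to the segment $\sigma$ is uniformly distributed in $[0,2\pi]$ and independent of $(x,y)$. The body hits a triangle if it has nonempty intersection with it; $p(i)$ is the probability that exactly $i$ triangles of $\mathcal{R}_{a,b,c}$ are hit. The quantity $c^*(\phi)$ is the length of the side corresponding to $c$ of the triangle similar to $\mathcal{T}$ (with parallel sides) all of whose sides touch $\mathcal{C}$ in direction $\phi$; the condition $\max c^*\le c$ expresses that in every direction $\mathcal{C}$ fits into a single triangle of the lattice. *)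

theory Defs
  imports "HOL-Analysis.Analysis"
begin

type_synonym plane = "real \<times> real"

definition vangle :: "plane \<Rightarrow> plane \<Rightarrow> real" where
  "vangle u v = arccos (u \<bullet> v / (norm u * norm v))"

definition triangle_data :: "real \<Rightarrow> real \<Rightarrow> real \<Rightarrow> real \<Rightarrow> real \<Rightarrow> real \<Rightarrow> bool" where
  "triangle_data a b c \<alpha> \<beta> \<gamma> \<longleftrightarrow>
     (\<exists>A B C :: plane. \<not> collinear {A, B, C} \<and>
        a = dist B C \<and> b = dist C A \<and> c = dist A B \<and>
        \<alpha> = vangle (B - A) (C - A) \<and>
        \<beta> = vangle (C - B) (A - B) \<and>
        \<gamma> = vangle (A - C) (B - C))"

definition lattice_lines :: "real \<Rightarrow> real \<Rightarrow> real \<Rightarrow> real \<Rightarrow> real \<Rightarrow> real \<Rightarrow> plane set" where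
  "lattice_lines a b c \<alpha> \<beta> \<gamma> =
     (let h\<^sub>a = b * sin \<gamma>; h\<^sub>b = a * sin \<gamma>; h\<^sub>c = a * sin \<beta> in
       (\<Union>k::int. {(x, y). x * sin \<beta> + y * cos \<beta> = of_int k * h\<^sub>a}) \<union>
       (\<Union>k::int. {(x, y). x * sin \<alpha> - y * cos \<alpha> = of_int k * h\<^sub>b}) \<union>
       (\<Union>k::int. {(x, y). y = of_int k * h\<^sub>c}))"

definition lattice_triangles ::
    "real \<Rightarrow> real \<Rightarrow> real \<Rightarrow> real \<Rightarrow> real \<Rightarrow> real \<Rightarrow> plane set set" where
  "lattice_triangles a b c \<alpha> \<beta> \<gamma> = closure ` components (- lattice_lines a b c \<alpha> \<beta> \<gamma>)"

definition base_parallelogram ::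
    "real \<Rightarrow> real \<Rightarrow> real \<Rightarrow> real \<Rightarrow> real \<Rightarrow> real \<Rightarrow> plane set" where
  "base_parallelogram a b c \<alpha> \<beta> \<gamma> =
     {(x, y). 0 \<le> y \<and> y \<le> a * sin \<beta> \<and> y * cot \<alpha> \<le> x \<and> x \<le> c + y * cot \<alpha>}"

definition rot :: "real \<Rightarrow> plane \<Rightarrow> plane" where
  "rot t = (\<lambda>(x, y). (x * cos t - y * sin t, x * sin t + y * cos t))"

definition half_disc :: "real \<Rightarrow> plane set \<Rightarrow> bool" where
  "half_disc r C \<longleftrightarrow> (\<exists>m d. norm d = 1 \<and> C = {p \<in> cball m r. 0 \<le> (p - m) \<bullet> d})"

text \<open>A body \<open>C\<close> is given in its standard position: the reference point \<open>O\<close> is the origin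
  and the segment \<open>\<sigma>\<close> points along the positive x-axis. Hence \<open>rot \<phi> ` C\<close> is the body with
  \<open>O\<close> at the origin and \<open>\<sigma>\<close> at the counterclockwise angle \<open>\<phi>\<close> from that axis.\<close>

definition support_fun :: "plane set \<Rightarrow> real \<Rightarrow> real" where
  "support_fun C \<phi> = Sup (fst ` rot \<phi> ` C)"

definition c_star :: "real \<Rightarrow> real \<Rightarrow> (real \<Rightarrow> real) \<Rightarrow> real \<Rightarrow> real" where
  "c_star \<alpha> \<beta> s \<phi> =
     s \<phi> * (1 / sin \<alpha>) + s (\<phi> + \<alpha> + \<beta>) * (1 / sin \<beta>) + s (\<phi> + \<alpha> + pi) * (cot \<alpha> + cot \<beta>)"

text \<open>The direction from which \<open>\<phi>\<close> is measured is the normal \<open>(- sin \<alpha>, cos \<alpha>)\<close> of the sides \<open>b\<close>,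
  at angle \<open>\<alpha> + pi/2\<close> to the x-axis. Of the two normals it is the one that points out of the
  triangle \<open>0 \<le> y \<le> h\<^sub>c, y cot \<alpha> \<le> x \<le> c - y cot \<beta>\<close> across its side \<open>b\<close>; with this choice the arguments
  \<open>\<phi>\<close>, \<open>\<phi> + \<alpha> + \<beta>\<close>, \<open>\<phi> + \<alpha> + pi\<close> in \<open>c_star\<close> belong to the outer normals of the sides
  \<open>b\<close>, \<open>a\<close>, \<open>c\<close>.\<close>

definition placed :: "real \<Rightarrow> plane set \<Rightarrow> plane \<Rightarrow> real \<Rightarrow> plane set" where
  "placed \<alpha> C q \<phi> = (\<lambda>v. q + v) ` rot (\<alpha> + pi / 2 + \<phi>) ` C"

definition throw_measure ::
    "real \<Rightarrow> real \<Rightarrow> real \<Rightarrow> real \<Rightarrow> real \<Rightarrow> real \<Rightarrow> (plane \<times> real) measure" where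
  "throw_measure a b c \<alpha> \<beta> \<gamma> =
     uniform_measure lborel (base_parallelogram a b c \<alpha> \<beta> \<gamma>) \<Otimes>\<^sub>M
     uniform_measure lborel {0..2 * pi}"

definition hit_prob ::
    "real \<Rightarrow> real \<Rightarrow> real \<Rightarrow> real \<Rightarrow> real \<Rightarrow> real \<Rightarrow> plane set \<Rightarrow> nat \<Rightarrow> real" where
  "hit_prob a b c \<alpha> \<beta> \<gamma> C i =
     measure (throw_measure a b c \<alpha> \<beta> \<gamma>)
       {(q, \<phi>). card {T \<in> lattice_triangles a b c \<alpha> \<beta> \<gamma>. placed \<alpha> C q \<phi> \<inter> T \<noteq> {}} = i}"

end

theory Submission
  imports Defs
begin

text \<open>
Let \<open>X, Y\<close> be the affine coordinates in which the lattice translations form \<open>\<int> \<times> \<int>\<close>. The three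
families of lines are then \<open>X \<in> \<int>\<close>, \<open>Y \<in> \<int>\<close> and \<open>X + Y \<in> \<int>\<close>, and they meet only in the integer
points, three at a time. A convex body that fits into a single triangle in every direction meets,
up to a null set of positions, at most one line of each family and covers at most one vertex. Cut
the body along the lines one after the other: each line adds a piece, and the second and the third
line through a covered vertex add one more each, since they cross earlier lines there. So it hits
\<open>1 + (number of lines met) + 2 (number of vertices covered)\<close> triangles (\<open>generic_hit_count\<close>). A body
that covers a vertex meets all three lines there; hence it hits six triangles, and five never occur.

For a fixed direction the position is uniform on the torus, and every event that matters is the
projection of a plane set whose lattice translates are disjoint; its probability is the area of
that set (\<open>torus_trace_packing\<close>). The probability of meeting a line of a given family is the width
\<open>w\<^sub>i\<close> of the body relative to the altitude. Any two of \<open>X, Y, X + Y\<close> are coordinates of the same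
lattice, which gives \<open>w\<^sub>i w\<^sub>j\<close> for lines of two given families. A vertex is covered with
probability \<open>F / Q\<close>. No line is met if the body lies inside one of the two kinds of triangles; if
\<open>t\<close> and \<open>t'\<close> are the ratios of the circumscribed triangles of both kinds, so that \<open>c\<^sup>* = c t\<close>, the
probability of this is \<open>((1 - t)\<^sup>2 + (1 - t')\<^sup>2) / 2\<close>. Inclusion and exclusion
then gives the probability of meeting all three families, and with it the distribution
of the number of triangles (\<open>hit_measures\<close>).

It remains to average \<open>t\<close>, \<open>t\<^sup>2\<close> and \<open>w\<^sub>i w\<^sub>j\<close> over the direction. They are quadratic in values of the
support function at the outer normals of the triangle, two of which enclose an angle \<open>\<pi> - \<gamma>\<close>.
For an acute or right triangle this is at least \<open>\<pi> / 2\<close>, which fixes the order of the break points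
of the piecewise trigonometric integrand (\<open>integral_half_disc_support_product\<close>). The law of cosines
turns the terms \<open>a b cos \<gamma>\<close> into squares of the sides.
\<close>

section \<open>Counting the cells hit by a convex set\<close>

text \<open>In affine coordinates both kinds of lattice triangles are cut out by three unit strips
\<open>i \<le> X \<le> i + 1\<close>, \<open>j \<le> Y \<le> j + 1\<close>, \<open>k \<le> X + Y \<le> k + 1\<close>: a triangle of one kind for \<open>k = i + j\<close>, one of
the other kind for \<open>k = i + j + 1\<close>. For other \<open>k\<close> the intersection has no interior.\<close>
definition cell :: "int \<times> int \<times> int \<Rightarrow> plane set" where
  "cell = (\<lambda>(i, j, k). {p. of_int i \<le> fst p \<and> fst p \<le> of_int i + 1 \<and>
     of_int j \<le> snd p \<and> snd p \<le> of_int j + 1 \<and>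
     of_int k \<le> fst p + snd p \<and> fst p + snd p \<le> of_int k + 1})"

definition cell_index :: "(int \<times> int \<times> int) set" where
  "cell_index = {(i, j, k). k = i + j \<or> k = i + j + 1}"

definition hit_cells :: "plane set \<Rightarrow> (int \<times> int \<times> int) set" where
  "hit_cells K = {s \<in> cell_index. K \<inter> cell s \<noteq> {}}"

lemma convex_attains_level:
  fixes f :: "'a::real_vector \<Rightarrow> real"
  assumes "convex K" "linear f" "p \<in> K" "q \<in> K" "f p \<le> l" "l \<le> f q"
  shows "\<exists>x\<in>K. f x = l"
proof -
  have "is_interval (f ` K)"
    using convex_linear_image[OF assms(2,1)] by (simp add: is_interval_convex_1)
  then have "l \<in> f ` K"
    using assms(3-) unfolding is_interval_1 by blast
  then show ?thesis by blast
qed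

text \<open>Where \<open>f + g \<ge> 0\<close>, the lines \<open>f = 0\<close> and \<open>g = 0\<close> do not cross in the interior, so they
cut the half plane into a chain of three regions. A convex set meets an interval of this
chain, one region more than the number of lines it meets.\<close>
lemma chain_count:
  fixes f g :: "'a::real_vector \<Rightarrow> real"
  assumes K: "convex K" "K \<noteq> {}" and lin: "linear f" "linear g"
    and wedge: "\<And>p. p \<in> K \<Longrightarrow> 0 \<le> f p + g p"
  shows "of_bool (\<exists>p\<in>K. f p \<le> 0) + of_bool (\<exists>p\<in>K. 0 \<le> f p \<and> 0 \<le> g p) + of_bool (\<exists>p\<in>K. g p \<le> 0)
    = (1::nat) + of_bool (\<exists>p\<in>K. f p = 0) + of_bool (\<exists>p\<in>K. g p = 0)"
proof -
  note lev = convex_attains_level[OF K(1) lin(1), where l=0] convex_attains_level[OF K(1) lin(2), where l=0]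
  obtain x where x: "x \<in> K" using K(2) by blast
  consider (none) "\<forall>p\<in>K. 0 < f p" "\<forall>p\<in>K. 0 < g p"
    | (left) p where "p \<in> K" "f p \<le> 0" "\<forall>p\<in>K. 0 < g p"
    | (right) p where "p \<in> K" "g p \<le> 0" "\<forall>p\<in>K. 0 < f p"
    | (both) p q where "p \<in> K" "f p \<le> 0" "q \<in> K" "g q \<le> 0"
    by (meson not_le)
  then show ?thesis
  proof cases
    case none
    then have "\<not> (\<exists>p\<in>K. f p \<le> 0)" "\<not> (\<exists>p\<in>K. g p \<le> 0)" "\<not> (\<exists>p\<in>K. f p = 0)" "\<not> (\<exists>p\<in>K. g p = 0)"
      by auto
    moreover have "\<exists>p\<in>K. 0 \<le> f p \<and> 0 \<le> g p"
      using x none by (auto intro!: bexI[of _ x] less_imp_le)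
    ultimately show ?thesis by simp
  next
    case left
    then have "\<exists>p\<in>K. f p \<le> 0" "\<not> (\<exists>p\<in>K. g p \<le> 0)" "\<not> (\<exists>p\<in>K. g p = 0)"
      by auto
    moreover have "(\<exists>p\<in>K. 0 \<le> f p \<and> 0 \<le> g p) \<longleftrightarrow> (\<exists>p\<in>K. f p = 0)"
      using lev(1)[OF left(1)] left by (metis less_imp_le order_refl)
    ultimately show ?thesis by simp
  next
    case right
    then have "\<exists>p\<in>K. g p \<le> 0" "\<not> (\<exists>p\<in>K. f p \<le> 0)" "\<not> (\<exists>p\<in>K. f p = 0)"
      by auto
    moreover have "(\<exists>p\<in>K. 0 \<le> f p \<and> 0 \<le> g p) \<longleftrightarrow> (\<exists>p\<in>K. g p = 0)"
      using lev(2)[OF right(1)] right by (metis less_imp_le order_refl)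
    ultimately show ?thesis by simp
  next
    case both
    have "0 \<le> g p" "0 \<le> f q" using wedge[of p] wedge[of q] both by linarith+
    then have 1: "\<exists>x\<in>K. f x = 0" "\<exists>x\<in>K. g x = 0"
      using lev(1)[OF both(1,3)] lev(2)[OF both(3,1)] both by auto
    then have "\<exists>p\<in>K. 0 \<le> f p \<and> 0 \<le> g p"
      using wedge by (metis add_0 order_refl)
    with 1 both(1-4) have "\<exists>p\<in>K. f p \<le> 0" "\<exists>p\<in>K. 0 \<le> f p \<and> 0 \<le> g p" "\<exists>p\<in>K. g p \<le> 0" by auto
    with 1 show ?thesis by simp
  qed
qed

lemma linear_fst_plus_snd: "linear (\<lambda>p::plane. fst p + snd p)"
  by (intro linear_compose_add bounded_linear.linear bounded_linear_fst bounded_linear_snd)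

lemma convex_origin_between:
  fixes K :: "plane set"
  assumes "convex K" "p \<in> K" "q \<in> K" "fst p = 0" "fst q = 0" "0 \<le> snd p" "snd q \<le> 0"
  shows "0 \<in> K"
proof -
  have "convex (K \<inter> {p. fst p = 0})"
    using assms(1) convex_hyperplane[of "(1::real, 0::real)" 0] by (intro convex_Int) (auto simp: inner_prod_def)
  moreover have "linear (snd :: plane \<Rightarrow> real)" by (simp add: bounded_linear.linear bounded_linear_snd)
  ultimately obtain x where "x \<in> K" "fst x = 0" "snd x = 0"
    using convex_attains_level[of "K \<inter> {p. fst p = 0}" snd q p 0] assms by auto
  moreover have "x = 0" using \<open>fst x = 0\<close> \<open>snd x = 0\<close> by (simp add: prod_eq_iff)
  ultimately show ?thesis by simp
qed

lemma convex_swap: "convex (prod.swap ` K)" if "convex K" for K :: "plane set"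
proof -
  have "linear (prod.swap :: plane \<Rightarrow> plane)" by (rule linearI) auto
  then show ?thesis using that by (rule convex_linear_image)
qed

text \<open>Three lines through the origin cut the plane into six sectors. Each of the two half planes
\<open>X + Y \<ge> 0\<close> and \<open>X + Y \<le> 0\<close> contains a chain of three of them, to which \<open>chain_count\<close> applies. The
lines \<open>X = 0\<close> and \<open>Y = 0\<close> are met in both half planes only if the convex set contains the origin,
so each of them is then counted twice.\<close>
lemma sector_count:
  fixes K :: "plane set"
  assumes K: "convex K" "K \<noteq> {}"
  shows "of_bool (\<exists>p\<in>K. fst p \<le> 0 \<and> 0 \<le> fst p + snd p) + of_bool (\<exists>p\<in>K. 0 \<le> fst p \<and> 0 \<le> snd p)
       + of_bool (\<exists>p\<in>K. snd p \<le> 0 \<and> 0 \<le> fst p + snd p)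
       + (of_bool (\<exists>p\<in>K. 0 \<le> fst p \<and> fst p + snd p \<le> 0) + of_bool (\<exists>p\<in>K. fst p \<le> 0 \<and> snd p \<le> 0)
       + of_bool (\<exists>p\<in>K. 0 \<le> snd p \<and> fst p + snd p \<le> 0))
    = (1::nat) + of_bool (\<exists>p\<in>K. fst p = 0) + of_bool (\<exists>p\<in>K. snd p = 0)
       + of_bool (\<exists>p\<in>K. fst p + snd p = 0) + 2 * of_bool (0 \<in> K)"
proof -
  let ?z = "\<lambda>p::plane. fst p + snd p"
  let ?U = "K \<inter> {p. 0 \<le> ?z p}" and ?D = "K \<inter> {p. ?z p \<le> 0}"
  have UD: "p \<in> K \<longleftrightarrow> p \<in> ?U \<or> p \<in> ?D" for p by auto
  have lin: "linear (fst :: plane \<Rightarrow> real)" "linear (snd :: plane \<Rightarrow> real)"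
    "linear (\<lambda>p::plane. - fst p)" "linear (\<lambda>p::plane. - snd p)"
    by (auto simp: linear_fst linear_snd intro!: linear_compose_neg)
  have cU: "convex ?U" and cD: "convex ?D"
    using K(1) convex_halfspace_ge[of 0 "(1::real, 1::real)"] convex_halfspace_le[of "(1::real, 1::real)" 0]
    by (auto intro!: convex_Int simp: inner_prod_def)
  have U: "of_bool (\<exists>p\<in>?U. fst p \<le> 0) + of_bool (\<exists>p\<in>?U. 0 \<le> fst p \<and> 0 \<le> snd p) + of_bool (\<exists>p\<in>?U. snd p \<le> 0)
    = (of_bool (?U \<noteq> {}) :: nat) + of_bool (\<exists>p\<in>?U. fst p = 0) + of_bool (\<exists>p\<in>?U. snd p = 0)"
  proof (cases "?U = {}")
    case False
    then show ?thesis using chain_count[OF cU False lin(1,2)] by simp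
  qed simp
  have D: "of_bool (\<exists>p\<in>?D. 0 \<le> fst p) + of_bool (\<exists>p\<in>?D. fst p \<le> 0 \<and> snd p \<le> 0) + of_bool (\<exists>p\<in>?D. 0 \<le> snd p)
    = (of_bool (?D \<noteq> {}) :: nat) + of_bool (\<exists>p\<in>?D. fst p = 0) + of_bool (\<exists>p\<in>?D. snd p = 0)"
  proof (cases "?D = {}")
    case False
    then show ?thesis using chain_count[OF cD False lin(3,4)] by simp
  qed simp
  have Z: "(of_bool (?U \<noteq> {}) :: nat) + of_bool (?D \<noteq> {}) = 1 + of_bool (\<exists>p\<in>K. ?z p = 0)"
  proof (cases "?U \<noteq> {} \<and> ?D \<noteq> {}")
    case True
    then obtain p q where "p \<in> K" "0 \<le> ?z p" "q \<in> K" "?z q \<le> 0" by auto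
    then have "\<exists>p\<in>K. ?z p = 0"
      using convex_attains_level[OF K(1) linear_fst_plus_snd, of q p 0] by auto
    then show ?thesis using True by simp
  next
    case False
    then have "\<not> (\<exists>p\<in>K. ?z p = 0)" by auto
    moreover have "?U \<noteq> {} \<or> ?D \<noteq> {}" using K(2) by (metis (no_types, lifting) IntI all_not_in_conv linear mem_Collect_eq)
    ultimately show ?thesis using False by (auto simp: of_bool_def)
  qed
  have X: "(of_bool (\<exists>p\<in>?U. fst p = 0) :: nat) + of_bool (\<exists>p\<in>?D. fst p = 0)
     = of_bool (\<exists>p\<in>K. fst p = 0) + of_bool (0 \<in> K)"
  proof (cases "0 \<in> K")
    case True
    then have "\<exists>p\<in>?U. fst p = 0" "\<exists>p\<in>?D. fst p = 0" "\<exists>p\<in>K. fst p = 0"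
      by (force intro: bexI[of _ 0])+
    with True show ?thesis by simp
  next
    case False
    then have "\<not> ((\<exists>p\<in>?U. fst p = 0) \<and> (\<exists>p\<in>?D. fst p = 0))"
      using convex_origin_between[OF K(1)] by fastforce
    moreover have "(\<exists>p\<in>K. fst p = 0) \<longleftrightarrow> (\<exists>p\<in>?U. fst p = 0) \<or> (\<exists>p\<in>?D. fst p = 0)"
      using UD by blast
    ultimately show ?thesis using False by (auto simp: of_bool_def)
  qed
  have Y: "(of_bool (\<exists>p\<in>?U. snd p = 0) :: nat) + of_bool (\<exists>p\<in>?D. snd p = 0)
     = of_bool (\<exists>p\<in>K. snd p = 0) + of_bool (0 \<in> K)"
  proof (cases "0 \<in> K")
    case True
    then have "\<exists>p\<in>?U. snd p = 0" "\<exists>p\<in>?D. snd p = 0" "\<exists>p\<in>K. snd p = 0"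
      by (force intro: bexI[of _ 0])+
    with True show ?thesis by simp
  next
    case False
    have "(0::plane) \<notin> prod.swap ` K" using False by (auto simp: zero_prod_def)
    then have "\<not> ((\<exists>p\<in>?U. snd p = 0) \<and> (\<exists>p\<in>?D. snd p = 0))"
      using convex_origin_between[OF convex_swap[OF K(1)]] by (fastforce simp: image_iff)
    moreover have "(\<exists>p\<in>K. snd p = 0) \<longleftrightarrow> (\<exists>p\<in>?U. snd p = 0) \<or> (\<exists>p\<in>?D. snd p = 0)"
      using UD by blast
    ultimately show ?thesis using False by (auto simp: of_bool_def)
  qed
  have e: "(\<exists>p\<in>?U. fst p \<le> 0) \<longleftrightarrow> (\<exists>p\<in>K. fst p \<le> 0 \<and> 0 \<le> ?z p)"
    "(\<exists>p\<in>?U. 0 \<le> fst p \<and> 0 \<le> snd p) \<longleftrightarrow> (\<exists>p\<in>K. 0 \<le> fst p \<and> 0 \<le> snd p)"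
    "(\<exists>p\<in>?U. snd p \<le> 0) \<longleftrightarrow> (\<exists>p\<in>K. snd p \<le> 0 \<and> 0 \<le> ?z p)"
    "(\<exists>p\<in>?D. 0 \<le> fst p) \<longleftrightarrow> (\<exists>p\<in>K. 0 \<le> fst p \<and> ?z p \<le> 0)"
    "(\<exists>p\<in>?D. fst p \<le> 0 \<and> snd p \<le> 0) \<longleftrightarrow> (\<exists>p\<in>K. fst p \<le> 0 \<and> snd p \<le> 0)"
    "(\<exists>p\<in>?D. 0 \<le> snd p) \<longleftrightarrow> (\<exists>p\<in>K. 0 \<le> snd p \<and> ?z p \<le> 0)"
    by force+
  show ?thesis
    using U D X Y Z unfolding e by linarith
qed

lemma in_cell_near_origin:
  assumes "p \<in> cell (i, j, k)" "-1 < fst p" "fst p < 1" "-1 < snd p" "snd p < 1"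
  shows "i \<in> {-1, 0}" "j \<in> {-1, 0}"
  using assms by (auto simp: cell_def)

text \<open>Inside the square \<open>(-1, 1)\<^sup>2\<close> the only cells are the six sectors at the origin, two of them
cut off at \<open>X + Y = \<plusminus>1\<close>, and the two corners behind these cuts. So the count is that of the sectors
plus one for every cut that is met.\<close>
lemma normalized_hit_count:
  fixes K :: "plane set"
  assumes K: "convex K" "K \<noteq> {}"
    and X: "\<And>p. p \<in> K \<Longrightarrow> -1 < fst p \<and> fst p < 1"
    and Y: "\<And>p. p \<in> K \<Longrightarrow> -1 < snd p \<and> snd p < 1"
    and Z: "\<And>k l::int. \<lbrakk>\<exists>p\<in>K. fst p + snd p = of_int k; \<exists>p\<in>K. fst p + snd p = of_int l\<rbrakk> \<Longrightarrow> k = l"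
  shows "card (hit_cells K) = 1 + of_bool (\<exists>p\<in>K. \<exists>i::int. fst p = of_int i)
    + of_bool (\<exists>p\<in>K. \<exists>j::int. snd p = of_int j)
    + of_bool (\<exists>p\<in>K. \<exists>k::int. fst p + snd p = of_int k)
    + 2 * of_bool (\<exists>p\<in>K. \<exists>i j::int. p = (of_int i, of_int j))"
proof -
  let ?z = "\<lambda>p::plane. fst p + snd p"
  let ?h = "\<lambda>s. of_bool (\<exists>p\<in>K. p \<in> cell s) :: nat"
  let ?I = "{(-1,-1,-2), (-1,-1,-1), (-1,0,-1), (-1,0,0), (0,-1,-1), (0,-1,0), (0,0,0), (0,0,1)} :: (int \<times> int \<times> int) set"
  have eight: "sum f ?I = f (-1,-1,-2) + f (-1,-1,-1) + f (-1,0,-1) + f (-1,0,0) + f (0,-1,-1)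
      + f (0,-1,0) + f (0,0,0) + f (0,0,1)" for f :: "int \<times> int \<times> int \<Rightarrow> nat"
    by simp
  have "hit_cells K = {s \<in> ?I. \<exists>p\<in>K. p \<in> cell s}"
  proof (intro set_eqI iffI)
    fix s assume "s \<in> hit_cells K"
    moreover obtain i j k where "s = (i, j, k)" by (cases s)
    ultimately obtain p where s: "s = (i, j, k)" "k = i + j \<or> k = i + j + 1" "p \<in> K" "p \<in> cell (i, j, k)"
      by (auto simp: hit_cells_def cell_index_def)
    then have "i = -1 \<or> i = 0" "j = -1 \<or> j = 0"
      using in_cell_near_origin[of p i j k] X[of p] Y[of p] by simp_all
    then have "s \<in> ?I" using s(1,2) by (elim disjE) simp_all
    with s show "s \<in> {s \<in> ?I. \<exists>p\<in>K. p \<in> cell s}" by blast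
  qed (auto simp: hit_cells_def cell_index_def)
  then have "card (hit_cells K) = (\<Sum>s\<in>?I. ?h s)"
    by (simp only: card_eq_sum sum.inter_filter finite.intros of_bool_def)
  also have "\<dots> = ?h (-1,-1,-2) + ?h (-1,-1,-1) + ?h (-1,0,-1) + ?h (-1,0,0) + ?h (0,-1,-1)
      + ?h (0,-1,0) + ?h (0,0,0) + ?h (0,0,1)"
    by (rule eight)
  finally have N: "card (hit_cells K) = \<dots>" .
  have lev: "\<exists>x\<in>K. ?z x = l" if "p \<in> K" "q \<in> K" "?z p \<le> l" "l \<le> ?z q" for p q l
    using convex_attains_level[OF K(1) linear_fst_plus_snd that] .
  have XY: "p \<in> K \<Longrightarrow> -1 < fst p \<and> fst p < 1 \<and> -1 < snd p \<and> snd p < 1" for p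
    using X Y by blast
  have c3: "(\<exists>p\<in>K. p \<in> cell (-1,0,-1)) \<longleftrightarrow> (\<exists>p\<in>K. 0 \<le> snd p \<and> ?z p \<le> 0)"
    by (intro bex_cong refl, drule XY) (auto simp: cell_def)
  have c4: "(\<exists>p\<in>K. p \<in> cell (-1,0,0)) \<longleftrightarrow> (\<exists>p\<in>K. fst p \<le> 0 \<and> 0 \<le> ?z p)"
    by (intro bex_cong refl, drule XY) (auto simp: cell_def)
  have c5: "(\<exists>p\<in>K. p \<in> cell (0,-1,-1)) \<longleftrightarrow> (\<exists>p\<in>K. 0 \<le> fst p \<and> ?z p \<le> 0)"
    by (intro bex_cong refl, drule XY) (auto simp: cell_def)
  have c6: "(\<exists>p\<in>K. p \<in> cell (0,-1,0)) \<longleftrightarrow> (\<exists>p\<in>K. snd p \<le> 0 \<and> 0 \<le> ?z p)"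
    by (intro bex_cong refl, drule XY) (auto simp: cell_def)
  have c7: "(\<exists>p\<in>K. p \<in> cell (0,0,0)) \<longleftrightarrow> (\<exists>p\<in>K. 0 \<le> fst p \<and> 0 \<le> snd p \<and> ?z p \<le> 1)"
    by (intro bex_cong refl, drule XY) (auto simp: cell_def)
  have c8: "(\<exists>p\<in>K. p \<in> cell (0,0,1)) \<longleftrightarrow> (\<exists>p\<in>K. 1 \<le> ?z p)"
    by (intro bex_cong refl, drule XY) (auto simp: cell_def)
  have c2: "(\<exists>p\<in>K. p \<in> cell (-1,-1,-1)) \<longleftrightarrow> (\<exists>p\<in>K. fst p \<le> 0 \<and> snd p \<le> 0 \<and> -1 \<le> ?z p)"
    by (intro bex_cong refl, drule XY) (auto simp: cell_def)
  have c1: "(\<exists>p\<in>K. p \<in> cell (-1,-1,-2)) \<longleftrightarrow> (\<exists>p\<in>K. ?z p \<le> -1)"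
    by (intro bex_cong refl, drule XY) (auto simp: cell_def)
  have up: "?h (0,0,0) + ?h (0,0,1) = of_bool (\<exists>p\<in>K. 0 \<le> fst p \<and> 0 \<le> snd p) + of_bool (\<exists>p\<in>K. ?z p = 1)"
  proof (cases "\<exists>p\<in>K. ?z p = 1")
    case True
    then obtain p where "p \<in> K" "?z p = 1" by blast
    moreover from this have "0 \<le> fst p" "0 \<le> snd p" using XY[of p] by auto
    ultimately show ?thesis unfolding c7 c8 by (fastforce simp: of_bool_def)
  next
    case False
    then have "(\<forall>p\<in>K. ?z p < 1) \<or> (\<forall>p\<in>K. 1 < ?z p)"
      using lev by (metis linorder_le_cases order_le_less)
    then show ?thesis
    proof
      assume "\<forall>p\<in>K. 1 < ?z p"
      moreover from this have "0 \<le> fst p \<and> 0 \<le> snd p" if "p \<in> K" for p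
        using XY[OF that] that by fastforce
      ultimately have "\<not> (\<exists>p\<in>K. 0 \<le> fst p \<and> 0 \<le> snd p \<and> ?z p \<le> 1)" "\<exists>p\<in>K. 1 \<le> ?z p"
        "\<exists>p\<in>K. 0 \<le> fst p \<and> 0 \<le> snd p"
        using K(2) by (meson not_le, meson all_not_in_conv less_imp_le, meson all_not_in_conv)
      with False show ?thesis unfolding c7 c8 by simp
    qed (unfold c7 c8, fastforce simp: of_bool_def)
  qed
  have dn: "?h (-1,-1,-2) + ?h (-1,-1,-1) = of_bool (\<exists>p\<in>K. fst p \<le> 0 \<and> snd p \<le> 0) + of_bool (\<exists>p\<in>K. ?z p = -1)"
  proof (cases "\<exists>p\<in>K. ?z p = -1")
    case True
    then obtain p where "p \<in> K" "?z p = -1" by blast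
    moreover from this have "fst p \<le> 0" "snd p \<le> 0" using XY[of p] by auto
    ultimately show ?thesis unfolding c1 c2 by (fastforce simp: of_bool_def)
  next
    case False
    then have "(\<forall>p\<in>K. ?z p < -1) \<or> (\<forall>p\<in>K. -1 < ?z p)"
      using lev by (metis linorder_le_cases order_le_less)
    then show ?thesis
    proof
      assume "\<forall>p\<in>K. ?z p < -1"
      moreover from this have "fst p \<le> 0 \<and> snd p \<le> 0" if "p \<in> K" for p
        using XY[OF that] that by fastforce
      ultimately have "\<not> (\<exists>p\<in>K. fst p \<le> 0 \<and> snd p \<le> 0 \<and> -1 \<le> ?z p)" "\<exists>p\<in>K. ?z p \<le> -1"
        "\<exists>p\<in>K. fst p \<le> 0 \<and> snd p \<le> 0"
        using K(2) by (meson not_le, meson all_not_in_conv less_imp_le, meson all_not_in_conv)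
      with False show ?thesis unfolding c1 c2 by simp
    qed (unfold c1 c2, fastforce simp: of_bool_def)
  qed
  have small: "i = 0" if "-1 < real_of_int i" "real_of_int i < 1" for i using that by linarith
  have LX: "(\<exists>p\<in>K. \<exists>i::int. fst p = of_int i) \<longleftrightarrow> (\<exists>p\<in>K. fst p = 0)"
    using X small by (metis of_int_0)
  have LY: "(\<exists>p\<in>K. \<exists>i::int. snd p = of_int i) \<longleftrightarrow> (\<exists>p\<in>K. snd p = 0)"
    using Y small by (metis of_int_0)
  have V: "(\<exists>p\<in>K. \<exists>i j::int. p = (of_int i, of_int j)) \<longleftrightarrow> 0 \<in> K"
    using X Y small by (metis fst_conv snd_conv of_int_0 zero_prod_def)
  have LZ: "(of_bool (\<exists>p\<in>K. \<exists>k::int. ?z p = of_int k) :: nat)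
      = of_bool (\<exists>p\<in>K. ?z p = 0) + of_bool (\<exists>p\<in>K. ?z p = 1) + of_bool (\<exists>p\<in>K. ?z p = -1)"
  proof -
    have "(\<exists>p\<in>K. \<exists>k::int. ?z p = of_int k) \<longleftrightarrow> (\<exists>p\<in>K. ?z p = 0) \<or> (\<exists>p\<in>K. ?z p = 1) \<or> (\<exists>p\<in>K. ?z p = -1)"
      (is "?L = ?R")
    proof
      assume ?L
      then obtain p k where p: "p \<in> K" "?z p = of_int k" by blast
      with X[OF p(1)] Y[OF p(1)] have "k = 0 \<or> k = 1 \<or> k = -1" by linarith
      with p show ?R by (auto intro!: bexI[of _ p])
    next
      show "?R \<Longrightarrow> ?L" by (metis of_int_0 of_int_1 of_int_minus)
    qed
    moreover have "\<not> ((\<exists>p\<in>K. ?z p = 0) \<and> (\<exists>p\<in>K. ?z p = 1))" "\<not> ((\<exists>p\<in>K. ?z p = 0) \<and> (\<exists>p\<in>K. ?z p = -1))"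
      "\<not> ((\<exists>p\<in>K. ?z p = 1) \<and> (\<exists>p\<in>K. ?z p = -1))"
      using Z[of 0 1] Z[of 0 "-1"] Z[of 1 "-1"] by auto
    ultimately show ?thesis by (auto simp: of_bool_def)
  qed
  show ?thesis
    using N up dn sector_count[OF K] unfolding LX LY LZ V c3 c4 c5 c6 by linarith
qed

text \<open>A lattice translation moves the body into the square \<open>(-1, 1)\<^sup>2\<close>. The extreme values of the
coordinates are assumed not to be integers, so that the closed interval of values and the
half-open one contain the same integers; the half-open form is the one for which a width of at
most 1 leaves room for at most one integer without exception.\<close>
lemma generic_hit_count:
  fixes K :: "plane set"
  assumes K: "convex K"
    and X: "fst ` K = {l1..u1}" "l1 \<le> u1" "u1 - l1 \<le> 1" "l1 \<notin> \<int>" "u1 \<notin> \<int>"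
    and Y: "snd ` K = {l2..u2}" "u2 - l2 \<le> 1" "l2 \<notin> \<int>" "u2 \<notin> \<int>"
    and Z: "(\<lambda>p. fst p + snd p) ` K = {l3..u3}" "u3 - l3 \<le> 1" "l3 \<notin> \<int>" "u3 \<notin> \<int>"
  shows "card (hit_cells K) = 1 + of_bool (\<exists>i::int. l1 \<le> i \<and> i < u1)
    + of_bool (\<exists>i::int. l2 \<le> i \<and> i < u2)
    + of_bool (\<exists>i::int. l3 \<le> i \<and> i < u3)
    + 2 * of_bool (\<exists>i j::int. (of_int i, of_int j) \<in> K)"
proof -
  define a b where "a = \<lfloor>u1\<rfloor>" and "b = \<lfloor>u2\<rfloor>"
  let ?t = "\<lambda>p::plane. p + (- of_int a, - of_int b)"
  define K' where "K' = ?t ` K"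
  have K'_iff: "p \<in> K' \<longleftrightarrow> p + (of_int a, of_int b) \<in> K" for p
  proof -
    have "p = ?t q \<longleftrightarrow> q = p + (of_int a, of_int b)" for q by (auto simp: prod_eq_iff)
    then show ?thesis by (simp add: K'_def image_iff)
  qed
  have ne: "\<And>k::int. l1 \<noteq> k \<and> u1 \<noteq> k \<and> l2 \<noteq> k \<and> u2 \<noteq> k \<and> l3 \<noteq> k \<and> u3 \<noteq> k"
    using X Y Z by (metis Ints_of_int)
  have X': "p \<in> K \<Longrightarrow> l1 \<le> fst p \<and> fst p \<le> u1" and Y': "p \<in> K \<Longrightarrow> l2 \<le> snd p \<and> snd p \<le> u2"
    and Z': "p \<in> K \<Longrightarrow> l3 \<le> fst p + snd p \<and> fst p + snd p \<le> u3" for p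
    using X(1) Y(1) Z(1) by (auto simp: set_eq_iff image_iff)
  have u: "of_int a < u1" "u1 < of_int a + 1" "of_int b < u2" "u2 < of_int b + 1"
    unfolding a_def b_def by (metis ne of_int_floor_le order_less_le, linarith)+
  have l: "of_int a - 1 < l1" "of_int b - 1 < l2" using u X Y by linarith+
  have levels: "(\<exists>p\<in>K'. \<exists>i::int. f p = of_int i) \<longleftrightarrow> (\<exists>i::int. l \<le> i \<and> i < u)"
    if f: "f ` K = {l..u}" "u \<notin> \<int>" and shift: "\<And>p. f (?t p) = f p - of_int n" for f :: "plane \<Rightarrow> real" and l u n
  proof -
    have "(\<exists>i::int. f (?t p) = of_int i) \<longleftrightarrow> (\<exists>i::int. f p = of_int i)" for p
      unfolding shift by (metis diff_add_cancel of_int_add of_int_diff)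
    then have "(\<exists>p\<in>K'. \<exists>i::int. f p = of_int i) \<longleftrightarrow> (\<exists>p\<in>K. \<exists>i::int. f p = of_int i)"
      unfolding K'_def by simp
    also have "\<dots> \<longleftrightarrow> (\<exists>i::int. real_of_int i \<in> f ` K)" unfolding image_iff Bex_def by metis
    also have "\<dots> \<longleftrightarrow> (\<exists>i::int. l \<le> i \<and> i < u)"
      unfolding f(1) using f(2) by (metis Ints_of_int atLeastAtMost_iff less_le)
    finally show ?thesis .
  qed
  have "bij_betw (\<lambda>(i, j, k). (i - a, j - b, k - a - b)) (hit_cells K) (hit_cells K')"
  proof (rule bij_betw_byWitness[where f' = "\<lambda>(i, j, k). (i + a, j + b, k + a + b)"])
    have s: "p \<in> cell (i - a, j - b, k - a - b) \<longleftrightarrow> p + (of_int a, of_int b) \<in> cell (i, j, k)" for p i j k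
      by (auto simp: cell_def)
    have s': "p + (of_int a, of_int b) \<in> cell (i + a, j + b, k + a + b) \<longleftrightarrow> p \<in> cell (i, j, k)" for p i j k
      by (auto simp: cell_def)
    show "(\<lambda>(i, j, k). (i - a, j - b, k - a - b)) ` hit_cells K \<subseteq> hit_cells K'"
    proof clarify
      fix i j k assume "(i, j, k) \<in> hit_cells K"
      then obtain p where p: "p \<in> K" "p \<in> cell (i, j, k)" "(i, j, k) \<in> cell_index"
        by (auto simp: hit_cells_def)
      then have "?t p \<in> K' \<inter> cell (i - a, j - b, k - a - b)"
        unfolding s Int_iff K'_iff by (simp add: add.assoc flip: zero_prod_def)
      with p(3) show "(i - a, j - b, k - a - b) \<in> hit_cells K'"
        by (auto simp: hit_cells_def cell_index_def)
    qed
    show "(\<lambda>(i, j, k). (i + a, j + b, k + a + b)) ` hit_cells K' \<subseteq> hit_cells K"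
    proof clarify
      fix i j k assume "(i, j, k) \<in> hit_cells K'"
      then obtain p where p: "p \<in> K'" "p \<in> cell (i, j, k)" "(i, j, k) \<in> cell_index"
        by (auto simp: hit_cells_def)
      then have "p + (of_int a, of_int b) \<in> K \<inter> cell (i + a, j + b, k + a + b)"
        unfolding s' Int_iff K'_iff by simp
      with p(3) show "(i + a, j + b, k + a + b) \<in> hit_cells K"
        by (auto simp: hit_cells_def cell_index_def)
    qed
  qed auto
  then have "card (hit_cells K) = card (hit_cells K')" by (rule bij_betw_same_card)
  also have "\<dots> = 1 + of_bool (\<exists>p\<in>K'. \<exists>i::int. fst p = of_int i)
    + of_bool (\<exists>p\<in>K'. \<exists>j::int. snd p = of_int j)
    + of_bool (\<exists>p\<in>K'. \<exists>k::int. fst p + snd p = of_int k)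
    + 2 * of_bool (\<exists>p\<in>K'. \<exists>i j::int. p = (of_int i, of_int j))"
  proof (rule normalized_hit_count)
    show "convex K'" unfolding K'_def using convex_translation[OF K, of "(- of_int a, - of_int b)"] by (simp add: add.commute)
    show "K' \<noteq> {}" unfolding K'_def using X by auto
    show "-1 < fst p \<and> fst p < 1" "-1 < snd p \<and> snd p < 1" if "p \<in> K'" for p
      using X'[of "p + (of_int a, of_int b)"] Y'[of "p + (of_int a, of_int b)"] that u l unfolding K'_iff by auto
    show "k = m" if "\<exists>p\<in>K'. fst p + snd p = of_int k" "\<exists>p\<in>K'. fst p + snd p = of_int m" for k m
    proof -
      have range: "l3 < of_int (i + a + b) \<and> of_int (i + a + b) < u3" if ex: "\<exists>p\<in>K'. fst p + snd p = of_int i" for i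
      proof -
        obtain p where p: "p \<in> K'" "fst p + snd p = of_int i" using ex by blast
        have "fst (p + (of_int a, of_int b)) + snd (p + (of_int a, of_int b)) = of_int (i + a + b)"
          using p(2) by simp
        then have "l3 \<le> of_int (i + a + b)" "of_int (i + a + b) \<le> u3"
          using Z'[OF p(1)[unfolded K'_iff]] by linarith+
        then show ?thesis using ne[of "i + a + b"] by (simp add: less_le)
      qed
      from range[OF that(1)] range[OF that(2)] have "l3 < of_int (k + a + b)" "of_int (k + a + b) < u3"
        "l3 < of_int (m + a + b)" "of_int (m + a + b) < u3" by simp_all
      with Z(2) show ?thesis by linarith
    qed
  qed
  also have "(\<exists>p\<in>K'. \<exists>i::int. fst p = of_int i) \<longleftrightarrow> (\<exists>i::int. l1 \<le> i \<and> i < u1)"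
    by (rule levels[OF X(1,5), of a]) simp
  also have "(\<exists>p\<in>K'. \<exists>i::int. snd p = of_int i) \<longleftrightarrow> (\<exists>i::int. l2 \<le> i \<and> i < u2)"
    by (rule levels[OF Y(1,4), of b]) simp
  also have "(\<exists>p\<in>K'. \<exists>i::int. fst p + snd p = of_int i) \<longleftrightarrow> (\<exists>i::int. l3 \<le> i \<and> i < u3)"
    by (rule levels[OF Z(1,4), of "a + b"]) simp
  also have "(\<exists>p\<in>K'. \<exists>i j::int. p = (of_int i, of_int j)) \<longleftrightarrow> (\<exists>i j::int. (of_int i, of_int j) \<in> K)"
  proof safe
    fix i j :: int assume "(of_int i, of_int j) \<in> K'"
    then show "\<exists>i j::int. (of_int i, of_int j) \<in> K"
      unfolding K'_iff by (intro exI[of _ "i + a"] exI[of _ "j + b"]) simp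
  next
    fix i j :: int assume "(of_int i, of_int j) \<in> K"
    then have "(of_int (i - a), of_int (j - b)) \<in> K'" unfolding K'_iff by simp
    then show "\<exists>p\<in>K'. \<exists>i j::int. p = (of_int i, of_int j)" by blast
  qed
  finally show ?thesis .
qed

section \<open>Traces of plane sets on the torus\<close>

definition unit_square :: "plane set" where
  "unit_square = {0..<1} \<times> {0..<1}"

definition lattice_point :: "int \<times> int \<Rightarrow> plane" where
  "lattice_point v = (of_int (fst v), of_int (snd v))"

text \<open>The projection of a plane set to the torus, with the half-open unit square as the set of
representatives.\<close>
definition torus_trace :: "plane set \<Rightarrow> plane set" where
  "torus_trace B = {z \<in> unit_square. \<exists>v. z + lattice_point v \<in> B}"

lemma unit_square_borel [measurable]: "unit_square \<in> sets borel"
  unfolding unit_square_def by (intro borel_Times) auto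

lemma emeasure_unit_square: "emeasure lborel unit_square = 1"
  unfolding unit_square_def by (subst lborel_prod[symmetric], subst lborel.emeasure_pair_measure_Times) auto

lemma measurable_coordinates_plane [measurable]:
  "(fst :: plane \<Rightarrow> real) \<in> borel \<rightarrow>\<^sub>M borel" "(snd :: plane \<Rightarrow> real) \<in> borel \<rightarrow>\<^sub>M borel"
  by (intro borel_measurable_continuous_onI continuous_intros)+

lemma measurable_add_const [measurable]: "(\<lambda>z::plane. z + c) \<in> borel \<rightarrow>\<^sub>M borel"
  by (intro borel_measurable_continuous_onI continuous_intros)

lemma emeasure_lborel_translate:
  fixes B :: "plane set"
  assumes [measurable]: "B \<in> sets borel"
  shows "emeasure lborel {z. z + c \<in> B} = emeasure lborel B"
proof -
  have "emeasure lborel B = emeasure (distr lborel borel ((+) c)) B" by (simp add: lborel_distr_plus)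
  also have "\<dots> = emeasure lborel ((+) c -` B)" by (subst emeasure_distr) auto
  finally show ?thesis by (simp add: vimage_def add.commute)
qed

lemma emeasure_lborel_reflect:
  fixes B :: "plane set"
  assumes [measurable]: "B \<in> sets borel"
  shows "emeasure lborel {z. - z \<in> B} = emeasure lborel B"
proof -
  have [measurable]: "(\<lambda>z::plane. - z) \<in> borel \<rightarrow>\<^sub>M borel"
    by (intro borel_measurable_continuous_onI continuous_intros)
  have "emeasure lborel B = emeasure (density (distr lborel borel (\<lambda>x::plane. 0 + (-1) *\<^sub>R x)) (\<lambda>_. ennreal (\<bar>-1\<bar> ^ DIM(plane)))) B"
    by (subst lborel_affine[of "-1" 0]) simp_all
  also have "\<dots> = emeasure (distr lborel borel (\<lambda>x::plane. - x)) B"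
    by (simp add: emeasure_density nn_integral_indicator)
  also have "\<dots> = emeasure lborel ((\<lambda>z. - z) -` B)" by (subst emeasure_distr) auto
  finally show ?thesis by (simp add: vimage_def)
qed

text \<open>If the lattice translates of \<open>B\<close> are disjoint, then \<open>B\<close> is cut by the translated unit squares
into pieces that are moved without overlap into one unit square.\<close>
lemma torus_trace_packing:
  assumes B [measurable]: "B \<in> sets borel"
    and packing: "\<And>z v w. \<lbrakk>z + lattice_point v \<in> B; z + lattice_point w \<in> B\<rbrakk> \<Longrightarrow> v = w"
  shows "torus_trace B \<in> sets borel" "emeasure lborel (torus_trace B) = emeasure lborel B"
proof -
  let ?A = "\<lambda>v. {z \<in> unit_square. z + lattice_point v \<in> B}"
  let ?C = "\<lambda>v. {z \<in> B. z - lattice_point v \<in> unit_square}"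
  have A: "?A v \<in> sets borel" for v by measurable
  have C: "?C v \<in> sets borel" for v
    using measurable_add_const[of "- lattice_point v"] by measurable
  have tr: "torus_trace B = (\<Union>v. ?A v)" by (auto simp: torus_trace_def)
  show "torus_trace B \<in> sets borel" unfolding tr using A by (intro sets.countable_UN) auto
  have "emeasure lborel (torus_trace B) = (\<integral>\<^sup>+v. emeasure lborel (?A v) \<partial>count_space UNIV)"
    unfolding tr using packing A by (intro emeasure_UN_countable) (auto simp: disjoint_family_on_def)
  also have "\<dots> = (\<integral>\<^sup>+v. emeasure lborel (?C v) \<partial>count_space UNIV)"
  proof (intro nn_integral_cong)
    fix v show "emeasure lborel (?A v) = emeasure lborel (?C v)"
      using emeasure_lborel_translate[OF C[of v], of "lattice_point v"] by (simp add: conj_commute)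
  qed
  also have "\<dots> = emeasure lborel (\<Union>v. ?C v)"
  proof (intro emeasure_UN_countable[symmetric])
    have floor: "fst v = \<lfloor>fst z\<rfloor>" "snd v = \<lfloor>snd z\<rfloor>" if "z - lattice_point v \<in> unit_square" for z v
      using that by (auto simp: unit_square_def lattice_point_def mem_Times_iff intro!: floor_unique[symmetric])
    have inj: "v = w" if "z - lattice_point v \<in> unit_square" "z - lattice_point w \<in> unit_square" for z v w
      using floor[OF that(1)] floor[OF that(2)] by (simp add: prod_eq_iff)
    show "disjoint_family_on ?C UNIV"
      unfolding disjoint_family_on_def using inj by blast
  qed (use C in auto)
  also have "(\<Union>v. ?C v) = B"
  proof -
    have "z - lattice_point (\<lfloor>fst z\<rfloor>, \<lfloor>snd z\<rfloor>) \<in> unit_square" for z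
      unfolding unit_square_def lattice_point_def mem_Times_iff by (simp, linarith)
    then show ?thesis by blast
  qed
  finally show "emeasure lborel (torus_trace B) = emeasure lborel B" .
qed

lemma emeasure_plane_sections:
  fixes B :: "plane set"
  assumes "B \<in> sets borel"
  shows "emeasure lborel B = (\<integral>\<^sup>+x. emeasure lborel {y. (x, y) \<in> B} \<partial>lborel)"
    and "emeasure lborel B = (\<integral>\<^sup>+y. emeasure lborel {x. (x, y) \<in> B} \<partial>lborel)"
proof -
  have B: "B \<in> sets (lborel \<Otimes>\<^sub>M lborel)" using assms by (simp only: lborel_prod sets_lborel)
  show "emeasure lborel B = (\<integral>\<^sup>+x. emeasure lborel {y. (x, y) \<in> B} \<partial>lborel)"
    using lborel.emeasure_pair_measure_alt[OF B] by (simp add: lborel_prod vimage_def)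
  show "emeasure lborel B = (\<integral>\<^sup>+y. emeasure lborel {x. (x, y) \<in> B} \<partial>lborel)"
    using lborel_pair.emeasure_pair_measure_alt2[OF B] by (simp add: lborel_prod vimage_def)
qed

text \<open>A shear preserves area. The half-open form is used for the events that a line is met.\<close>
lemma area_sheared_rectangle:
  fixes m :: real
  assumes "l \<le> u" "l' \<le> u'"
  shows "emeasure lborel {z::plane. l < fst z \<and> fst z \<le> u \<and> l' < snd z + m * fst z \<and> snd z + m * fst z \<le> u'}
      = ennreal ((u - l) * (u' - l'))" (is "emeasure lborel ?B = _")
    and "emeasure lborel {z::plane. l < snd z \<and> snd z \<le> u \<and> l' < fst z + m * snd z \<and> fst z + m * snd z \<le> u'}
      = ennreal ((u - l) * (u' - l'))" (is "emeasure lborel ?C = _")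
proof -
  have sec: "{y. (x, y) \<in> ?B} = (if x \<in> {l<..u} then {l' - m * x<..u' - m * x} else {})" for x
    by auto
  have B: "?B \<in> sets borel"
    by measurable
  have "emeasure lborel ?B = (\<integral>\<^sup>+x. emeasure lborel {y. (x, y) \<in> ?B} \<partial>lborel)"
    by (rule emeasure_plane_sections(1)[OF B])
  also have "\<dots> = (\<integral>\<^sup>+x. ennreal (u' - l') * indicator {l<..u} x \<partial>lborel)"
    unfolding sec using assms by (intro nn_integral_cong) (auto simp: indicator_def)
  also have "\<dots> = ennreal ((u - l) * (u' - l'))"
    using assms by (subst nn_integral_cmult_indicator) (auto simp: ennreal_mult[symmetric] mult.commute)
  finally show "emeasure lborel ?B = ennreal ((u - l) * (u' - l'))" .
  have sec: "{x. (x, y) \<in> ?C} = (if y \<in> {l<..u} then {l' - m * y<..u' - m * y} else {})" for y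
    by auto
  have C: "?C \<in> sets borel"
    by measurable
  have "emeasure lborel ?C = (\<integral>\<^sup>+x. emeasure lborel {y. (y, x) \<in> ?C} \<partial>lborel)"
    by (rule emeasure_plane_sections(2)[OF C])
  also have "\<dots> = (\<integral>\<^sup>+x. ennreal (u' - l') * indicator {l<..u} x \<partial>lborel)"
    unfolding sec using assms by (intro nn_integral_cong) (auto simp: indicator_def)
  also have "\<dots> = ennreal ((u - l) * (u' - l'))"
    using assms by (subst nn_integral_cmult_indicator) (auto simp: ennreal_mult[symmetric] mult.commute)
  finally show "emeasure lborel ?C = ennreal ((u - l) * (u' - l'))" .
qed

lemma area_corner_triangle:
  fixes k l m :: real
  assumes "0 \<le> k - l - m"
  shows "emeasure lborel {z::plane. l < fst z \<and> m < snd z \<and> fst z + snd z < k} = ennreal ((k - l - m)\<^sup>2 / 2)"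
    (is "emeasure lborel ?B = _")
proof -
  have sec: "{y. (x, y) \<in> ?B} = (if l < x then {m<..<k - x} else {})" for x
    by auto
  have B: "?B \<in> sets borel"
    by measurable
  have "emeasure lborel ?B = (\<integral>\<^sup>+x. emeasure lborel {y. (x, y) \<in> ?B} \<partial>lborel)"
    by (rule emeasure_plane_sections(1)[OF B])
  also have "\<dots> = (\<integral>\<^sup>+x. ennreal (k - m - x) * indicator {l..k - m} x \<partial>lborel)"
  proof (rule nn_integral_cong_AE)
    have "AE x in lborel. x \<notin> {l}" by (intro AE_not_in countable_imp_null_set_lborel) auto
    then show "AE x in lborel. emeasure lborel {y. (x, y) \<in> ?B} = ennreal (k - m - x) * indicator {l..k - m} x"
      unfolding sec by eventually_elim (auto simp: indicator_def)
  qed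
  also have "\<dots> = ennreal (- ((k - m - (k - m))\<^sup>2 / 2) - - ((k - m - l)\<^sup>2 / 2))"
    by (rule nn_integral_FTC_Icc) (use assms in \<open>auto intro!: derivative_eq_intros simp: field_simps\<close>)
  finally show ?thesis by (simp add: algebra_simps)
qed

text \<open>These are the three families of lines, suitably translated: countable unions of lines
are null sets.\<close>
lemma AE_not_integer_offset:
  "AE z::plane in lborel. fst z + c \<notin> \<int>" "AE z::plane in lborel. snd z + c \<notin> \<int>"
  "AE z::plane in lborel. fst z + snd z + c \<notin> \<int>"
proof -
  have ctb: "countable {x. x + d \<in> \<int>}" for d :: real
  proof -
    have "{x. x + d \<in> \<int>} = (\<lambda>x. x - d) ` \<int>" by (force simp: image_iff)
    then show ?thesis by (simp add: countable_int)
  qed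
  have ae: "AE x in lborel. x + d \<notin> \<int>" for d :: real
    using AE_not_in[OF countable_imp_null_set_lborel[OF ctb[of d]]] by simp
  have plane: "AE z in lborel. f z \<notin> \<int>"
    if "continuous_on UNIV f" "AE x in lborel. AE y in lborel. f (x, y) \<notin> \<int>" for f :: "plane \<Rightarrow> real"
  proof -
    have "open {z. f z \<notin> \<int>}"
      using open_vimage[OF open_Compl[OF closed_Ints] that(1)] by (simp add: vimage_def)
    then have "{z. f z \<notin> \<int>} \<in> sets (lborel \<Otimes>\<^sub>M lborel)" by (simp only: lborel_prod sets_lborel borel_open)
    then have "{z \<in> space (lborel \<Otimes>\<^sub>M lborel). f z \<notin> \<int>} \<in> sets (lborel \<Otimes>\<^sub>M lborel)"
      by (simp add: space_pair_measure)
    from lborel_pair.AE_pair_measure[OF this that(2)] show ?thesis by (simp only: lborel_prod)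
  qed
  show "AE z::plane in lborel. fst z + c \<notin> \<int>"
    by (rule plane) (use ae[of c] in \<open>auto intro!: continuous_intros elim: eventually_mono\<close>)
  show "AE z::plane in lborel. snd z + c \<notin> \<int>"
    by (rule plane) (use ae[of c] in \<open>auto intro!: continuous_intros\<close>)
  have "AE y in lborel. x + y + c \<notin> \<int>" for x using ae[of "x + c"] by (simp add: ac_simps)
  then show "AE z::plane in lborel. fst z + snd z + c \<notin> \<int>"
    by (intro plane) (auto intro!: continuous_intros)
qed

section \<open>Translates of a convex body in general position\<close>

abbreviation trace_integral :: "plane set \<Rightarrow> real \<Rightarrow> bool" where
  "trace_integral B a \<equiv> has_bochner_integral lborel (indicator (torus_trace B) :: plane \<Rightarrow> real) a"

definition hit_positions :: "plane set \<Rightarrow> nat \<Rightarrow> plane set" where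
  "hit_positions K n = {z \<in> unit_square. card (hit_cells ((+) z ` K)) = n}"

lemma has_integral_trace_indicator:
  assumes "B \<in> sets borel" "emeasure lborel B = ennreal a" "0 \<le> a"
    and "\<And>z v w. \<lbrakk>z + lattice_point v \<in> B; z + lattice_point w \<in> B\<rbrakk> \<Longrightarrow> v = w"
  shows "trace_integral B a"
proof -
  note tr = torus_trace_packing[OF assms(1,4)]
  have "measure lborel (torus_trace B) = a" using tr(2) assms(2,3) by (simp add: measure_def)
  then show ?thesis
    using has_bochner_integral_real_indicator[of "torus_trace B" lborel] tr assms(2) by simp
qed

text \<open>A convex body in lattice coordinates with the ranges of the three coordinate functions. The
number \<open>u3 - l1 - l2\<close> is the side of the smallest cell-shaped triangle \<open>X \<ge> l1\<close>, \<open>Y \<ge> l2\<close>,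
\<open>X + Y \<le> u3\<close> around the body, in units of a cell, and \<open>u1 + u2 - l3\<close> is the same for the other kind
of triangle.\<close>
locale lattice_body =
  fixes K :: "plane set" and l1 u1 l2 u2 l3 u3 :: real
  assumes compact: "compact K" and convex: "convex K" and nonempty: "K \<noteq> {}"
    and fst_image: "fst ` K = {l1..u1}"
    and snd_image: "snd ` K = {l2..u2}"
    and sum_image: "(\<lambda>p. fst p + snd p) ` K = {l3..u3}"
    and fits_up: "u3 - l1 - l2 \<le> 1"
    and fits_down: "u1 + u2 - l3 \<le> 1"
begin

lemma bounds:
  assumes "p \<in> K"
  shows "l1 \<le> fst p" "fst p \<le> u1" "l2 \<le> snd p" "snd p \<le> u2" "l3 \<le> fst p + snd p" "fst p + snd p \<le> u3"
  using assms fst_image snd_image sum_image by (auto simp: set_eq_iff image_iff)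

lemma ranges: "l1 \<le> u1" "l2 \<le> u2" "l3 \<le> u3"
  using nonempty bounds by (meson all_not_in_conv order_trans)+

text \<open>A point at which one coordinate is extreme bounds the two others. These inequalities say that
the three ranges come from one body, and they bound every width by the side of the circumscribed
triangle.\<close>
lemma extremes:
  "u1 + l2 \<le> u3" "l1 + u2 \<le> u3" "u3 \<le> u1 + u2" "l1 + l2 \<le> l3" "l3 \<le> u1 + l2" "l3 \<le> l1 + u2"
proof -
  have "u1 \<in> fst ` K" "l1 \<in> fst ` K" "u2 \<in> snd ` K" "l2 \<in> snd ` K"
    "u3 \<in> (\<lambda>p. fst p + snd p) ` K" "l3 \<in> (\<lambda>p. fst p + snd p) ` K"
    unfolding fst_image snd_image sum_image using ranges by auto
  then obtain a b c d e f where p: "a \<in> K" "fst a = u1" "b \<in> K" "fst b = l1" "c \<in> K" "snd c = u2"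
    "d \<in> K" "snd d = l2" "e \<in> K" "fst e + snd e = u3" "f \<in> K" "fst f + snd f = l3"
    unfolding image_iff Bex_def by metis
  show "u1 + l2 \<le> u3" using p(1,2) bounds(3,6)[of a] by linarith
  show "l1 + u2 \<le> u3" using p(5,6) bounds(1,6)[of c] by linarith
  show "u3 \<le> u1 + u2" using p(9,10) bounds(2,4)[of e] by linarith
  show "l1 + l2 \<le> l3" using p(11,12) bounds(1,3)[of f] by linarith
  show "l3 \<le> u1 + l2" using p(7,8) bounds(2,5)[of d] by linarith
  show "l3 \<le> l1 + u2" using p(3,4) bounds(4,5)[of b] by linarith
qed

lemma widths: "u1 - l1 \<le> 1" "u2 - l2 \<le> 1" "u3 - l3 \<le> 1"
  using extremes fits_up fits_down by linarith+

definition "meets1 z \<longleftrightarrow> (\<exists>i::int. fst z + l1 \<le> of_int i \<and> of_int i < fst z + u1)"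
definition "meets2 z \<longleftrightarrow> (\<exists>i::int. snd z + l2 \<le> of_int i \<and> of_int i < snd z + u2)"
definition "meets3 z \<longleftrightarrow> (\<exists>i::int. fst z + snd z + l3 \<le> of_int i \<and> of_int i < fst z + snd z + u3)"
definition "covers_vertex z \<longleftrightarrow> (\<exists>i j::int. (of_int i, of_int j) \<in> (+) z ` K)"

definition "generic z \<longleftrightarrow> fst z + l1 \<notin> \<int> \<and> fst z + u1 \<notin> \<int> \<and> snd z + l2 \<notin> \<int> \<and> snd z + u2 \<notin> \<int>
  \<and> fst z + snd z + l3 \<notin> \<int> \<and> fst z + snd z + u3 \<notin> \<int>"

text \<open>The sets below describe the positions at which the body meets fixed lines: \<open>B1\<close>, \<open>B2\<close>, \<open>B3\<close>
one fixed line of one family (in a unit strip across it), \<open>B12\<close>, \<open>B13\<close>, \<open>B23\<close> two fixed lines,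
\<open>Bup\<close> and \<open>Bdown\<close> no line at all because the body lies inside a fixed cell, \<open>BV\<close> a fixed vertex.
The strict inequalities in \<open>BV\<close> remove a null set, so that its translates are disjoint.
The summands with factor 0 or 1 give the first six the form of a sheared rectangle.\<close>
definition "B1 = {z::plane. - u1 < fst z \<and> fst z \<le> - l1 \<and> -1 < snd z + 0 * fst z \<and> snd z + 0 * fst z \<le> 0}"
definition "B2 = {z::plane. - u2 < snd z \<and> snd z \<le> - l2 \<and> -1 < fst z + 0 * snd z \<and> fst z + 0 * snd z \<le> 0}"
definition "B3 = {z::plane. -1 < fst z \<and> fst z \<le> 0 \<and> - u3 < snd z + 1 * fst z \<and> snd z + 1 * fst z \<le> - l3}"
definition "B12 = {z::plane. - u1 < fst z \<and> fst z \<le> - l1 \<and> - u2 < snd z + 0 * fst z \<and> snd z + 0 * fst z \<le> - l2}"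
definition "B13 = {z::plane. - u1 < fst z \<and> fst z \<le> - l1 \<and> - u3 < snd z + 1 * fst z \<and> snd z + 1 * fst z \<le> - l3}"
definition "B23 = {z::plane. - u2 < snd z \<and> snd z \<le> - l2 \<and> - u3 < fst z + 1 * snd z \<and> fst z + 1 * snd z \<le> - l3}"
definition "Bup = {z::plane. - l1 < fst z \<and> - l2 < snd z \<and> fst z + snd z < 1 - u3}"
definition "Bdown = {z::plane. fst z < 1 - u1 \<and> snd z < 1 - u2 \<and> 1 - l3 < fst z + snd z}"
definition "BV = {z::plane. - z \<in> K \<and> - u1 < fst z \<and> - u2 < snd z}"

lemmas B_defs = B1_def B2_def B3_def B12_def B13_def B23_def

lemma B_borel [measurable]:
  "B1 \<in> sets borel" "B2 \<in> sets borel" "B3 \<in> sets borel" "B12 \<in> sets borel" "B13 \<in> sets borel"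
  "B23 \<in> sets borel" "Bup \<in> sets borel" "Bdown \<in> sets borel"
  unfolding B_defs Bup_def Bdown_def by measurable

lemma BV_borel [measurable]: "BV \<in> sets borel"
proof -
  have [measurable]: "K \<in> sets borel" using compact by (simp add: borel_compact)
  have [measurable]: "(\<lambda>z::plane. - z) \<in> borel \<rightarrow>\<^sub>M borel"
    by (intro borel_measurable_continuous_onI continuous_intros)
  show ?thesis unfolding BV_def by measurable
qed

lemma int_shift_unique:
  assumes "a < x + of_int v" "x + of_int v \<le> b" "a < x + of_int w" "x + of_int w \<le> b" "b - a \<le> (1::real)"
  shows "v = w"
  using assms by linarith

lemma unique_B:
  assumes vw: "z + lattice_point v \<in> B" "z + lattice_point w \<in> B"
    and "B = B1 \<or> B = B2 \<or> B = B3 \<or> B = B12 \<or> B = B13 \<or> B = B23"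
  shows "v = w"
proof -
  have coords: "fst (z + lattice_point v) = fst z + of_int (fst v)" "snd (z + lattice_point v) = snd z + of_int (snd v)"
    "fst z + of_int (fst v) + (snd z + of_int (snd v)) = fst z + snd z + of_int (fst v + snd v)"
    "snd z + of_int (snd v) + (fst z + of_int (fst v)) = fst z + snd z + of_int (fst v + snd v)" for v
    by (simp_all add: lattice_point_def)
  have 1: "fst v = fst w" if "- u1 < fst z + of_int (fst v) \<and> fst z + of_int (fst v) \<le> - l1"
    "- u1 < fst z + of_int (fst w) \<and> fst z + of_int (fst w) \<le> - l1"
    using that widths(1) by linarith
  have 2: "snd v = snd w" if "- u2 < snd z + of_int (snd v) \<and> snd z + of_int (snd v) \<le> - l2"
    "- u2 < snd z + of_int (snd w) \<and> snd z + of_int (snd w) \<le> - l2"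
    using that widths(2) by linarith
  have 3: "fst v + snd v = fst w + snd w"
    if "- u3 < fst z + snd z + of_int (fst v + snd v) \<and> fst z + snd z + of_int (fst v + snd v) \<le> - l3"
      "- u3 < fst z + snd z + of_int (fst w + snd w) \<and> fst z + snd z + of_int (fst w + snd w) \<le> - l3"
    using that widths(3) int_shift_unique by force
  have 4: "fst v = fst w" if "- 1 < fst z + of_int (fst v) \<and> fst z + of_int (fst v) \<le> 0"
    "- 1 < fst z + of_int (fst w) \<and> fst z + of_int (fst w) \<le> 0"
    using that by linarith
  have 5: "snd v = snd w" if "- 1 < snd z + of_int (snd v) \<and> snd z + of_int (snd v) \<le> 0"
    "- 1 < snd z + of_int (snd w) \<and> snd z + of_int (snd w) \<le> 0"
    using that by linarith
  note simps = mem_Collect_eq coords mult_zero_left mult_1 add_0_right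
  from assms(3) show ?thesis
  proof (elim disjE)
    assume "B = B1"
    note vw' = vw[unfolded this B1_def simps]
    have "fst v = fst w" by (rule 1) (use vw' in blast)+
    moreover have "snd v = snd w" by (rule 5) (use vw' in blast)+
    ultimately show ?thesis by (simp add: prod_eq_iff)
  next
    assume "B = B2"
    note vw' = vw[unfolded this B2_def simps]
    have "fst v = fst w" by (rule 4) (use vw' in blast)+
    moreover have "snd v = snd w" by (rule 2) (use vw' in blast)+
    ultimately show ?thesis by (simp add: prod_eq_iff)
  next
    assume "B = B3"
    note vw' = vw[unfolded this B3_def simps]
    have "fst v = fst w" by (rule 4) (use vw' in blast)+
    moreover have "fst v + snd v = fst w + snd w" by (rule 3) (use vw' in blast)+
    ultimately show ?thesis by (simp add: prod_eq_iff)
  next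
    assume "B = B12"
    note vw' = vw[unfolded this B12_def simps]
    have "fst v = fst w" by (rule 1) (use vw' in blast)+
    moreover have "snd v = snd w" by (rule 2) (use vw' in blast)+
    ultimately show ?thesis by (simp add: prod_eq_iff)
  next
    assume "B = B13"
    note vw' = vw[unfolded this B13_def simps]
    have "fst v = fst w" by (rule 1) (use vw' in blast)+
    moreover have "fst v + snd v = fst w + snd w" by (rule 3) (use vw' in blast)+
    ultimately show ?thesis by (simp add: prod_eq_iff)
  next
    assume "B = B23"
    note vw' = vw[unfolded this B23_def simps]
    have "fst v + snd v = fst w + snd w" by (rule 3) (use vw' in blast)+
    moreover have "snd v = snd w" by (rule 2) (use vw' in blast)+
    ultimately show ?thesis by (simp add: prod_eq_iff)
  qed
qed

lemma trace_integrals: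
  "trace_integral B1 (u1 - l1)"
  "trace_integral B2 (u2 - l2)"
  "trace_integral B3 (u3 - l3)"
  "trace_integral B12 ((u1 - l1) * (u2 - l2))"
  "trace_integral B13 ((u1 - l1) * (u3 - l3))"
  "trace_integral B23 ((u2 - l2) * (u3 - l3))"
proof -
  note area = area_sheared_rectangle
  show "trace_integral B1 (u1 - l1)"
  proof (rule has_integral_trace_indicator[OF B_borel(1)])
    show "emeasure lborel B1 = ennreal (u1 - l1)"
      using area(1)[of "- u1" "- l1" "-1" 0 0] ranges by (simp add: B1_def)
  qed (use unique_B ranges in auto)
  show "trace_integral B2 (u2 - l2)"
  proof (rule has_integral_trace_indicator[OF B_borel(2)])
    show "emeasure lborel B2 = ennreal (u2 - l2)"
      using area(2)[of "- u2" "- l2" "-1" 0 0] ranges by (simp add: B2_def)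
  qed (use unique_B ranges in auto)
  show "trace_integral B3 (u3 - l3)"
  proof (rule has_integral_trace_indicator[OF B_borel(3)])
    show "emeasure lborel B3 = ennreal (u3 - l3)"
      using area(1)[of "-1" 0 "- u3" "- l3" 1] ranges by (simp add: B3_def)
  qed (use unique_B ranges in auto)
  show "trace_integral B12 ((u1 - l1) * (u2 - l2))"
  proof (rule has_integral_trace_indicator[OF B_borel(4)])
    show "emeasure lborel B12 = ennreal ((u1 - l1) * (u2 - l2))"
      using area(1)[of "- u1" "- l1" "- u2" "- l2" 0] ranges by (simp add: B12_def)
  qed (use unique_B ranges in auto)
  show "trace_integral B13 ((u1 - l1) * (u3 - l3))"
  proof (rule has_integral_trace_indicator[OF B_borel(5)])
    show "emeasure lborel B13 = ennreal ((u1 - l1) * (u3 - l3))"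
      using area(1)[of "- u1" "- l1" "- u3" "- l3" 1] ranges by (simp add: B13_def)
  qed (use unique_B ranges in auto)
  show "trace_integral B23 ((u2 - l2) * (u3 - l3))"
  proof (rule has_integral_trace_indicator[OF B_borel(6)])
    show "emeasure lborel B23 = ennreal ((u2 - l2) * (u3 - l3))"
      using area(2)[of "- u2" "- l2" "- u3" "- l3" 1] ranges by (simp add: B23_def)
  qed (use unique_B ranges in auto)
qed

text \<open>The positions inside a fixed cell form a similar triangle, smaller by the side of the
circumscribed triangle. Reflection in the origin exchanges the two kinds of cells.\<close>
lemma empty_cell_integral:
  "trace_integral (Bup \<union> Bdown)
    ((1 - (u3 - l1 - l2))\<^sup>2 / 2 + (1 - (u1 + u2 - l3))\<^sup>2 / 2)"
proof (rule has_integral_trace_indicator)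
  have up: "emeasure lborel Bup = ennreal ((1 - (u3 - l1 - l2))\<^sup>2 / 2)"
    using area_corner_triangle[of "1 - u3" "- l1" "- l2"] fits_up by (simp add: Bup_def algebra_simps)
  have "Bdown = {z. - z \<in> {z. u1 - 1 < fst z \<and> u2 - 1 < snd z \<and> fst z + snd z < l3 - 1}}"
    by (auto simp: Bdown_def)
  then have "emeasure lborel Bdown = emeasure lborel {z::plane. u1 - 1 < fst z \<and> u2 - 1 < snd z \<and> fst z + snd z < l3 - 1}"
    by (simp only:) (rule emeasure_lborel_reflect, measurable)
  also have "\<dots> = ennreal ((1 - (u1 + u2 - l3))\<^sup>2 / 2)"
    using area_corner_triangle[of "l3 - 1" "u1 - 1" "u2 - 1"] fits_down by (simp add: algebra_simps)
  finally have down: "emeasure lborel Bdown = \<dots>" .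
  have "Bup \<inter> Bdown = {}" using ranges extremes by (auto simp: Bup_def Bdown_def)
  then show "emeasure lborel (Bup \<union> Bdown) = ennreal ((1 - (u3 - l1 - l2))\<^sup>2 / 2 + (1 - (u1 + u2 - l3))\<^sup>2 / 2)"
    by (subst plus_emeasure[symmetric]) (simp_all add: up down ennreal_plus[symmetric] del: ennreal_plus)
  show "v = w" if "z + lattice_point v \<in> Bup \<union> Bdown" "z + lattice_point w \<in> Bup \<union> Bdown" for z v w
  proof -
    have *: "0 < fst y + l1 \<and> fst y + u1 < 1 \<and> 0 < snd y + l2 \<and> snd y + u2 < 1" if "y \<in> Bup \<union> Bdown" for y
      using that extremes by (auto simp: Bup_def Bdown_def)
    show ?thesis using *[OF that(1)] *[OF that(2)] ranges
      by (simp add: lattice_point_def prod_eq_iff)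
  qed
qed auto

lemma vertex_integral:
  "trace_integral BV (measure lborel K)"
proof (rule has_integral_trace_indicator[OF BV_borel])
  have [measurable]: "K \<in> sets borel" using compact by (simp add: borel_compact)
  have fin: "emeasure lborel K = ennreal (measure lborel K)"
    using emeasure_compact_finite[OF compact] by (simp add: emeasure_eq_ennreal_measure)
  have ne: "AE z::plane in lborel. fst z \<noteq> - u1 \<and> snd z \<noteq> - u2"
    using AE_not_integer_offset(1)[of u1] AE_not_integer_offset(2)[of u2]
    by eventually_elim (auto simp: )
  have "emeasure lborel BV = emeasure lborel {z. - z \<in> K}"
  proof (rule emeasure_eq_AE)
    show "AE z in lborel. z \<in> BV \<longleftrightarrow> z \<in> {z. - z \<in> K}"
      using ne by eventually_elim (use bounds in \<open>fastforce simp: BV_def\<close>)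
    have [measurable]: "(\<lambda>z::plane. - z) \<in> borel \<rightarrow>\<^sub>M borel"
      by (intro borel_measurable_continuous_onI continuous_intros)
    show "{z. - z \<in> K} \<in> sets lborel" by measurable
  qed simp
  then show "emeasure lborel BV = ennreal (measure lborel K)"
    using emeasure_lborel_reflect[of K] fin by simp
  show "v = w" if "z + lattice_point v \<in> BV" "z + lattice_point w \<in> BV" for z v w
  proof -
    have *: "fst y \<le> - l1 \<and> - u1 < fst y \<and> snd y \<le> - l2 \<and> - u2 < snd y" if "y \<in> BV" for y
      using that bounds[of "- y"] by (auto simp: BV_def)
    show ?thesis using *[OF that(1)] *[OF that(2)] widths
      by (simp add: lattice_point_def prod_eq_iff)
  qed
qed simp

lemma AE_generic: "AE z in lborel. generic z"
  unfolding generic_def using AE_not_integer_offset by (simp add: AE_conj_iff)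

text \<open>For two families the two integers may be chosen independently: \<open>(i, j) \<mapsto> (i, i + j)\<close> is a
bijection of \<open>\<int> \<times> \<int>\<close>. A single family leaves the other integer free, and the unit strip in the
definition of the set selects one.\<close>
lemma trace_lines:
  assumes "z \<in> unit_square"
  shows "z \<in> torus_trace B1 \<longleftrightarrow> meets1 z" "z \<in> torus_trace B2 \<longleftrightarrow> meets2 z" "z \<in> torus_trace B3 \<longleftrightarrow> meets3 z"
    "z \<in> torus_trace B12 \<longleftrightarrow> meets1 z \<and> meets2 z" "z \<in> torus_trace B13 \<longleftrightarrow> meets1 z \<and> meets3 z"
    "z \<in> torus_trace B23 \<longleftrightarrow> meets2 z \<and> meets3 z"
proof -
  have tr: "z \<in> torus_trace B \<longleftrightarrow> (\<exists>i j. z - lattice_point (i, j) \<in> B)" for B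
  proof -
    have neg: "lattice_point (- i, - j) = - lattice_point (i, j)" for i j by (simp add: lattice_point_def)
    have "z \<in> torus_trace B \<longleftrightarrow> (\<exists>i j. z + lattice_point (i, j) \<in> B)"
      using assms by (simp add: torus_trace_def split_paired_Ex)
    also have "\<dots> \<longleftrightarrow> (\<exists>i j. z + lattice_point (- i, - j) \<in> B)" by (metis minus_minus)
    finally show ?thesis unfolding neg by simp
  qed
  have ceil: "\<exists>i::int. -1 < x - of_int i \<and> x - of_int i \<le> 0" for x :: real
    by (intro exI[of _ "\<lceil>x\<rceil>"]) linarith
  have m1: "meets1 z \<longleftrightarrow> (\<exists>i::int. - u1 < fst z - of_int i \<and> fst z - of_int i \<le> - l1)"
    unfolding meets1_def by (intro ex_cong1) auto
  have m2: "meets2 z \<longleftrightarrow> (\<exists>i::int. - u2 < snd z - of_int i \<and> snd z - of_int i \<le> - l2)"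
    unfolding meets2_def by (intro ex_cong1) auto
  have m3: "meets3 z \<longleftrightarrow> (\<exists>i::int. - u3 < fst z + snd z - of_int i \<and> fst z + snd z - of_int i \<le> - l3)"
    unfolding meets3_def by (intro ex_cong1) auto
  show "z \<in> torus_trace B1 \<longleftrightarrow> meets1 z"
    unfolding tr m1 using ceil[of "snd z"] by (auto simp: B1_def lattice_point_def)
  show "z \<in> torus_trace B2 \<longleftrightarrow> meets2 z"
    unfolding tr m2 using ceil[of "fst z"] by (auto simp: B2_def lattice_point_def)
  show "z \<in> torus_trace B12 \<longleftrightarrow> meets1 z \<and> meets2 z"
    unfolding tr m1 m2 by (auto simp: B12_def lattice_point_def)
  \<comment> \<open>change of the lattice basis\<close>
  have shear: "(\<exists>i j. P (i::int) (i + j :: int)) \<longleftrightarrow> (\<exists>i k. P i k)" for P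
    by (metis add_diff_cancel_left' add.commute diff_add_cancel)
  have B3: "z - lattice_point (i, j) \<in> B3 \<longleftrightarrow> -1 < fst z - of_int i \<and> fst z - of_int i \<le> 0 \<and>
     - u3 < fst z + snd z - of_int (i + j) \<and> fst z + snd z - of_int (i + j) \<le> - l3" for i j
    by (auto simp: B3_def lattice_point_def)
  show "z \<in> torus_trace B3 \<longleftrightarrow> meets3 z"
    unfolding tr m3 B3 using ceil[of "fst z"]
      shear[of "\<lambda>i k. -1 < fst z - of_int i \<and> fst z - of_int i \<le> 0 \<and> - u3 < fst z + snd z - of_int k \<and> fst z + snd z - of_int k \<le> - l3"]
    by blast
  have B13: "z - lattice_point (i, j) \<in> B13 \<longleftrightarrow> - u1 < fst z - of_int i \<and> fst z - of_int i \<le> - l1 \<and>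
     - u3 < fst z + snd z - of_int (i + j) \<and> fst z + snd z - of_int (i + j) \<le> - l3" for i j
    by (auto simp: B13_def lattice_point_def)
  show "z \<in> torus_trace B13 \<longleftrightarrow> meets1 z \<and> meets3 z"
    unfolding tr m1 m3 B13
      shear[of "\<lambda>i k. - u1 < fst z - of_int i \<and> fst z - of_int i \<le> - l1 \<and> - u3 < fst z + snd z - of_int k \<and> fst z + snd z - of_int k \<le> - l3"]
    by blast
  have B23: "z - lattice_point (i, j) \<in> B23 \<longleftrightarrow> - u2 < snd z - of_int j \<and> snd z - of_int j \<le> - l2 \<and>
     - u3 < fst z + snd z - of_int (j + i) \<and> fst z + snd z - of_int (j + i) \<le> - l3" for i j
    by (auto simp: B23_def lattice_point_def)
  show "z \<in> torus_trace B23 \<longleftrightarrow> meets2 z \<and> meets3 z"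
    unfolding tr m2 m3 B23
    using shear[of "\<lambda>i k. - u2 < snd z - of_int i \<and> snd z - of_int i \<le> - l2 \<and> - u3 < fst z + snd z - of_int k \<and> fst z + snd z - of_int k \<le> - l3"]
    by blast
qed

lemma floor_between:
  assumes "\<not> (\<exists>i::int. x + l \<le> of_int i \<and> of_int i < x + u)" "x + l \<notin> \<int>" "x + u \<notin> \<int>" "l \<le> u"
  shows "of_int \<lfloor>x + l\<rfloor> < x + l" "x + u < of_int \<lfloor>x + l\<rfloor> + (1::real)"
proof -
  have "of_int \<lfloor>x + l\<rfloor> \<noteq> x + l" using assms(2) by (metis Ints_of_int)
  then show "of_int \<lfloor>x + l\<rfloor> < x + l" by (simp add: less_le)
  have "x + l \<le> of_int (\<lfloor>x + l\<rfloor> + 1)" by linarith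
  then have "\<not> of_int (\<lfloor>x + l\<rfloor> + 1) < x + u" using assms(1) by blast
  moreover have "of_int (\<lfloor>x + l\<rfloor> + 1) \<noteq> x + u" using assms(3) by (metis Ints_of_int)
  ultimately show "x + u < of_int \<lfloor>x + l\<rfloor> + (1::real)" by simp
qed

text \<open>If no line is met, then the integer parts of the three least coordinates name a strip of each
family that contains the body. Such a triple of strips contains a point only if it is a cell.\<close>
lemma trace_empty:
  assumes "z \<in> unit_square" "generic z"
  shows "z \<in> torus_trace (Bup \<union> Bdown) \<longleftrightarrow> \<not> meets1 z \<and> \<not> meets2 z \<and> \<not> meets3 z"
proof
  assume "z \<in> torus_trace (Bup \<union> Bdown)"
  then obtain v where v: "z + lattice_point v \<in> Bup \<union> Bdown" by (auto simp: torus_trace_def)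
  define i j where "i = fst v" and "j = snd v"
  have e: "fst (lattice_point v) = of_int i" "snd (lattice_point v) = of_int j"
    by (simp_all add: lattice_point_def i_def j_def)
  obtain k :: int where
    "0 < fst z + of_int i + l1" "fst z + of_int i + u1 < 1" "0 < snd z + of_int j + l2" "snd z + of_int j + u2 < 1"
    "of_int k < fst z + snd z + l3 + of_int i + of_int j" "fst z + snd z + of_int i + of_int j + u3 < of_int k + 1"
  proof (cases "z + lattice_point v \<in> Bup")
    case True
    then show ?thesis using extremes ranges by (intro that[of 0]) (auto simp: Bup_def e)
  next
    case False
    then show ?thesis using v extremes ranges by (intro that[of 1]) (auto simp: Bdown_def e)
  qed
  note b = this
  have no_int: "\<not> (0 < real_of_int m \<and> real_of_int m < 1)" for m by auto
  have "False" if "meets1 z" using that b(1,2) unfolding meets1_def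
  proof clarify
    fix n assume "fst z + l1 \<le> of_int n" "of_int n < fst z + u1"
    then have "0 < real_of_int (n + i)" "real_of_int (n + i) < 1" using b by linarith+
    then show False using no_int by blast
  qed
  moreover have "False" if "meets2 z" using that b(3,4) unfolding meets2_def
  proof clarify
    fix n assume "snd z + l2 \<le> of_int n" "of_int n < snd z + u2"
    then have "0 < real_of_int (n + j)" "real_of_int (n + j) < 1" using b by linarith+
    then show False using no_int by blast
  qed
  moreover have "False" if "meets3 z" using that b(5,6) unfolding meets3_def
  proof clarify
    fix n assume "fst z + snd z + l3 \<le> of_int n" "of_int n < fst z + snd z + u3"
    then have "0 < real_of_int (n + i + j - k)" "real_of_int (n + i + j - k) < 1" using b by linarith+
    then show False using no_int by blast
  qed
  ultimately show "\<not> meets1 z \<and> \<not> meets2 z \<and> \<not> meets3 z" by blast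
next
  assume n: "\<not> meets1 z \<and> \<not> meets2 z \<and> \<not> meets3 z"
  define i j k where "i = \<lfloor>fst z + l1\<rfloor>" and "j = \<lfloor>snd z + l2\<rfloor>" and "k = \<lfloor>fst z + snd z + l3\<rfloor>"
  have b: "of_int i < fst z + l1" "fst z + u1 < of_int i + 1" "of_int j < snd z + l2" "snd z + u2 < of_int j + 1"
    "of_int k < fst z + snd z + l3" "fst z + snd z + u3 < of_int k + 1"
    using floor_between[of "fst z" l1 u1] floor_between[of "snd z" l2 u2] floor_between[of "fst z + snd z" l3 u3]
      n assms(2) ranges unfolding meets1_def meets2_def meets3_def generic_def i_def j_def k_def by simp_all
  then have "of_int (i + j) < real_of_int (k + 1)" "real_of_int k < of_int (i + j + 2)"
    using extremes ranges by simp_all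
  then have "k = i + j \<or> k = i + j + 1" by linarith
  then have "z + lattice_point (- i, - j) \<in> Bup \<union> Bdown"
    using b by (elim disjE) (auto simp: Bup_def Bdown_def lattice_point_def)
  then show "z \<in> torus_trace (Bup \<union> Bdown)" using assms(1) by (auto simp: torus_trace_def)
qed

lemma translate_iff: "p \<in> (+) z ` K \<longleftrightarrow> p - z \<in> K"
  by (metis (no_types, lifting) add_diff_cancel_left' diff_add_cancel add.commute image_iff)

lemma trace_vertex:
  assumes "z \<in> unit_square" "generic z"
  shows "z \<in> torus_trace BV \<longleftrightarrow> covers_vertex z"
proof
  assume "z \<in> torus_trace BV"
  then obtain v where v: "z + lattice_point v \<in> BV" by (auto simp: torus_trace_def)
  have "(of_int (- fst v), of_int (- snd v)) - z = - (z + lattice_point v)"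
    by (auto simp: lattice_point_def prod_eq_iff)
  then show "covers_vertex z"
    using v unfolding covers_vertex_def translate_iff BV_def by (metis (mono_tags, lifting) mem_Collect_eq)
next
  assume "covers_vertex z"
  then obtain i j :: int where p: "(of_int i, of_int j) - z \<in> K"
    by (auto simp: covers_vertex_def translate_iff)
  have "fst z + u1 \<noteq> of_int i" "snd z + u2 \<noteq> of_int j" using assms(2) unfolding generic_def by (metis Ints_of_int)+
  then have "- u1 < fst z - of_int i" "- u2 < snd z - of_int j" using bounds(2,4)[OF p] by auto
  moreover have "- (z + lattice_point (- i, - j)) = (of_int i, of_int j) - z"
    by (auto simp: lattice_point_def prod_eq_iff)
  ultimately have "z + lattice_point (- i, - j) \<in> BV" using p by (auto simp: BV_def lattice_point_def)
  then show "z \<in> torus_trace BV" using assms(1) by (auto simp: torus_trace_def)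
qed

lemma covers_vertex_meets:
  assumes "generic z" "covers_vertex z"
  shows "meets1 z" "meets2 z" "meets3 z"
proof -
  obtain i j :: int where p: "(of_int i, of_int j) - z \<in> K"
    using assms(2) by (auto simp: covers_vertex_def translate_iff)
  have "fst z + u1 \<noteq> of_int i" "snd z + u2 \<noteq> of_int j" "fst z + snd z + u3 \<noteq> of_int (i + j)"
    using assms(1) unfolding generic_def by (metis Ints_of_int)+
  then have "fst z + l1 \<le> of_int i \<and> of_int i < fst z + u1" "snd z + l2 \<le> of_int j \<and> of_int j < snd z + u2"
    "fst z + snd z + l3 \<le> of_int (i + j) \<and> of_int (i + j) < fst z + snd z + u3"
    using bounds[OF p] by auto
  then show "meets1 z" "meets2 z" "meets3 z" unfolding meets1_def meets2_def meets3_def by blast+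
qed

lemma hit_count:
  assumes "generic z"
  shows "card (hit_cells ((+) z ` K)) = 1 + of_bool (meets1 z) + of_bool (meets2 z) + of_bool (meets3 z)
    + 2 * of_bool (covers_vertex z)"
  unfolding meets1_def meets2_def meets3_def covers_vertex_def
proof (rule generic_hit_count)
  show "convex ((+) z ` K)" by (rule convex_translation[OF convex])
  have "fst ` (+) z ` K = (+) (fst z) ` fst ` K" by (simp add: image_image)
  then show "fst ` (+) z ` K = {fst z + l1..fst z + u1}" by (simp add: fst_image)
  have "snd ` (+) z ` K = (+) (snd z) ` snd ` K" by (simp add: image_image)
  then show "snd ` (+) z ` K = {snd z + l2..snd z + u2}" by (simp add: snd_image)
  have "(\<lambda>p. fst p + snd p) ` (+) z ` K = (+) (fst z + snd z) ` (\<lambda>p. fst p + snd p) ` K"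
    by (simp add: image_image algebra_simps)
  then show "(\<lambda>p. fst p + snd p) ` (+) z ` K = {fst z + snd z + l3..fst z + snd z + u3}" by (simp add: sum_image)
qed (use assms ranges widths in \<open>auto simp: generic_def\<close>)

definition "t_up = u3 - l1 - l2"
definition "t_down = u1 + u2 - l3"
definition "pair_sum = (u1 - l1) * (u2 - l2) + (u1 - l1) * (u3 - l3) + (u2 - l2) * (u3 - l3)"
definition "no_line = ((1 - t_up)\<^sup>2 + (1 - t_down)\<^sup>2) / 2"
definition "three_lines = 1 - (t_up + t_down) + pair_sum - no_line"

text \<open>The indicator of each event is almost everywhere a fixed linear combination of indicators of
traces, whose integrals are known. The trace for three families is not that of a packing; it is
replaced by inclusion and exclusion from the event that no line is met.\<close>
lemma hit_measures:
  assumes meas: "\<And>n. hit_positions K n \<in> sets borel"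
  defines "M n \<equiv> measure lborel (hit_positions K n)"
  shows "M 1 = no_line"
    "M 2 = (t_up + t_down) - 2 * pair_sum + 3 * three_lines"
    "M 3 = pair_sum - 3 * three_lines"
    "M 4 = three_lines - measure lborel K"
    "M 5 = 0"
    "M 6 = measure lborel K"
proof -
  define I :: "plane set \<Rightarrow> plane \<Rightarrow> real" where "I B = indicator (torus_trace B)" for B
  define S :: "plane \<Rightarrow> real" where "S = indicator unit_square"
  note int = trace_integrals[folded I_def] empty_cell_integral[folded I_def] vertex_integral[folded I_def]
  have intS: "has_bochner_integral lborel S 1"
    unfolding S_def using has_bochner_integral_real_indicator[of unit_square lborel] emeasure_unit_square
    by (simp add: measure_def)
  have intM: "has_bochner_integral lborel (indicator (hit_positions K n) :: plane \<Rightarrow> real) (M n)" for n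
    unfolding M_def
  proof (rule has_bochner_integral_real_indicator)
    show "emeasure lborel (hit_positions K n) < \<infinity>"
      using emeasure_mono[of "hit_positions K n" unit_square lborel] emeasure_unit_square
      by (auto simp: hit_positions_def le_less_trans[OF _ ennreal_one_less_top])
  qed (simp add: meas)
  \<comment> \<open>inclusion and exclusion: almost everywhere the indicator of meeting all three families\<close>
  define T where "T z = S z - I B1 z - I B2 z - I B3 z + I B12 z + I B13 z + I B23 z - I (Bup \<union> Bdown) z" for z
  have intT: "has_bochner_integral lborel T three_lines"
  proof -
    have "has_bochner_integral lborel T (1 - (u1 - l1) - (u2 - l2) - (u3 - l3) + (u1 - l1) * (u2 - l2)
      + (u1 - l1) * (u3 - l3) + (u2 - l2) * (u3 - l3) - ((1 - (u3 - l1 - l2))\<^sup>2 / 2 + (1 - (u1 + u2 - l3))\<^sup>2 / 2))"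
      unfolding T_def by (intro has_bochner_integral_add has_bochner_integral_diff int intS)
    then show ?thesis
      by (rule back_subst[where P = "has_bochner_integral lborel T"])
        (simp add: three_lines_def pair_sum_def no_line_def t_up_def t_down_def field_simps)
  qed
  define P where "P z = I B12 z + I B13 z + I B23 z" for z
  have intP: "has_bochner_integral lborel P pair_sum"
    unfolding P_def pair_sum_def by (intro has_bochner_integral_add int)
  define L where "L z = I B1 z + I B2 z + I B3 z" for z
  have intL: "has_bochner_integral lborel L (t_up + t_down)"
  proof -
    have "has_bochner_integral lborel L ((u1 - l1) + (u2 - l2) + (u3 - l3))"
      unfolding L_def by (intro has_bochner_integral_add int)
    then show ?thesis
      by (rule back_subst[where P = "has_bochner_integral lborel L"]) (simp add: t_up_def t_down_def)
  qed
  have int0: "has_bochner_integral lborel (I (Bup \<union> Bdown)) no_line"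
    using int(7) by (simp add: no_line_def t_up_def t_down_def add_divide_distrib)
  have vals: "I B1 z = of_bool (z \<in> unit_square \<and> meets1 z)" "I B2 z = of_bool (z \<in> unit_square \<and> meets2 z)"
    "I B3 z = of_bool (z \<in> unit_square \<and> meets3 z)" "I B12 z = of_bool (z \<in> unit_square \<and> meets1 z \<and> meets2 z)"
    "I B13 z = of_bool (z \<in> unit_square \<and> meets1 z \<and> meets3 z)" "I B23 z = of_bool (z \<in> unit_square \<and> meets2 z \<and> meets3 z)"
    "I (Bup \<union> Bdown) z = of_bool (z \<in> unit_square \<and> \<not> meets1 z \<and> \<not> meets2 z \<and> \<not> meets3 z)"
    "I BV z = of_bool (z \<in> unit_square \<and> covers_vertex z)" "S z = of_bool (z \<in> unit_square)"
    if "generic z" for z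
    using trace_lines[of z] trace_empty[of z] trace_vertex[of z] that
    by (cases "z \<in> unit_square"; simp add: I_def S_def indicator_def torus_trace_def)+
  have ae: "AE z in lborel. indicator (hit_positions K n) z = f z"
    if "\<And>z. generic z \<Longrightarrow> indicator (hit_positions K n) z = f z" for n and f :: "plane \<Rightarrow> real"
    using AE_generic that by auto
  note defs = T_def P_def L_def
  show "M 1 = no_line"
  proof (rule has_bochner_integral_eq_AE[OF intM int0 ae])
    fix z assume g: "generic z"
    show "indicator (hit_positions K 1) z = I (Bup \<union> Bdown) z"
      unfolding vals[OF g] using hit_count[OF g] by (auto simp: indicator_def hit_positions_def dest: covers_vertex_meets[OF g])
  qed
  have cases: "indicator (hit_positions K n) z = (if z \<in> unit_square \<and>
      1 + of_bool (meets1 z) + of_bool (meets2 z) + of_bool (meets3 z) + 2 * of_bool (covers_vertex z) = n then 1 else 0 :: real)"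
      "covers_vertex z \<Longrightarrow> meets1 z \<and> meets2 z \<and> meets3 z" if "generic z" for n z
    using hit_count[OF that] covers_vertex_meets[OF that] by (auto simp: hit_positions_def)
  have combination: "M n = v"
    if "has_bochner_integral lborel f v" and "\<And>z. generic z \<Longrightarrow> indicator (hit_positions K n) z = f z" for n v f
    by (rule has_bochner_integral_eq_AE[OF intM that(1) ae[OF that(2)]])
  have "has_bochner_integral lborel (\<lambda>z. L z - 2 * P z + 3 * T z) (t_up + t_down - 2 * pair_sum + 3 * three_lines)"
    by (intro has_bochner_integral_add has_bochner_integral_diff has_bochner_integral_mult_right intL intP intT)
  then show "M 2 = (t_up + t_down) - 2 * pair_sum + 3 * three_lines"
  proof (rule combination)
    fix z assume g: "generic z"
    show "indicator (hit_positions K 2) z = L z - 2 * P z + 3 * T z"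
      unfolding defs vals[OF g] cases(1)[OF g] using cases(2)[OF g]
      by (cases "covers_vertex z"; cases "meets1 z"; cases "meets2 z"; cases "meets3 z"; simp)
  qed
  have "has_bochner_integral lborel (\<lambda>z. P z - 3 * T z) (pair_sum - 3 * three_lines)"
    by (intro has_bochner_integral_diff has_bochner_integral_mult_right intP intT)
  then show "M 3 = pair_sum - 3 * three_lines"
  proof (rule combination)
    fix z assume g: "generic z"
    show "indicator (hit_positions K 3) z = P z - 3 * T z"
      unfolding defs vals[OF g] cases(1)[OF g] using cases(2)[OF g]
      by (cases "covers_vertex z"; cases "meets1 z"; cases "meets2 z"; cases "meets3 z"; simp)
  qed
  have "has_bochner_integral lborel (\<lambda>z. T z - I BV z) (three_lines - measure lborel K)"
    by (intro has_bochner_integral_diff intT int)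
  then show "M 4 = three_lines - measure lborel K"
  proof (rule combination)
    fix z assume g: "generic z"
    show "indicator (hit_positions K 4) z = T z - I BV z"
      unfolding defs vals[OF g] cases(1)[OF g] using cases(2)[OF g]
      by (cases "covers_vertex z"; cases "meets1 z"; cases "meets2 z"; cases "meets3 z"; simp)
  qed
  show "M 5 = 0"
  proof (rule combination[OF has_bochner_integral_zero])
    fix z assume g: "generic z"
    show "indicator (hit_positions K 5) z = (0::real)"
      unfolding cases(1)[OF g] using cases(2)[OF g]
      by (cases "covers_vertex z"; cases "meets1 z"; cases "meets2 z"; cases "meets3 z"; simp)
  qed
  show "M 6 = measure lborel K"
  proof (rule combination[OF int(8)])
    fix z assume g: "generic z"
    show "indicator (hit_positions K 6) z = I BV z"
      unfolding vals[OF g] cases(1)[OF g] using cases(2)[OF g]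
      by (cases "covers_vertex z"; cases "meets1 z"; cases "meets2 z"; cases "meets3 z"; simp)
  qed
qed

end

section \<open>Angles and sides of a triangle\<close>

locale triangle_sides_angles =
  fixes a b c \<alpha> \<beta> \<gamma> :: real
  assumes sides_pos: "0 < a" "0 < b" "0 < c"
    and angles_pos: "0 < \<alpha>" "0 < \<beta>" "0 < \<gamma>"
    and angle_sum: "\<alpha> + \<beta> + \<gamma> = pi"
    and law_of_sines: "b * sin \<gamma> = c * sin \<beta>" "a * sin \<gamma> = c * sin \<alpha>" "a * sin \<beta> = b * sin \<alpha>"
    and law_of_cosines: "2 * b * c * cos \<alpha> = b\<^sup>2 + c\<^sup>2 - a\<^sup>2" "2 * c * a * cos \<beta> = c\<^sup>2 + a\<^sup>2 - b\<^sup>2"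
      "2 * a * b * cos \<gamma> = a\<^sup>2 + b\<^sup>2 - c\<^sup>2"

text \<open>The last equation is Heron's formula for four times the squared area, in a form symmetric
in the three sides after expansion.\<close>
lemma vangle_law_of_cosines:
  fixes u v :: plane
  assumes "\<not> collinear {0, u, v}"
  defines "\<theta> \<equiv> vangle u v"
  shows "2 * norm u * norm v * cos \<theta> = (norm u)\<^sup>2 + (norm v)\<^sup>2 - (norm (u - v))\<^sup>2" "0 < \<theta>" "\<theta> < pi"
    "0 < norm u" "0 < norm v"
    "(norm u * norm v * sin \<theta>)\<^sup>2 = (norm u)\<^sup>2 * (norm v)\<^sup>2 - (((norm u)\<^sup>2 + (norm v)\<^sup>2 - (norm (u - v))\<^sup>2) / 2)\<^sup>2"
proof -
  have "u \<noteq> 0" "v \<noteq> 0" using assms by (auto simp: insert_commute)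
  then show pos: "0 < norm u" "0 < norm v" by auto
  have "\<bar>u \<bullet> v\<bar> \<noteq> norm u * norm v" using assms norm_cauchy_schwarz_equal by blast
  then have "\<bar>u \<bullet> v\<bar> < norm u * norm v" using Cauchy_Schwarz_ineq2[of u v] by linarith
  then have q: "\<bar>u \<bullet> v / (norm u * norm v)\<bar> < 1" using pos by (simp add: abs_mult)
  then have cos: "cos \<theta> = u \<bullet> v / (norm u * norm v)" unfolding \<theta>_def vangle_def by (intro cos_arccos_abs) simp
  show "0 < \<theta>" "\<theta> < pi" unfolding \<theta>_def vangle_def using arccos_lt_bounded[of "u \<bullet> v / (norm u * norm v)"] q[unfolded abs_less_iff] by linarith+
  have d: "(norm (u - v))\<^sup>2 = (norm u)\<^sup>2 + (norm v)\<^sup>2 - 2 * (u \<bullet> v)"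
    unfolding power2_norm_eq_inner by (simp add: inner_diff inner_commute)
  have c: "norm u * norm v * cos \<theta> = u \<bullet> v" using cos pos by simp
  then show "2 * norm u * norm v * cos \<theta> = (norm u)\<^sup>2 + (norm v)\<^sup>2 - (norm (u - v))\<^sup>2" using d by simp
  have "(norm u * norm v * sin \<theta>)\<^sup>2 = (norm u)\<^sup>2 * (norm v)\<^sup>2 - (norm u * norm v * cos \<theta>)\<^sup>2"
    unfolding power_mult_distrib sin_squared_eq by (simp add: algebra_simps)
  then show "(norm u * norm v * sin \<theta>)\<^sup>2 = (norm u)\<^sup>2 * (norm v)\<^sup>2 - (((norm u)\<^sup>2 + (norm v)\<^sup>2 - (norm (u - v))\<^sup>2) / 2)\<^sup>2"
    unfolding c d by simp
qed

text \<open>Twice the area, \<open>D = c b sin \<alpha>\<close>, has the same value at all three vertices because its square is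
symmetric in the sides; this is the law of sines. The sum of the angles then follows by expanding
\<open>sin (\<alpha> + \<beta>)\<close> and \<open>cos (\<alpha> + \<beta>)\<close>.\<close>
lemma triangle_data_imp_sides_angles:
  assumes "triangle_data a b c \<alpha> \<beta> \<gamma>"
  shows "triangle_sides_angles a b c \<alpha> \<beta> \<gamma>"
proof -
  obtain A B C :: plane where ncol: "\<not> collinear {A, B, C}"
    and a: "a = dist B C" and b: "b = dist C A" and c: "c = dist A B"
    and al: "\<alpha> = vangle (B - A) (C - A)" and be: "\<beta> = vangle (C - B) (A - B)" and ga: "\<gamma> = vangle (A - C) (B - C)"
    using assms unfolding triangle_data_def by blast
  have col: "\<not> collinear {0, B - A, C - A}" "\<not> collinear {0, C - B, A - B}" "\<not> collinear {0, A - C, B - C}"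
    using ncol collinear_3[of B A C] collinear_3[of C B A] collinear_3[of A C B]
    by (simp_all add: insert_commute)
  have n: "norm (B - A) = c" "norm (C - A) = b" "norm (C - B) = a" "norm (A - B) = c" "norm (A - C) = b" "norm (B - C) = a"
    using a b c by (simp_all add: dist_norm norm_minus_commute)
  have d: "B - A - (C - A) = B - C" "C - B - (A - B) = C - A" "A - C - (B - C) = A - B" by simp_all
  note 1 = vangle_law_of_cosines[OF col(1), folded al, unfolded d n]
  note 2 = vangle_law_of_cosines[OF col(2), folded be, unfolded d n]
  note 3 = vangle_law_of_cosines[OF col(3), folded ga, unfolded d n]
  have pos: "0 < a" "0 < b" "0 < c" using 1 2 by auto
  have sp: "0 < sin \<alpha>" "0 < sin \<beta>" "0 < sin \<gamma>" using 1 2 3 by (auto intro: sin_gt_zero)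
  define D where "D = c * b * sin \<alpha>"
  have D: "0 < D" unfolding D_def using pos sp by simp
  have "D\<^sup>2 = (a * c * sin \<beta>)\<^sup>2" "D\<^sup>2 = (b * a * sin \<gamma>)\<^sup>2"
    unfolding D_def 1(6) 2(6) 3(6) by (simp_all add: power2_eq_square field_simps)
  then have D2: "D = a * c * sin \<beta>" "D = b * a * sin \<gamma>"
    using D pos sp power2_eq_iff_nonneg[of D "a * c * sin \<beta>"] power2_eq_iff_nonneg[of D "b * a * sin \<gamma>"] by simp_all
  have ls: "b * sin \<gamma> = c * sin \<beta>" "a * sin \<gamma> = c * sin \<alpha>" "a * sin \<beta> = b * sin \<alpha>"
  proof -
    have "a * (b * sin \<gamma>) = b * a * sin \<gamma>" "a * (c * sin \<beta>) = a * c * sin \<beta>" "b * (a * sin \<gamma>) = b * a * sin \<gamma>"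
      "b * (c * sin \<alpha>) = c * b * sin \<alpha>" "c * (a * sin \<beta>) = a * c * sin \<beta>" "c * (b * sin \<alpha>) = c * b * sin \<alpha>"
      by (simp_all only: ac_simps)
    then have "a * (b * sin \<gamma>) = a * (c * sin \<beta>)" "b * (a * sin \<gamma>) = b * (c * sin \<alpha>)" "c * (a * sin \<beta>) = c * (b * sin \<alpha>)"
      using D2 D_def by metis+
    then show "b * sin \<gamma> = c * sin \<beta>" "a * sin \<gamma> = c * sin \<alpha>" "a * sin \<beta> = b * sin \<alpha>"
      using pos by simp_all
  qed
  have e: "2 * a * c * cos \<beta> = c\<^sup>2 + a\<^sup>2 - b\<^sup>2" "2 * c * b * cos \<alpha> = c\<^sup>2 + b\<^sup>2 - a\<^sup>2"
    "2 * b * a * cos \<gamma> = a\<^sup>2 + b\<^sup>2 - c\<^sup>2"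
    using 1(1) 2(1) 3(1) by (simp_all add: algebra_simps)
  have sinsum: "sin (\<alpha> + \<beta>) = sin \<gamma>"
  proof -
    have "2 * a * b * c * sin (\<alpha> + \<beta>) = (2 * a * c * cos \<beta>) * (b * sin \<alpha>) + (2 * c * b * cos \<alpha>) * (a * sin \<beta>)"
      unfolding sin_add by (simp add: algebra_simps)
    also have "\<dots> = (2 * c * c) * (b * sin \<alpha>)"
      unfolding e ls(3) by (simp add: algebra_simps power2_eq_square)
    also have "\<dots> = 2 * c * D" unfolding D_def by simp
    also have "\<dots> = 2 * a * b * c * sin \<gamma>" unfolding D2(2) by simp
    finally show ?thesis using pos by simp
  qed
  have "cos (\<alpha> + \<beta>) = cos (pi - \<gamma>)"
  proof -
    have "(2 * a * b * c * c) * cos (\<alpha> + \<beta>)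
        = ((2 * a * c * cos \<beta>) * (2 * c * b * cos \<alpha>)) / 2 - 2 * ((c * b * sin \<alpha>) * (a * c * sin \<beta>))"
      unfolding cos_add by (simp add: algebra_simps)
    also have "(c * b * sin \<alpha>) * (a * c * sin \<beta>) = D\<^sup>2"
      by (simp only: D2(1)[symmetric] D_def[symmetric] power2_eq_square)
    also have "D\<^sup>2 = c\<^sup>2 * b\<^sup>2 - ((c\<^sup>2 + b\<^sup>2 - a\<^sup>2) / 2)\<^sup>2" using 1(6) unfolding D_def .
    also have "(2 * a * c * cos \<beta>) * (2 * c * b * cos \<alpha>) / 2 - 2 * (c\<^sup>2 * b\<^sup>2 - ((c\<^sup>2 + b\<^sup>2 - a\<^sup>2) / 2)\<^sup>2)
        = - (c * c * (2 * b * a * cos \<gamma>))"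
      unfolding e by (simp add: power2_eq_square field_simps)
    finally have "(2 * a * b * c * c) * cos (\<alpha> + \<beta>) = (2 * a * b * c * c) * - cos \<gamma>"
      by (simp add: algebra_simps)
    moreover have "2 * a * b * c * c \<noteq> 0" using pos by simp
    ultimately have "cos (\<alpha> + \<beta>) = - cos \<gamma>" by (metis mult_left_cancel)
    then show ?thesis unfolding cos_diff by simp
  qed
  moreover have "\<alpha> + \<beta> \<le> pi"
    using sp(3) sinsum 1 2 sin_le_zero[of "\<alpha> + \<beta>"] by fastforce
  ultimately have "\<alpha> + \<beta> = pi - \<gamma>"
    using 1 2 3 cos_inj_pi[of "\<alpha> + \<beta>" "pi - \<gamma>"] by simp
  then have sum: "\<alpha> + \<beta> + \<gamma> = pi" by simp
  have lc: "2 * b * c * cos \<alpha> = b\<^sup>2 + c\<^sup>2 - a\<^sup>2" "2 * c * a * cos \<beta> = c\<^sup>2 + a\<^sup>2 - b\<^sup>2"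
    "2 * a * b * cos \<gamma> = a\<^sup>2 + b\<^sup>2 - c\<^sup>2"
    using e by (simp_all only: mult.commute[of b a] mult.commute[of c b] mult.commute[of c a] mult.assoc[of 2] add.commute[of "b\<^sup>2" "c\<^sup>2"])
  show ?thesis by (rule triangle_sides_angles.intro; fact pos ls lc sum 1(2) 2(2) 3(2))
qed

section \<open>The triangles of the lattice\<close>

text \<open>A component that contains a member \<open>D\<close> cannot leave it: \<open>D\<close> and the union of the other members
would separate it.\<close>
lemma components_of_disjoint_open_family:
  assumes "\<And>D. D \<in> \<D> \<Longrightarrow> open D \<and> connected D \<and> D \<noteq> {}" "pairwise disjnt \<D>"
  shows "components (\<Union>\<D>) = \<D>"
proof -
  have comp: "connected_component_set (\<Union>\<D>) x = D" if D: "D \<in> \<D>" "x \<in> D" for D x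
  proof
    show "D \<subseteq> connected_component_set (\<Union>\<D>) x"
      using D assms(1) by (intro connected_component_maximal) auto
    let ?C = "connected_component_set (\<Union>\<D>) x"
    have "D \<inter> \<Union>(\<D> - {D}) \<inter> ?C = {}" using assms(2) D(1) unfolding pairwise_def disjnt_def by blast
    moreover have "?C \<subseteq> D \<union> \<Union>(\<D> - {D})" using connected_component_subset[of "\<Union>\<D>" x] by blast
    moreover have "open D" "open (\<Union>(\<D> - {D}))" using assms(1) D(1) by auto
    moreover have "x \<in> D \<inter> ?C" using D by auto
    ultimately have "\<Union>(\<D> - {D}) \<inter> ?C = {}"
      using connectedD[OF connected_connected_component, of D "\<Union>(\<D> - {D})" "\<Union>\<D>" x] by blast
    then show "?C \<subseteq> D" using connected_component_subset[of "\<Union>\<D>" x] by blast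
  qed
  show ?thesis
  proof (intro set_eqI iffI)
    fix S assume "S \<in> components (\<Union>\<D>)"
    then show "S \<in> \<D>" using comp unfolding components_def by auto
  next
    fix S assume S: "S \<in> \<D>"
    then obtain x where "x \<in> S" using assms(1) by blast
    then show "S \<in> components (\<Union>\<D>)" using comp[OF S] S unfolding components_def by blast
  qed
qed

definition open_cell :: "int \<times> int \<times> int \<Rightarrow> plane set" where
  "open_cell = (\<lambda>(i, j, k). {p. of_int i < fst p \<and> fst p < of_int i + 1 \<and>
     of_int j < snd p \<and> snd p < of_int j + 1 \<and>
     of_int k < fst p + snd p \<and> fst p + snd p < of_int k + 1})"

definition cell_center :: "int \<times> int \<times> int \<Rightarrow> plane" where
  "cell_center = (\<lambda>(i, j, k). if k = i + j then (of_int i + 1/3, of_int j + 1/3) else (of_int i + 2/3, of_int j + 2/3))"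

lemma cell_center_in_open_cell: "s \<in> cell_index \<Longrightarrow> cell_center s \<in> open_cell s"
  by (auto simp: cell_index_def cell_center_def open_cell_def)

lemma convex_open_cell: "convex (open_cell s)"
  and closed_cell: "closed (cell s)" and open_open_cell: "open (open_cell s)"
proof -
  obtain i j k where s: "s = (i, j, k)" by (cases s)
  let ?e1 = "(1, 0) :: plane" and ?e2 = "(0, 1) :: plane" and ?e3 = "(1, 1) :: plane"
  have "cell s = {p. ?e1 \<bullet> p \<ge> of_int i} \<inter> {p. ?e1 \<bullet> p \<le> of_int i + 1} \<inter> {p. ?e2 \<bullet> p \<ge> of_int j}
      \<inter> {p. ?e2 \<bullet> p \<le> of_int j + 1} \<inter> {p. ?e3 \<bullet> p \<ge> of_int k} \<inter> {p. ?e3 \<bullet> p \<le> of_int k + 1}"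
    unfolding s by (auto simp: cell_def inner_prod_def)
  then show "closed (cell s)"
    by (auto intro!: closed_Int closed_halfspace_ge closed_halfspace_le)
  have "open_cell s = {p. ?e1 \<bullet> p > of_int i} \<inter> {p. ?e1 \<bullet> p < of_int i + 1} \<inter> {p. ?e2 \<bullet> p > of_int j}
      \<inter> {p. ?e2 \<bullet> p < of_int j + 1} \<inter> {p. ?e3 \<bullet> p > of_int k} \<inter> {p. ?e3 \<bullet> p < of_int k + 1}"
    unfolding s by (auto simp: open_cell_def inner_prod_def)
  then show "convex (open_cell s)" "open (open_cell s)"
    by (auto intro!: convex_Int convex_halfspace_gt convex_halfspace_lt open_Int open_halfspace_gt open_halfspace_lt)
qed

text \<open>A cell is star-shaped around its centre, and all points of the segment from the centre to a
point of the cell, except possibly that point, are interior.\<close>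
lemma closure_open_cell:
  assumes "s \<in> cell_index"
  shows "closure (open_cell s) = cell s"
proof
  have "open_cell s \<subseteq> cell s" by (auto simp: open_cell_def cell_def)
  then show "closure (open_cell s) \<subseteq> cell s" using closed_cell by (rule closure_minimal)
  show "cell s \<subseteq> closure (open_cell s)"
  proof
    fix p assume p: "p \<in> cell s"
    obtain i j k where s: "s = (i, j, k)" by (cases s)
    define q where "q = cell_center s"
    have q: "q \<in> open_cell s" unfolding q_def by (rule cell_center_in_open_cell[OF assms])
    define t :: "nat \<Rightarrow> real" where "t n = inverse (of_nat (Suc n))" for n
    have t: "0 < t n" "t n \<le> 1" for n unfolding t_def by (simp_all add: inverse_le_1_iff)
    have mix: "l < x + t n * (y - x)" "y' + t n * (x' - y') < l'" if "l \<le> x" "l < y" "x' < l'" "y' \<le> l'" for l l' x y x' y' n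
    proof -
      have "0 < (1 - t n) * (x - l) + t n * (y - l)" "0 < (1 - t n) * (l' - y') + t n * (l' - x')"
        using t[of n] that by (auto intro!: add_nonneg_pos)
      then show "l < x + t n * (y - x)" "y' + t n * (x' - y') < l'" by (simp_all add: algebra_simps)
    qed
    have "p + t n *\<^sub>R (q - p) \<in> open_cell s" for n
    proof -
      have "fst p + snd p + t n * (fst q + snd q - (fst p + snd p)) = fst p + t n * (fst q - fst p) + (snd p + t n * (snd q - snd p))"
        by (simp add: algebra_simps)
      then show ?thesis
        using p q mix[of "of_int i" "fst p" "fst q" "fst q" "of_int i + 1" "fst p" n]
          mix[of "of_int j" "snd p" "snd q" "snd q" "of_int j + 1" "snd p" n]
          mix[of "of_int k" "fst p + snd p" "fst q + snd q" "fst q + snd q" "of_int k + 1" "fst p + snd p" n]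
        unfolding s cell_def open_cell_def by simp
    qed
    moreover have "(\<lambda>n. p + t n *\<^sub>R (q - p)) \<longlonglongrightarrow> p + 0 *\<^sub>R (q - p)"
      unfolding t_def by (intro tendsto_intros LIMSEQ_inverse_real_of_nat)
    ultimately show "p \<in> closure (open_cell s)" unfolding closure_sequential
      by (intro exI[of _ "\<lambda>n. p + t n *\<^sub>R (q - p)"]) auto
  qed
qed

lemma open_cells_cover:
  "(\<Union>s\<in>cell_index. open_cell s) = {p. fst p \<notin> \<int> \<and> snd p \<notin> \<int> \<and> fst p + snd p \<notin> \<int>}"
proof (intro set_eqI iffI)
  fix p :: plane assume "p \<in> {p. fst p \<notin> \<int> \<and> snd p \<notin> \<int> \<and> fst p + snd p \<notin> \<int>}"
  then have ne: "fst p \<noteq> of_int n" "snd p \<noteq> of_int n" "fst p + snd p \<noteq> of_int n" for n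
    by (metis (mono_tags, lifting) Ints_of_int mem_Collect_eq)+
  have fl: "of_int \<lfloor>x\<rfloor> < x \<and> x < of_int \<lfloor>x\<rfloor> + 1" if "\<And>n. x \<noteq> of_int n" for x :: real
    using that[of "\<lfloor>x\<rfloor>"] floor_correct[of x] by linarith
  let ?i = "\<lfloor>fst p\<rfloor>" and ?j = "\<lfloor>snd p\<rfloor>" and ?k = "\<lfloor>fst p + snd p\<rfloor>"
  have "p \<in> open_cell (?i, ?j, ?k)"
    unfolding open_cell_def using fl[of "fst p"] fl[of "snd p"] fl[of "fst p + snd p"] ne by simp
  moreover have "?k = ?i + ?j \<or> ?k = ?i + ?j + 1" by linarith
  then have "(?i, ?j, ?k) \<in> cell_index" by (simp add: cell_index_def)
  ultimately show "p \<in> (\<Union>s\<in>cell_index. open_cell s)" by blast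
next
  have no: "x \<notin> \<int>" if "of_int i < x" "x < of_int i + 1" for x :: real and i
    using that by (auto elim!: Ints_cases)
  fix p assume "p \<in> (\<Union>s\<in>cell_index. open_cell s)"
  then show "p \<in> {p. fst p \<notin> \<int> \<and> snd p \<notin> \<int> \<and> fst p + snd p \<notin> \<int>}"
    using no by (auto simp: open_cell_def)
qed

lemma open_cell_meets_cell:
  assumes "p \<in> open_cell s" "p \<in> cell s'"
  shows "s = s'"
  using assms by (cases s; cases s'; simp add: open_cell_def cell_def; linarith)

context triangle_sides_angles begin

lemma sines_pos: "0 < sin \<alpha>" "0 < sin \<beta>" "0 < sin \<gamma>"
  using angles_pos angle_sum by (auto intro!: sin_gt_zero)

definition from_coords :: "plane \<Rightarrow> plane" where
  "from_coords z = (c * fst z + b * cos \<alpha> * snd z, b * sin \<alpha> * snd z)"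

definition to_coords :: "plane \<Rightarrow> plane" where
  "to_coords p = ((fst p * sin \<alpha> - snd p * cos \<alpha>) / (a * sin \<gamma>), snd p / (a * sin \<beta>))"

lemma to_from_coords [simp]: "to_coords (from_coords z) = z"
  using sides_pos sines_pos law_of_sines
  by (simp add: to_coords_def from_coords_def prod_eq_iff field_simps)

lemma from_to_coords [simp]: "from_coords (to_coords p) = p"
  using sides_pos sines_pos law_of_sines
  by (simp add: to_coords_def from_coords_def prod_eq_iff field_simps)

lemma linear_from_coords: "linear from_coords"
  by (rule linearI) (auto simp: from_coords_def algebra_simps)

lemma linear_to_coords: "linear to_coords"
  by (rule linearI) (auto simp: to_coords_def algebra_simps add_divide_distrib diff_divide_distrib)

lemma inj_from_coords: "inj from_coords" by (metis injI to_from_coords)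
lemma surj_from_coords: "surj from_coords" by (metis surjI from_to_coords)

lemma sum_coords: "fst (to_coords p) + snd (to_coords p) = (fst p * sin \<beta> + snd p * cos \<beta>) / (b * sin \<gamma>)"
proof -
  have *: "p = (c * X + b * cos \<alpha> * Y, b * sin \<alpha> * Y)" if "to_coords p = (X, Y)" for X Y
    using from_to_coords[of p] that by (simp add: from_coords_def)
  obtain X Y where XY: "to_coords p = (X, Y)" by fastforce
  have "fst p * sin \<beta> + snd p * cos \<beta> = X * (c * sin \<beta>) + Y * (b * sin (\<alpha> + \<beta>))"
    unfolding *[OF XY] sin_add by (simp add: algebra_simps)
  also have "sin (\<alpha> + \<beta>) = sin \<gamma>" using angle_sum sin_pi_minus[of \<gamma>] by (metis add_diff_cancel_right')
  finally have "fst p * sin \<beta> + snd p * cos \<beta> = (X + Y) * (b * sin \<gamma>)"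
    using law_of_sines(1) by (simp add: algebra_simps)
  then show ?thesis using XY sides_pos sines_pos by simp
qed

lemma lattice_lines_coords:
  "- lattice_lines a b c \<alpha> \<beta> \<gamma> = from_coords ` (\<Union>s\<in>cell_index. open_cell s)"
proof -
  have hp: "a * sin \<gamma> \<noteq> 0" "a * sin \<beta> \<noteq> 0" "b * sin \<gamma> \<noteq> 0" using sides_pos sines_pos by auto
  have "p \<in> lattice_lines a b c \<alpha> \<beta> \<gamma> \<longleftrightarrow>
    fst (to_coords p) \<in> \<int> \<or> snd (to_coords p) \<in> \<int> \<or> fst (to_coords p) + snd (to_coords p) \<in> \<int>" for p
    unfolding sum_coords unfolding lattice_lines_def to_coords_def Let_def Ints_def
    using hp by (auto simp: case_prod_beta field_simps)
  then have "p \<in> - lattice_lines a b c \<alpha> \<beta> \<gamma> \<longleftrightarrow> to_coords p \<in> (\<Union>s\<in>cell_index. open_cell s)" for p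
    unfolding open_cells_cover by simp
  then show ?thesis by (metis (no_types, lifting) from_to_coords to_from_coords image_iff set_eqI)
qed

text \<open>The open cells are the components of the complement of the lines, and the affine map
\<open>from_coords\<close> commutes with taking components and closures.\<close>
lemma lattice_triangles_eq:
  "lattice_triangles a b c \<alpha> \<beta> \<gamma> = (\<lambda>s. from_coords ` cell s) ` cell_index"
proof -
  let ?D = "(\<lambda>s. from_coords ` open_cell s) ` cell_index"
  have "components (\<Union>?D) = ?D"
  proof (rule components_of_disjoint_open_family)
    show "open D \<and> connected D \<and> D \<noteq> {}" if D: "D \<in> ?D" for D
    proof -
      obtain s where s: "s \<in> cell_index" "D = from_coords ` open_cell s" using D by blast
      show ?thesis unfolding s(2)
        using open_surjective_linear_image[OF open_open_cell linear_from_coords surj_from_coords]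
          convex_connected[OF convex_linear_image[OF linear_from_coords convex_open_cell]]
          cell_center_in_open_cell[OF s(1)] by blast
    qed
    have "s = s'" if "p \<in> open_cell s" "p \<in> open_cell s'" for p s s'
      using open_cell_meets_cell[OF that(1), of s'] that(2) by (auto simp: open_cell_def cell_def)
    then have "from_coords ` open_cell s \<inter> from_coords ` open_cell s' = {}" if "s \<noteq> s'" for s s'
      using that inj_from_coords unfolding inj_def by blast
    then show "pairwise disjnt ?D" unfolding pairwise_def disjnt_def by (metis (no_types, lifting) imageE)
  qed
  then have "components (- lattice_lines a b c \<alpha> \<beta> \<gamma>) = ?D"
    unfolding lattice_lines_coords image_UN by simp
  then show ?thesis
    unfolding lattice_triangles_def
    by (simp add: image_image closure_injective_linear_image[OF linear_from_coords inj_from_coords, symmetric] closure_open_cell)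
qed

lemma inj_cell: "inj_on (\<lambda>s. from_coords ` cell s) cell_index"
proof (rule inj_onI)
  fix s s' assume s: "s \<in> cell_index" "s' \<in> cell_index" "from_coords ` cell s = from_coords ` cell s'"
  then have "cell s = cell s'" using inj_from_coords inj_image_eq_iff by metis
  moreover have "cell_center s \<in> cell s"
    using cell_center_in_open_cell[OF s(1)] by (auto simp: open_cell_def cell_def)
  ultimately show "s = s'" using open_cell_meets_cell[OF cell_center_in_open_cell[OF s(1)]] by simp
qed

lemma meets_from_coords_iff: "P \<inter> from_coords ` S \<noteq> {} \<longleftrightarrow> to_coords ` P \<inter> S \<noteq> {}"
proof -
  have "z \<in> to_coords ` P \<longleftrightarrow> from_coords z \<in> P" for z
  proof
    assume "from_coords z \<in> P"
    then have "to_coords (from_coords z) \<in> to_coords ` P" by (rule imageI)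
    then show "z \<in> to_coords ` P" by simp
  qed auto
  then show ?thesis by blast
qed

lemma card_hit_triangles:
  "card {T \<in> lattice_triangles a b c \<alpha> \<beta> \<gamma>. P \<inter> T \<noteq> {}} = card (hit_cells (to_coords ` P))"
proof -
  have eq: "{T \<in> lattice_triangles a b c \<alpha> \<beta> \<gamma>. P \<inter> T \<noteq> {}} = (\<lambda>s. from_coords ` cell s) ` hit_cells (to_coords ` P)"
    unfolding lattice_triangles_eq hit_cells_def using meets_from_coords_iff[of P] by blast
  have "inj_on (\<lambda>s. from_coords ` cell s) (hit_cells (to_coords ` P))"
    using inj_cell unfolding inj_on_def hit_cells_def by blast
  then show ?thesis unfolding eq by (rule card_image)
qed

text \<open>The map \<open>from_coords\<close> is a shear after a scaling by \<open>c\<close> and by the altitude \<open>b sin \<alpha>\<close>, so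
its determinant is \<open>c b sin \<alpha> = a b sin \<gamma>\<close>.\<close>
lemma emeasure_from_coords:
  assumes A: "A \<in> sets borel"
  shows "from_coords ` A \<in> sets borel"
    and "emeasure lborel (from_coords ` A) = ennreal (a * b * sin \<gamma>) * emeasure lborel A"
proof -
  have cont: "continuous_on UNIV to_coords" using linear_to_coords by (rule linear_continuous_on[OF linear_linear[THEN iffD2]])
  have "p \<in> from_coords ` A \<longleftrightarrow> to_coords p \<in> A" for p
    by (metis from_to_coords to_from_coords image_iff)
  then have eq: "from_coords ` A = to_coords -` A" by blast
  show meas: "from_coords ` A \<in> sets borel"
    unfolding eq using measurable_sets[OF borel_measurable_continuous_onI[OF cont] A] by simp
  let ?f = "indicator (from_coords ` A) :: plane \<Rightarrow> ennreal"
  have f: "?f \<in> borel_measurable (lborel \<Otimes>\<^sub>M lborel)" using meas by (simp add: lborel_prod)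
  have fsec: "(\<lambda>x. ?f (x, y)) \<in> borel_measurable borel" for y
    using measurable_compose[OF measurable_Pair2'[of y lborel lborel] f] by simp
  have inner: "(\<lambda>y. \<integral>\<^sup>+x. g (x, y) \<partial>lborel) \<in> borel_measurable borel"
    if "g \<in> borel_measurable (lborel \<Otimes>\<^sub>M lborel)" for g :: "plane \<Rightarrow> ennreal"
    using lborel.borel_measurable_nn_integral[of "\<lambda>y x. g (x, y)" lborel] measurable_pair_swap[OF that]
    by (simp add: case_prod_beta)
  have h: "0 < b * sin \<alpha>" using sides_pos sines_pos by simp
  have "emeasure lborel (from_coords ` A) = (\<integral>\<^sup>+y. \<integral>\<^sup>+x. ?f (x, y) \<partial>lborel \<partial>lborel)"
    using meas lborel_pair.nn_integral_snd[OF f] by (simp add: lborel_prod)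
  also have "\<dots> = ennreal (b * sin \<alpha>) * (\<integral>\<^sup>+y. \<integral>\<^sup>+x. ?f (x, b * sin \<alpha> * y) \<partial>lborel \<partial>lborel)"
    using h sides_pos sines_pos inner[OF f]
    by (subst nn_integral_real_affine[of _ "b * sin \<alpha>" 0]) simp_all
  also have "(\<lambda>y. \<integral>\<^sup>+x. ?f (x, b * sin \<alpha> * y) \<partial>lborel)
    = (\<lambda>y. ennreal c * (\<integral>\<^sup>+x. indicator A (x, y) \<partial>lborel))"
  proof
    fix y
    have "?f (b * cos \<alpha> * y + c * x, b * sin \<alpha> * y) = indicator A (x, y)" for x
      using inj_image_mem_iff[OF inj_from_coords, of "(x, y)" A]
      by (simp add: indicator_def from_coords_def add.commute)
    then show "(\<integral>\<^sup>+x. ?f (x, b * sin \<alpha> * y) \<partial>lborel) = ennreal c * (\<integral>\<^sup>+x. indicator A (x, y) \<partial>lborel)"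
      using nn_integral_real_affine[OF fsec[of "b * sin \<alpha> * y"], of c "b * cos \<alpha> * y"] sides_pos by simp
  qed
  also have "(\<integral>\<^sup>+y. ennreal c * (\<integral>\<^sup>+x. indicator A (x, y) \<partial>lborel) \<partial>lborel) = ennreal c * emeasure lborel A"
  proof -
    have g: "(indicator A :: plane \<Rightarrow> ennreal) \<in> borel_measurable (lborel \<Otimes>\<^sub>M lborel)" using A by (simp add: lborel_prod)
    show ?thesis
      using lborel_pair.nn_integral_snd[OF g] A inner[OF g]
      by (subst nn_integral_cmult) (simp_all add: lborel_prod)
  qed
  also have "ennreal (b * sin \<alpha>) * (ennreal c * emeasure lborel A) = ennreal (b * sin \<alpha> * c) * emeasure lborel A"
    using ennreal_mult[of "b * sin \<alpha>" c] h sides_pos by (simp only: mult.assoc[symmetric] less_imp_le)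
  also have "b * sin \<alpha> * c = a * b * sin \<gamma>" using law_of_sines by simp
  finally show "emeasure lborel (from_coords ` A) = ennreal (a * b * sin \<gamma>) * emeasure lborel A" .
qed

lemma base_parallelogram_coords:
  "base_parallelogram a b c \<alpha> \<beta> \<gamma> = from_coords ` ({0..1} \<times> {0..1})"
proof -
  have h: "0 < a * sin \<beta>" "0 < c" using sides_pos sines_pos by simp_all
  have *: "to_coords p \<in> {0..1} \<times> {0..1} \<longleftrightarrow> p \<in> base_parallelogram a b c \<alpha> \<beta> \<gamma>" for p
  proof -
    have 1: "fst (to_coords p) = (fst p - snd p * cot \<alpha>) / c"
      using law_of_sines sines_pos sides_pos by (simp add: to_coords_def cot_def field_simps)
    have 2: "snd (to_coords p) = snd p / (a * sin \<beta>)" by (simp add: to_coords_def)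
    show ?thesis
      unfolding base_parallelogram_def mem_Times_iff 1 2 mem_Collect_eq case_prod_beta
      using h by (auto simp: divide_le_eq le_divide_eq)
  qed
  show ?thesis
  proof (intro set_eqI iffI)
    fix p assume "p \<in> base_parallelogram a b c \<alpha> \<beta> \<gamma>"
    then have "to_coords p \<in> {0..1} \<times> {0..1}" using * by blast
    then show "p \<in> from_coords ` ({0..1} \<times> {0..1})" by (metis from_to_coords image_eqI)
  next
    fix p assume "p \<in> from_coords ` ({0..1} \<times> {0..1})"
    then have "to_coords p \<in> {0..1} \<times> {0..1}" by auto
    then show "p \<in> base_parallelogram a b c \<alpha> \<beta> \<gamma>" using *[of p] by simp
  qed
qed

lemma base_parallelogram_measure:
  "base_parallelogram a b c \<alpha> \<beta> \<gamma> \<in> sets borel"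
  "emeasure lborel (base_parallelogram a b c \<alpha> \<beta> \<gamma>) = ennreal (a * b * sin \<gamma>)"
proof -
  have sq: "({0..1} \<times> {0..1} :: plane set) \<in> sets borel" by (intro borel_Times) auto
  show "base_parallelogram a b c \<alpha> \<beta> \<gamma> \<in> sets borel"
    "emeasure lborel (base_parallelogram a b c \<alpha> \<beta> \<gamma>) = ennreal (a * b * sin \<gamma>)"
    using emeasure_from_coords[OF sq] unfolding base_parallelogram_coords
    by (simp_all add: lborel_prod[symmetric] lborel.emeasure_pair_measure_Times)
qed

end

section \<open>Integrals of the support function of a half disc\<close>

lemma has_integral_shift_real:
  fixes f :: "real \<Rightarrow> real"
  assumes "(f has_integral I) {u + d..v + d}"
  shows "((\<lambda>x. f (x + d)) has_integral I) {u..v}"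
  using has_integral_affinity[of f I "u + d" "v + d" 1 d] assms by (simp add: algebra_simps image_affinity_atLeastAtMost)

lemma has_integral_periodic_shift:
  fixes f :: "real \<Rightarrow> real"
  assumes f: "(f has_integral I) {s..s + p}" and p: "0 < p" and per: "\<And>x. f (x + p) = f x"
  shows "((\<lambda>x. f (x + d)) has_integral I) {0..p}"
proof -
  have per_nat: "f (x + of_nat n * p) = f x" for x n
    by (induction n) (simp_all add: distrib_right add.assoc[symmetric] per, metis add.assoc add.commute per)
  have per_int: "f (x + of_int n * p) = f x" for x n
  proof (cases "0 \<le> n")
    case True
    then show ?thesis using per_nat[of x "nat n"] by simp
  next
    case False
    then show ?thesis using per_nat[of "x + of_int n * p" "nat (- n)"] by simp
  qed
  \<comment> \<open>the shift reduced modulo the period, relative to the left end\<close>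
  define e where "e = (d - s) - of_int \<lfloor>(d - s) / p\<rfloor> * p"
  have e: "0 \<le> e" "e \<le> p"
  proof -
    have "of_int \<lfloor>(d - s) / p\<rfloor> * p \<le> (d - s) / p * p" using p by (intro mult_right_mono) auto
    moreover have "(d - s) / p * p \<le> (of_int \<lfloor>(d - s) / p\<rfloor> + 1) * p" using p by (intro mult_right_mono) linarith+
    moreover have "(d - s) / p * p = d - s" using p by simp
    ultimately show "0 \<le> e" "e \<le> p" unfolding e_def distrib_right by linarith+
  qed
  have int: "f integrable_on {s..s + p}" using f by blast
  then have i1: "f integrable_on {s..s + e}" and i2: "f integrable_on {s + e..s + p}"
    using e by (auto elim!: integrable_on_subinterval)
  have I: "integral {s..s + e} f + integral {s + e..s + p} f = I"
    using Henstock_Kurzweil_Integration.integral_combine[OF _ _ int, of "s + e"] e f by (simp add: integral_unique)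
  have "((\<lambda>x. f (x + (s + e))) has_integral integral {s + e..s + p} f) {0..p - e}"
    by (rule has_integral_shift_real) (use i2 in \<open>simp add: algebra_simps has_integral_integral\<close>)
  moreover have "((\<lambda>x. f (x + (s + e - p))) has_integral integral {s..s + e} f) {p - e..p}"
    by (rule has_integral_shift_real) (use i1 in \<open>simp add: algebra_simps has_integral_integral\<close>)
  moreover have "f (x + (s + e - p)) = f (x + (s + e))" for x
    using per[of "x + (s + e - p)"] by (simp add: algebra_simps)
  ultimately have "((\<lambda>x. f (x + (s + e))) has_integral (integral {s + e..s + p} f + integral {s..s + e} f)) {0..p}"
    using e by (intro has_integral_combine[of 0 "p - e" p]) simp_all
  moreover have "f (x + (s + e)) = f (x + d)" for x
    using per_int[of "x + (s + e)" "\<lfloor>(d - s) / p\<rfloor>"] by (simp add: e_def algebra_simps)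
  ultimately show ?thesis using I by (simp add: add.commute)
qed

text \<open>The support function of the unit half disc with centre 0 and inner normal \<open>d\<close>, as a function
of the angle between \<open>d\<close> and the direction: the arc is extreme on the side of \<open>d\<close>, an end point of
the diameter on the other side.\<close>
definition half_disc_support :: "real \<Rightarrow> real" where
  "half_disc_support \<theta> = (if 0 \<le> cos \<theta> then 1 else \<bar>sin \<theta>\<bar>)"

lemma half_disc_support_periodic: "half_disc_support (x + 2 * pi) = half_disc_support x"
  by (simp add: half_disc_support_def)

text \<open>The projection of the half disc consists of the radius towards the round side and of the
projected half diameter on the other side.\<close>
lemma half_disc_support_width: "half_disc_support x + half_disc_support (x + pi) = 1 + \<bar>sin x\<bar>"
proof (cases "cos x = 0")
  case True
  then have "\<bar>sin x\<bar> = 1" using sin_cos_squared_add[of x] by (simp add: abs_square_eq_1)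
  with True show ?thesis by (simp add: half_disc_support_def)
qed (auto simp: half_disc_support_def)

lemma half_disc_support_cases:
  "\<lbrakk>- (pi / 2) \<le> x; x \<le> pi / 2\<rbrakk> \<Longrightarrow> half_disc_support x = 1"
  "\<lbrakk>pi / 2 \<le> x; x \<le> pi\<rbrakk> \<Longrightarrow> half_disc_support x = sin x"
  "\<lbrakk>pi \<le> x; x \<le> pi + pi / 2\<rbrakk> \<Longrightarrow> half_disc_support x = - sin x"
  "\<lbrakk>pi + pi / 2 \<le> x; x \<le> 2 * pi + pi / 2\<rbrakk> \<Longrightarrow> half_disc_support x = 1"
proof -
  have flat: "half_disc_support x = \<bar>sin x\<bar>" if "cos x \<le> 0" for x
  proof (cases "cos x = 0")
    case True
    then have "\<bar>sin x\<bar> = 1" using sin_cos_squared_add[of x] by (simp add: abs_square_eq_1)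
    with True show ?thesis by (simp add: half_disc_support_def)
  qed (use that in \<open>simp add: half_disc_support_def\<close>)
  have c: "0 \<le> cos (x - pi)" if "pi / 2 \<le> x" "x \<le> pi + pi / 2" for x
    using that by (intro cos_ge_zero) auto
  show "half_disc_support x = 1" if "- (pi / 2) \<le> x" "x \<le> pi / 2"
    using cos_ge_zero[of x] that by (simp add: half_disc_support_def)
  show "half_disc_support x = sin x" if "pi / 2 \<le> x" "x \<le> pi"
    using flat[of x] c[of x] sin_ge_zero[of x] that by (simp add: cos_diff)
  show "half_disc_support x = - sin x" if "pi \<le> x" "x \<le> pi + pi / 2"
    using flat[of x] c[of x] sin_ge_zero[of "x - pi"] that by (simp add: cos_diff sin_diff)
  show "half_disc_support x = 1" if "pi + pi / 2 \<le> x" "x \<le> 2 * pi + pi / 2"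
    using cos_ge_zero[of "x - 2 * pi"] that by (simp add: half_disc_support_def cos_diff)
qed

text \<open>Every integrand below has this form between two break points, with \<open>A, B, C, D\<close> among
\<open>0\<close>, \<open>1\<close>, \<open>-1\<close>; the break points are the zeros of the sine and cosine factors.\<close>
lemma has_integral_sin_products:
  fixes A B C D w :: real
  assumes "u \<le> v"
    and "\<And>x. u \<le> x \<Longrightarrow> x \<le> v \<Longrightarrow> f x = A + B * sin x + C * sin (x + w) + D * (sin x * sin (x + w))"
  defines "F \<equiv> \<lambda>x. A * x - B * cos x - C * cos (x + w) + D * (x * cos w / 2 - sin (2 * x + w) / 4)"
  shows "(f has_integral (F v - F u)) {u..v}"
proof -
  have prod: "cos w / 2 - cos (2 * x + w) / 2 = sin x * sin (x + w)" for x
  proof -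
    have "sin x * sin (x + w) = (cos (x - (x + w)) - cos (x + (x + w))) / 2" by (rule sin_times_sin)
    moreover have "x - (x + w) = - w" "x + (x + w) = 2 * x + w" by simp_all
    ultimately show ?thesis by (simp only: cos_minus diff_divide_distrib)
  qed
  have "((\<lambda>x. A + B * sin x + C * sin (x + w) + D * (sin x * sin (x + w))) has_integral (F v - F u)) {u..v}"
  proof (rule fundamental_theorem_of_calculus[OF assms(1)])
    fix x
    have "(F has_real_derivative (A + B * sin x + C * sin (x + w) + D * (cos w / 2 - cos (2 * x + w) / 2))) (at x within {u..v})"
      unfolding F_def by (auto intro!: derivative_eq_intros)
    then show "(F has_vector_derivative (A + B * sin x + C * sin (x + w) + D * (sin x * sin (x + w)))) (at x within {u..v})"
      unfolding prod by (simp add: has_real_derivative_iff_has_vector_derivative)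
  qed
  then show ?thesis by (rule has_integral_eq[rotated]) (simp add: assms(2))
qed

lemma cos_sin_3pi_half: "cos (3 * pi / 2) = 0" "sin (3 * pi / 2) = - 1"
  using cos_3over2_pi sin_3over2_pi by (metis times_divide_eq_left)+

lemma integral_half_disc_support:
  "((\<lambda>x. half_disc_support (x + d)) has_integral (pi + 2)) {0..2 * pi}"
proof -
  note piece = has_integral_sin_products[where w = 0 and f = half_disc_support]
  have 1: "(half_disc_support has_integral pi) {- (pi / 2)..pi / 2}"
    using piece[of "- (pi / 2)" "pi / 2" 1 0 0 0] half_disc_support_cases(1) by simp
  have 2: "(half_disc_support has_integral 1) {pi / 2..pi}"
    using piece[of "pi / 2" pi 0 1 0 0] half_disc_support_cases(2) by simp
  have 3: "(half_disc_support has_integral 1) {pi..pi + pi / 2}"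
    using piece[of pi "pi + pi / 2" 0 "-1" 0 0] half_disc_support_cases(3) by (simp add: cos_sin_3pi_half)
  have "(half_disc_support has_integral (pi + 1 + 1)) {- (pi / 2)..pi + pi / 2}"
    by (rule has_integral_combine[OF _ _ has_integral_combine[OF _ _ 1 2] 3]) (use pi_gt_zero in linarith)+
  then have "(half_disc_support has_integral (pi + 2)) {- (pi / 2)..- (pi / 2) + 2 * pi}"
    by (simp add: field_simps)
  then show ?thesis by (rule has_integral_periodic_shift) (simp_all add: half_disc_support_periodic)
qed

lemma integral_half_disc_support_square:
  "((\<lambda>x. (half_disc_support (x + d))\<^sup>2) has_integral (3 * pi / 2)) {0..2 * pi}"
proof -
  let ?f = "\<lambda>x. (half_disc_support x)\<^sup>2"
  note piece = has_integral_sin_products[where w = 0 and f = ?f]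
  have "(?f has_integral (1 * (pi / 2) - 1 * - (pi / 2))) {- (pi / 2)..pi / 2}"
    using piece[of "- (pi / 2)" "pi / 2" 1 0 0 0] half_disc_support_cases(1) by simp
  moreover have "(?f has_integral (pi / 2)) {pi / 2..pi + pi / 2}"
  proof -
    have "?f x = sin x * sin x" if "pi / 2 \<le> x" "x \<le> pi + pi / 2" for x
      using half_disc_support_cases(2,3)[of x] that by (cases "x \<le> pi") (auto simp: power2_eq_square)
    then show ?thesis
      using piece[of "pi / 2" "pi + pi / 2" 0 0 0 1] by (simp add: sin_add field_simps cos_sin_3pi_half)
  qed
  ultimately have "(?f has_integral (pi + pi / 2)) {- (pi / 2)..pi + pi / 2}"
    by (intro has_integral_combine[of "- (pi / 2)" "pi / 2" "pi + pi / 2"]) simp_all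
  then have "(?f has_integral (3 * pi / 2)) {- (pi / 2)..- (pi / 2) + 2 * pi}"
    by (simp add: field_simps)
  then show ?thesis by (rule has_integral_periodic_shift) (simp_all add: half_disc_support_periodic)
qed

text \<open>Because \<open>w = \<pi> - \<gamma>\<close> is at least \<open>\<pi> / 2\<close>, the break points in one period are in the order
\<open>\<pi>/2 - w\<close>, \<open>\<pi> - w\<close>, \<open>\<pi>/2\<close>, \<open>3\<pi>/2 - w\<close>, \<open>\<pi>\<close>. The six pieces contribute \<open>\<gamma>\<close>, \<open>1\<close>, \<open>1 - sin \<gamma>\<close>,
\<open>(sin \<gamma> + \<gamma> cos \<gamma>) / 2\<close>, \<open>1 - sin \<gamma>\<close> and \<open>1\<close>; both factors are on the diameter side only in
the fourth.\<close>
lemma integral_half_disc_support_product: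
  assumes \<gamma>: "0 \<le> \<gamma>" "\<gamma> \<le> pi / 2" and y: "y = x + (pi - \<gamma>)"
  shows "((\<lambda>\<phi>. half_disc_support (\<phi> + x) * half_disc_support (\<phi> + y))
    has_integral (\<gamma> + 4 - 3 / 2 * sin \<gamma> + \<gamma> * cos \<gamma> / 2)) {0..2 * pi}"
proof -
  define w where "w = pi - \<gamma>"
  have w: "pi / 2 \<le> w" "w \<le> pi" unfolding w_def using \<gamma> by auto
  have trig: "sin w = sin \<gamma>" "cos w = - cos \<gamma>" by (simp_all add: w_def)
  let ?f = "\<lambda>t. half_disc_support t * half_disc_support (t + w)"
  note piece = has_integral_sin_products[where w = w and f = ?f]
  note g = half_disc_support_cases
  have 1: "(?f has_integral \<gamma>) {- (pi / 2)..pi / 2 - w}"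
    using piece[of "- (pi / 2)" "pi / 2 - w" 1 0 0 0] w g(1) by (simp add: w_def)
  have 2: "(?f has_integral 1) {pi / 2 - w..pi - w}"
    using piece[of "pi / 2 - w" "pi - w" 0 0 1 0] w g(1,2) by simp
  have 3: "(?f has_integral (1 - sin \<gamma>)) {pi - w..pi / 2}"
    using piece[of "pi - w" "pi / 2" 0 0 "-1" 0] w g(1,3) by (simp add: cos_add trig)
  have 4: "(?f has_integral (sin \<gamma> / 2 + \<gamma> * cos \<gamma> / 2)) {pi / 2..pi + (pi / 2 - w)}"
  proof -
    have "sin (2 * (pi + (pi / 2 - w)) + w) = sin \<gamma>" "sin (2 * (pi / 2) + w) = - sin \<gamma>"
      by (simp_all add: w_def sin_add sin_diff cos_add cos_diff algebra_simps)
    then show ?thesis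
      using piece[of "pi / 2" "pi + (pi / 2 - w)" 0 0 0 "-1"] w g(2,3) trig
      by (simp add: w_def algebra_simps add_divide_distrib diff_divide_distrib)
  qed
  have 5: "(?f has_integral (1 - sin \<gamma>)) {pi + (pi / 2 - w)..pi}"
    using piece[of "pi + (pi / 2 - w)" pi 0 1 0 0] w g(2,4) by (simp add: cos_add cos_diff trig cos_sin_3pi_half)
  have 6: "(?f has_integral 1) {pi..pi + pi / 2}"
    using piece[of pi "pi + pi / 2" 0 "-1" 0 0] w g(3,4) by (simp add: cos_sin_3pi_half)
  have "(?f has_integral (\<gamma> + 1 + (1 - sin \<gamma>) + (sin \<gamma> / 2 + \<gamma> * cos \<gamma> / 2) + (1 - sin \<gamma>) + 1)) {- (pi / 2)..pi + pi / 2}"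
    using w by (intro has_integral_combine[OF _ _ has_integral_combine[OF _ _ has_integral_combine[OF _ _
        has_integral_combine[OF _ _ has_integral_combine[OF _ _ 1 2] 3] 4] 5] 6]) simp_all
  then have "(?f has_integral (\<gamma> + 4 - 3 / 2 * sin \<gamma> + \<gamma> * cos \<gamma> / 2)) {- (pi / 2)..- (pi / 2) + 2 * pi}"
    by (simp add: field_simps)
  then have "((\<lambda>t. ?f (t + x)) has_integral (\<gamma> + 4 - 3 / 2 * sin \<gamma> + \<gamma> * cos \<gamma> / 2)) {0..2 * pi}"
    by (rule has_integral_periodic_shift)
      (simp_all add: half_disc_support_periodic add.assoc add.commute[of "2 * pi" w], metis add.assoc half_disc_support_periodic)
  then show ?thesis by (simp add: y w_def add.assoc)
qed

text \<open>Both sines keep their signs between \<open>0\<close>, \<open>\<pi> - w\<close>, \<open>\<pi>\<close>, \<open>2 \<pi> - w\<close> and \<open>2 \<pi>\<close>.\<close>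
lemma integral_half_disc_width_product:
  assumes w: "0 \<le> w" "w \<le> pi" and y: "y = x + w"
  shows "((\<lambda>\<phi>. (1 + \<bar>sin (\<phi> + x)\<bar>) * (1 + \<bar>sin (\<phi> + y)\<bar>))
    has_integral (2 * pi + 8 + 2 * ((pi / 2 - w) * cos w + sin w))) {0..2 * pi}"
proof -
  let ?f = "\<lambda>t. (1 + \<bar>sin t\<bar>) * (1 + \<bar>sin (t + w)\<bar>)"
  note piece = has_integral_sin_products[where w = w and f = ?f]
  have pos: "\<bar>sin t\<bar> = sin t" if "0 \<le> t" "t \<le> pi" for t using sin_ge_zero that by simp
  have neg: "\<bar>sin t\<bar> = - sin t" if "pi \<le> t" "t \<le> 2 * pi" for t
    using sin_ge_zero[of "t - pi"] that by (simp add: sin_diff)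
  have pos': "\<bar>sin t\<bar> = sin t" if "2 * pi \<le> t" "t \<le> 3 * pi" for t
    using sin_ge_zero[of "t - 2 * pi"] that by (simp add: sin_diff)
  have e: "sin (2 * (pi - w) + w) = - sin w" "sin (2 * pi + w) = sin w" "sin (2 * (2 * pi - w) + w) = - sin w"
    "sin (2 * (2 * pi) + w) = sin w"
  proof -
    have "2 * (pi - w) + w = 2 * pi - w" "2 * (2 * pi - w) + w = 2 * pi - w + 2 * pi" "2 * (2 * pi) + w = w + 2 * pi + 2 * pi"
      by simp_all
    then show "sin (2 * (pi - w) + w) = - sin w" "sin (2 * pi + w) = sin w" "sin (2 * (2 * pi - w) + w) = - sin w"
      "sin (2 * (2 * pi) + w) = sin w" by (simp_all only: sin_periodic sin_2pi_minus add.commute[of "2 * pi" w])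
  qed
  have e': "sin (pi * 2 - w) = - sin w" "cos (pi * 2 - w) = cos w" "sin (pi * 2 + w) = sin w" "sin (pi * 4 - w) = - sin w"
    "sin (pi * 4 + w) = sin w" "sin (w + pi * 2) = sin w" "sin (w + pi * 4) = sin w" "cos (w + pi * 2) = cos w"
  proof -
    have "pi * 4 - w = 2 * pi - w + 2 * pi" "pi * 4 + w = w + 2 * pi + 2 * pi" "pi * 2 + w = w + 2 * pi" "pi * 2 - w = 2 * pi - w"
      "w + pi * 2 = w + 2 * pi" "w + pi * 4 = w + 2 * pi + 2 * pi" by simp_all
    then show "sin (pi * 2 - w) = - sin w" "cos (pi * 2 - w) = cos w" "sin (pi * 2 + w) = sin w" "sin (pi * 4 - w) = - sin w"
    "sin (pi * 4 + w) = sin w" "sin (w + pi * 2) = sin w" "sin (w + pi * 4) = sin w" "cos (w + pi * 2) = cos w" by (simp_all only: sin_periodic cos_periodic sin_2pi_minus cos_2pi_minus)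
  qed
  have 1: "(?f has_integral ((pi - w) + (cos w + 1) + (1 + cos w) + ((pi - w) * cos w / 2 + sin w / 2))) {0..pi - w}"
    by (rule has_integral_eq_rhs[OF piece[of 0 "pi - w" 1 1 1 1]]) (use w pos in \<open>auto simp: e e' field_simps\<close>)
  have 2: "(?f has_integral (w + (1 - cos w) + (1 - cos w) - (w * cos w / 2 - sin w / 2))) {pi - w..pi}"
    by (rule has_integral_eq_rhs[OF piece[of "pi - w" pi 1 1 "-1" "-1"]]) (use w pos neg in \<open>auto simp: e e' field_simps\<close>)
  have 3: "(?f has_integral ((pi - w) + (cos w + 1) + (1 + cos w) + ((pi - w) * cos w / 2 + sin w / 2))) {pi..2 * pi - w}"
    by (rule has_integral_eq_rhs[OF piece[of pi "2 * pi - w" 1 "-1" "-1" 1]]) (use w neg in \<open>auto simp: e e' field_simps\<close>)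
  have 4: "(?f has_integral (w + (1 - cos w) + (1 - cos w) - (w * cos w / 2 - sin w / 2))) {2 * pi - w..2 * pi}"
    by (rule has_integral_eq_rhs[OF piece[of "2 * pi - w" "2 * pi" 1 "-1" 1 "-1"]]) (use w neg pos' in \<open>auto simp: e e' field_simps\<close>)
  have "(?f has_integral (2 * pi + 8 + 2 * ((pi / 2 - w) * cos w + sin w))) {0..0 + 2 * pi}"
    using has_integral_combine[OF _ _ has_integral_combine[OF _ _ has_integral_combine[OF _ _ 1 2] 3] 4] w
    by (simp add: algebra_simps add_divide_distrib diff_divide_distrib)
  then have "((\<lambda>t. ?f (t + x)) has_integral (2 * pi + 8 + 2 * ((pi / 2 - w) * cos w + sin w))) {0..2 * pi}"
    by (rule has_integral_periodic_shift) (simp_all, metis add.assoc add.commute sin_periodic)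
  then show ?thesis by (simp add: y add.assoc)
qed

section \<open>Geometry of the half disc\<close>

definition unit_vector :: "real \<Rightarrow> plane" where
  "unit_vector \<theta> = (cos \<theta>, sin \<theta>)"

definition half_disc_at :: "real \<Rightarrow> plane \<Rightarrow> real \<Rightarrow> plane set" where
  "half_disc_at r m \<eta> = {p \<in> cball m r. 0 \<le> (p - m) \<bullet> unit_vector \<eta>}"

lemma inner_unit_vector: "p \<bullet> unit_vector \<theta> = fst p * cos \<theta> + snd p * sin \<theta>"
  by (simp add: unit_vector_def inner_prod_def)

lemma norm_unit_vector [simp]: "norm (unit_vector \<theta>) = 1"
  by (simp add: unit_vector_def norm_prod_def)

lemma half_disc_at_of_half_disc:
  assumes "half_disc r C"
  obtains m \<delta> where "C = half_disc_at r m \<delta>"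
proof -
  obtain m d where d: "norm d = 1" "C = {p \<in> cball m r. 0 \<le> (p - m) \<bullet> d}"
    using assms unfolding half_disc_def by blast
  have "(fst d)\<^sup>2 + (snd d)\<^sup>2 = 1" using d(1) by (simp add: norm_prod_def)
  then obtain \<delta> where "fst d = cos \<delta>" "snd d = sin \<delta>" using sincos_total_2pi by metis
  then have "d = unit_vector \<delta>" by (simp add: unit_vector_def prod_eq_iff)
  then show ?thesis using d(2) that by (simp add: half_disc_at_def)
qed

lemma rot_half_disc_at: "rot \<rho> ` half_disc_at r m \<eta> = half_disc_at r (rot \<rho> m) (\<eta> + \<rho>)"
proof -
  have lin: "linear (rot \<rho>)" for \<rho> by (rule linearI) (auto simp: rot_def algebra_simps)
  have inv: "rot \<rho> (rot (- \<rho>) p) = p" for \<rho> p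
  proof -
    obtain x y where p: "p = (x, y)" by fastforce
    have "z * (cos \<rho> * cos \<rho>) + z * (sin \<rho> * sin \<rho>) = z" for z
      using sin_cos_squared_add2[of \<rho>] by (metis distrib_left mult_1_right power2_eq_square)
    then show ?thesis unfolding p rot_def by (simp add: algebra_simps)
  qed
  have iso: "norm (rot \<rho> p) = norm p" for p
  proof -
    have "(fst p * cos \<rho> - snd p * sin \<rho>)\<^sup>2 + (fst p * sin \<rho> + snd p * cos \<rho>)\<^sup>2 = (fst p)\<^sup>2 + (snd p)\<^sup>2"
      using sin_cos_squared_add[of \<rho>] by algebra
    then show ?thesis by (simp add: norm_prod_def rot_def case_prod_beta)
  qed
  have turn: "rot \<rho> p \<bullet> unit_vector (\<eta> + \<rho>) = p \<bullet> unit_vector \<eta>" for p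
  proof -
    have "(fst p * cos \<rho> - snd p * sin \<rho>) * (cos \<eta> * cos \<rho> - sin \<eta> * sin \<rho>)
      + (fst p * sin \<rho> + snd p * cos \<rho>) * (sin \<eta> * cos \<rho> + cos \<eta> * sin \<rho>) = fst p * cos \<eta> + snd p * sin \<eta>"
      using sin_cos_squared_add[of \<rho>] by algebra
    then show ?thesis by (simp add: inner_unit_vector rot_def case_prod_beta cos_add sin_add)
  qed
  have mem: "rot \<rho> p \<in> half_disc_at r (rot \<rho> m) (\<eta> + \<rho>) \<longleftrightarrow> p \<in> half_disc_at r m \<eta>" for p
    using iso[of "m - p"] turn[of "p - m"] by (simp add: half_disc_at_def dist_norm linear_diff[OF lin])
  show ?thesis
  proof (intro set_eqI iffI)
    fix p assume "p \<in> half_disc_at r (rot \<rho> m) (\<eta> + \<rho>)"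
    then have "rot (- \<rho>) p \<in> half_disc_at r m \<eta>" using mem[of "rot (- \<rho>) p"] inv[of \<rho> p] by simp
    then have "rot \<rho> (rot (- \<rho>) p) \<in> rot \<rho> ` half_disc_at r m \<eta>" by (rule imageI)
    then show "p \<in> rot \<rho> ` half_disc_at r m \<eta>" using inv[of \<rho> p] by simp
  qed (use mem in auto)
qed

lemma compact_half_disc_at: "compact (half_disc_at r m \<eta>)" and convex_half_disc_at: "convex (half_disc_at r m \<eta>)"
proof -
  have e: "half_disc_at r m \<eta> = cball m r \<inter> {p. unit_vector \<eta> \<bullet> p \<ge> m \<bullet> unit_vector \<eta>}"
    by (auto simp: half_disc_at_def inner_diff inner_commute)
  show "compact (half_disc_at r m \<eta>)" unfolding e by (intro compact_Int_closed compact_cball closed_halfspace_ge)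
  show "convex (half_disc_at r m \<eta>)" unfolding e by (intro convex_Int convex_cball convex_halfspace_ge)
qed

text \<open>If the direction \<open>n\<close> lies on the round side, the radius in this direction belongs to the half
disc. Otherwise the component of \<open>n\<close> along \<open>d\<close> only lowers the value, and what remains is the
diameter, spanned by the unit vector \<open>e\<close> orthogonal to \<open>d\<close>.\<close>
lemma half_disc_at_support:
  assumes "0 \<le> r"
  shows "p \<in> half_disc_at r m \<eta> \<Longrightarrow> p \<bullet> unit_vector \<nu> \<le> m \<bullet> unit_vector \<nu> + r * half_disc_support (\<eta> - \<nu>)"
    and "\<exists>p\<in>half_disc_at r m \<eta>. p \<bullet> unit_vector \<nu> = m \<bullet> unit_vector \<nu> + r * half_disc_support (\<eta> - \<nu>)"
proof -
  let ?d = "unit_vector \<eta>" and ?n = "unit_vector \<nu>" and ?e = "unit_vector (\<eta> - pi / 2)"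
  have dn: "?n \<bullet> ?d = cos (\<eta> - \<nu>)" and en: "?e \<bullet> ?n = sin (\<eta> - \<nu>)" and ed: "?e \<bullet> ?d = 0"
    unfolding inner_unit_vector by (simp_all add: unit_vector_def cos_diff sin_diff)
  have split: "v \<bullet> ?n = cos (\<eta> - \<nu>) * (v \<bullet> ?d) + sin (\<eta> - \<nu>) * (v \<bullet> ?e)" for v
  proof -
    have "fst v * cos \<nu> + snd v * sin \<nu> = (cos \<eta> * cos \<nu> + sin \<eta> * sin \<nu>) * (fst v * cos \<eta> + snd v * sin \<eta>)
      + (sin \<eta> * cos \<nu> - cos \<eta> * sin \<nu>) * (fst v * sin \<eta> - snd v * cos \<eta>)"
      using sin_cos_squared_add[of \<eta>] by algebra
    then show ?thesis unfolding inner_unit_vector by (simp add: cos_diff sin_diff)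
  qed
  show "p \<bullet> ?n \<le> m \<bullet> ?n + r * half_disc_support (\<eta> - \<nu>)" if p: "p \<in> half_disc_at r m \<eta>"
  proof -
    define v where "v = p - m"
    have v: "norm v \<le> r" "0 \<le> v \<bullet> ?d"
      using p by (auto simp: half_disc_at_def v_def dist_norm norm_minus_commute)
    have b: "\<bar>v \<bullet> unit_vector \<theta>\<bar> \<le> r" for \<theta> using Cauchy_Schwarz_ineq2[of v "unit_vector \<theta>"] v(1) by simp
    have "v \<bullet> ?n \<le> r * half_disc_support (\<eta> - \<nu>)"
    proof (cases "0 \<le> cos (\<eta> - \<nu>)")
      case True
      then show ?thesis using b[of \<nu>] by (simp add: half_disc_support_def)
    next
      case False
      have "cos (\<eta> - \<nu>) * (v \<bullet> ?d) \<le> 0" using False v(2) by (simp add: mult_nonpos_nonneg)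
      moreover have "sin (\<eta> - \<nu>) * (v \<bullet> ?e) \<le> \<bar>sin (\<eta> - \<nu>)\<bar> * r"
      proof -
        have "sin (\<eta> - \<nu>) * (v \<bullet> ?e) \<le> \<bar>sin (\<eta> - \<nu>) * (v \<bullet> ?e)\<bar>" by (rule abs_ge_self)
        also have "\<dots> \<le> \<bar>sin (\<eta> - \<nu>)\<bar> * r" unfolding abs_mult by (intro mult_left_mono b) simp
        finally show ?thesis .
      qed
      ultimately have "v \<bullet> ?n \<le> \<bar>sin (\<eta> - \<nu>)\<bar> * r" using split[of v] by linarith
      then show ?thesis using False by (simp add: half_disc_support_def mult.commute)
    qed
    then show ?thesis by (simp add: v_def inner_diff_left)
  qed
  show "\<exists>p\<in>half_disc_at r m \<eta>. p \<bullet> ?n = m \<bullet> ?n + r * half_disc_support (\<eta> - \<nu>)"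
  proof (cases "0 \<le> cos (\<eta> - \<nu>)")
    case True
    then have "m + r *\<^sub>R ?n \<in> half_disc_at r m \<eta>" using assms dn by (simp add: half_disc_at_def dist_norm)
    moreover have "(m + r *\<^sub>R ?n) \<bullet> ?n = m \<bullet> ?n + r"
      by (simp add: inner_add_left power2_norm_eq_inner[symmetric])
    ultimately show ?thesis using True by (auto simp: half_disc_support_def)
  next
    case False
    \<comment> \<open>the end point of the diameter on the side of \<open>n\<close>\<close>
    define \<sigma> :: real where "\<sigma> = (if 0 \<le> sin (\<eta> - \<nu>) then 1 else - 1)"
    have "m + (r * \<sigma>) *\<^sub>R ?e \<in> half_disc_at r m \<eta>"
      using assms ed by (simp add: half_disc_at_def dist_norm \<sigma>_def)
    moreover have "(m + (r * \<sigma>) *\<^sub>R ?e) \<bullet> ?n = m \<bullet> ?n + r * \<bar>sin (\<eta> - \<nu>)\<bar>"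
      using en by (simp add: inner_add_left \<sigma>_def)
    ultimately show ?thesis using False by (auto simp: half_disc_support_def)
  qed
qed

text \<open>The lower end is the support value in the opposite direction.\<close>
lemma half_disc_at_image:
  assumes "0 \<le> r" "0 < h"
  shows "(\<lambda>p. p \<bullet> unit_vector \<nu> / h) ` half_disc_at r m \<eta>
    = {m \<bullet> unit_vector \<nu> / h - r / h * half_disc_support (\<eta> - \<nu> + pi)..m \<bullet> unit_vector \<nu> / h + r / h * half_disc_support (\<eta> - \<nu>)}"
    (is "?f ` ?H = {?l..?u}")
proof
  have opp: "unit_vector (\<nu> - pi) = - unit_vector \<nu>" by (simp add: unit_vector_def cos_diff sin_diff)
  have e: "\<eta> - (\<nu> - pi) = \<eta> - \<nu> + pi" by simp
  note up = half_disc_at_support(1)[OF assms(1), of _ m \<eta> \<nu>] half_disc_at_support(2)[OF assms(1), of m \<eta> \<nu>]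
  note low = half_disc_at_support(1)[OF assms(1), of _ m \<eta> "\<nu> - pi", unfolded opp e]
    half_disc_at_support(2)[OF assms(1), of m \<eta> "\<nu> - pi", unfolded opp e]
  show "?f ` ?H \<subseteq> {?l..?u}"
  proof clarify
    fix p assume p: "p \<in> ?H"
    have "?f p \<le> (m \<bullet> unit_vector \<nu> + r * half_disc_support (\<eta> - \<nu>)) / h"
      using up(1)[OF p] assms(2) by (simp add: divide_right_mono)
    moreover have "(m \<bullet> unit_vector \<nu> - r * half_disc_support (\<eta> - \<nu> + pi)) / h \<le> ?f p"
      using low(1)[OF p] assms(2) by (intro divide_right_mono) auto
    ultimately show "?f p \<in> {?l..?u}" by (simp add: add_divide_distrib diff_divide_distrib)
  qed
  obtain p q where "p \<in> ?H" "?f p = ?u" "q \<in> ?H" "?f q = ?l"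
  proof -
    obtain p q where pq: "p \<in> ?H" "p \<bullet> unit_vector \<nu> = m \<bullet> unit_vector \<nu> + r * half_disc_support (\<eta> - \<nu>)"
      "q \<in> ?H" "q \<bullet> - unit_vector \<nu> = m \<bullet> - unit_vector \<nu> + r * half_disc_support (\<eta> - \<nu> + pi)"
      using up(2) low(2) by blast
    then have "q \<bullet> unit_vector \<nu> = m \<bullet> unit_vector \<nu> - r * half_disc_support (\<eta> - \<nu> + pi)" by simp
    then show ?thesis using that[of p q] pq by (simp add: add_divide_distrib diff_divide_distrib)
  qed
  moreover have "linear ?f" by (rule linearI) (simp_all add: inner_add_left add_divide_distrib)
  ultimately show "{?l..?u} \<subseteq> ?f ` ?H"
    using convex_attains_level[OF convex_half_disc_at, of ?f q r m \<eta> p] by (force simp: image_iff)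
qed

text \<open>The half disc and its reflection in the centre cover the disc and overlap in the diameter.\<close>
lemma area_half_disc_at:
  assumes "0 \<le> r"
  shows "emeasure lborel (half_disc_at r m \<eta>) = ennreal (pi * r\<^sup>2 / 2)"
proof -
  let ?H = "half_disc_at r m \<eta>" and ?G = "half_disc_at r m (\<eta> + pi)"
  have opp: "unit_vector (\<eta> + pi) = - unit_vector \<eta>" by (simp add: unit_vector_def)
  have borel: "half_disc_at r m \<theta> \<in> sets borel" for \<theta> by (intro borel_compact compact_half_disc_at)
  have G: "?G = {p. - (p + (- 2 *\<^sub>R m)) \<in> ?H}"
  proof -
    have n1: "- (p + (- 2 *\<^sub>R m)) - m = - (p - m)" for p by (simp add: scaleR_2)
    have n2: "dist m (- (p + (- 2 *\<^sub>R m))) = dist m p" for p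
    proof -
      have "m - - (p + (- 2 *\<^sub>R m)) = p - m" by (simp add: scaleR_2)
      then show ?thesis unfolding dist_norm by (simp only: norm_minus_commute)
    qed
    have "p \<in> ?G \<longleftrightarrow> - (p + (- 2 *\<^sub>R m)) \<in> ?H" for p
      unfolding half_disc_at_def mem_Collect_eq mem_cball n1 n2 opp by (simp only: inner_minus_left inner_minus_right)
    then show ?thesis by blast
  qed
  have meas: "{z. - z \<in> ?H} \<in> sets borel"
  proof -
    have [measurable]: "(\<lambda>z::plane. - z) \<in> borel \<rightarrow>\<^sub>M borel"
      by (intro borel_measurable_continuous_onI continuous_intros)
    note [measurable] = borel
    show ?thesis by measurable
  qed
  have "emeasure lborel ?G = emeasure lborel {z. - z \<in> ?H}"
    unfolding G using emeasure_lborel_translate[OF meas, of "- 2 *\<^sub>R m"] by simp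
  then have GH: "emeasure lborel ?G = emeasure lborel ?H"
    using emeasure_lborel_reflect[OF borel] by simp
  have U: "?H \<union> ?G = cball m r" by (auto simp: half_disc_at_def opp)
  have "negligible {p. unit_vector \<eta> \<bullet> p = m \<bullet> unit_vector \<eta>}"
    by (rule negligible_hyperplane) (metis norm_unit_vector norm_zero zero_neq_one)
  moreover have "?H \<inter> ?G \<subseteq> {p. unit_vector \<eta> \<bullet> p = m \<bullet> unit_vector \<eta>}"
    by (auto simp: half_disc_at_def opp inner_diff inner_commute)
  ultimately have "negligible (?H \<inter> ?G)" using negligible_subset by blast
  then have "?H \<inter> ?G \<in> null_sets lborel"
    using borel by (simp add: negligible_iff_null_sets null_sets_completion_iff)
  then have "AE p in lborel. p \<notin> ?H \<inter> ?G" by (rule AE_not_in)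
  then have "emeasure lborel (?H \<union> ?G) = emeasure lborel ?H + emeasure lborel ?G"
    using emeasure_Un_Int[of ?H lborel ?G] borel \<open>?H \<inter> ?G \<in> null_sets lborel\<close> by (simp add: null_setsD1)
  then have "2 * emeasure lborel ?H = emeasure lborel (cball m r)" using GH U by (simp add: mult_2)
  also have "\<dots> = ennreal (pi * r\<^sup>2)"
    using emeasure_cball[OF assms, of m] unit_ball_vol_numeral(1)[of Num.One] by (simp add: power2_eq_square)
  also have "\<dots> = 2 * ennreal (pi * r\<^sup>2 / 2)"
    by (subst ennreal_numeral[symmetric], subst ennreal_mult[symmetric]) auto
  finally show ?thesis by (simp add: ennreal_mult_cancel_left)
qed

lemma support_fun_half_disc_at:
  assumes "0 \<le> r"
  shows "support_fun (half_disc_at r m \<delta>) \<phi> = fst (rot \<phi> m) + r * half_disc_support (\<phi> + \<delta>)"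
proof -
  have "fst ` half_disc_at r (rot \<phi> m) (\<delta> + \<phi>)
    = (\<lambda>p. p \<bullet> unit_vector 0 / 1) ` half_disc_at r (rot \<phi> m) (\<delta> + \<phi>)"
    by (simp add: inner_unit_vector)
  also have "\<dots> = {fst (rot \<phi> m) - r * half_disc_support (\<delta> + \<phi> + pi)..fst (rot \<phi> m) + r * half_disc_support (\<delta> + \<phi>)}"
    using half_disc_at_image[OF assms, of 1 0 "rot \<phi> m" "\<delta> + \<phi>"] by (simp add: inner_unit_vector)
  finally have im: "fst ` half_disc_at r (rot \<phi> m) (\<delta> + \<phi>) = \<dots>" .
  have "0 \<le> half_disc_support x" for x by (simp add: half_disc_support_def)
  then have "fst (rot \<phi> m) - r * half_disc_support (\<delta> + \<phi> + pi) \<le> fst (rot \<phi> m) + r * half_disc_support (\<delta> + \<phi>)"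
    using assms by (smt (verit) mult_nonneg_nonneg)
  then show ?thesis unfolding support_fun_def rot_half_disc_at im by (simp add: add.commute)
qed

section \<open>The random throw\<close>

text \<open>The event is the projection of a closed set along the compact body.\<close>
lemma closed_hit_event:
  assumes "compact C" "closed T"
  shows "closed {(q, \<phi>). placed \<alpha> C q \<phi> \<inter> T \<noteq> {}}"
proof -
  let ?g = "\<lambda>(v :: plane, q :: plane, \<phi>). q + rot (\<alpha> + pi / 2 + \<phi>) v"
  have "continuous_on UNIV ?g"
    unfolding rot_def case_prod_beta by (intro continuous_intros)
  then have "closed (?g -` T)" using assms(2) by (simp add: closed_vimage)
  from closed_compact_projection[OF assms(1) this]
  have "closed {y. \<exists>v. v \<in> C \<and> (v, y) \<in> ?g -` T}" .
  also have "{y. \<exists>v. v \<in> C \<and> (v, y) \<in> ?g -` T} = {(q, \<phi>). placed \<alpha> C q \<phi> \<inter> T \<noteq> {}}"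
    by (auto simp: placed_def)
  finally show ?thesis .
qed

text \<open>Reduction to sets of natural numbers, by an injection of the countable index type.\<close>
lemma measurable_card_countable:
  fixes I :: "'a::countable set"
  assumes "\<And>s. s \<in> I \<Longrightarrow> A s \<in> sets M"
  shows "{x \<in> space M. card {s \<in> I. x \<in> A s} = n} \<in> sets M"
proof -
  define N where "N x = to_nat ` {s \<in> I. x \<in> A s}" for x
  have card: "card (N x) = card {s \<in> I. x \<in> A s}" for x
    unfolding N_def by (rule card_image) (rule inj_on_subset[OF inj_to_nat], simp)
  have "{x \<in> space M. k \<in> N x} \<in> sets M" for k
  proof -
    have "{x \<in> space M. k \<in> N x} = (\<Union>s\<in>{s \<in> I. to_nat s = k}. A s \<inter> space M)"
      by (auto simp: N_def)
    also have "\<dots> \<in> sets M"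
      using assms by (intro sets.countable_UN') (auto intro: countable_subset[OF subset_UNIV])
    finally show ?thesis .
  qed
  then have "(\<lambda>x. card (N x)) \<in> measurable M (count_space UNIV)" by (rule measurable_card)
  then have "(\<lambda>x. card (N x)) -` {n} \<inter> space M \<in> sets M" by (rule measurable_sets) simp
  also have "(\<lambda>x. card (N x)) -` {n} \<inter> space M = {x \<in> space M. card {s \<in> I. x \<in> A s} = n}"
    unfolding card by auto
  finally show ?thesis .
qed

locale half_disc_throw = triangle_sides_angles +
  fixes r \<delta> :: real and m :: plane
  assumes acute: "\<alpha> \<le> pi / 2" "\<beta> \<le> pi / 2" "\<gamma> \<le> pi / 2"
    and radius: "0 < r"
    and fits: "\<And>\<phi>. \<phi> \<in> {0..<2 * pi} \<Longrightarrow> c_star \<alpha> \<beta> (support_fun (half_disc_at r m \<delta>)) \<phi> \<le> c"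
begin

abbreviation "g \<equiv> half_disc_support"

definition "C = half_disc_at r m \<delta>"
text \<open>The altitudes are \<open>Q / a\<close>, \<open>Q / b\<close>, \<open>Q / c\<close>. So \<open>\<kappa> a g\<close> is a support value in units of the
altitude on \<open>a\<close>; \<open>fit \<psi>\<close> is the side of the circumscribed triangle in units of the triangles of
the lattice, \<open>fit (\<psi> + \<pi>)\<close> the one for the triangles of the other kind, and \<open>pairs\<close> the sum of
the products of two relative widths. The argument \<open>\<psi>\<close> is \<open>\<phi> + \<delta>\<close>, where \<open>\<delta>\<close> is the angle of the
symmetry axis in the standard position of the body.\<close>
definition "Q = a * b * sin \<gamma>"
definition "\<kappa> = r / Q"
definition "fit \<psi> = \<kappa> * (a * g (\<psi> + \<alpha> + \<beta>) + b * g \<psi> + c * g (\<psi> + \<alpha> + pi))"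
definition "width \<psi> = 1 + \<bar>sin \<psi>\<bar>" for \<psi> :: real
definition "pairs \<psi> = \<kappa>\<^sup>2 * (b * c * (width \<psi> * width (\<psi> + \<alpha>)) + b * a * (width \<psi> * width (\<psi> + \<alpha> + \<beta>))
  + c * a * (width (\<psi> + \<alpha>) * width (\<psi> + \<alpha> + \<beta>)))"
definition "no_line_prob \<psi> = ((1 - fit \<psi>)\<^sup>2 + (1 - fit (\<psi> + pi))\<^sup>2) / 2"
definition "three_line_prob \<psi> = 1 - (fit \<psi> + fit (\<psi> + pi)) + pairs \<psi> - no_line_prob \<psi>"

definition body_coords :: "real \<Rightarrow> plane set" where
  "body_coords \<phi> = to_coords ` rot (\<alpha> + pi / 2 + \<phi>) ` C"

lemma Q_pos: "0 < Q" unfolding Q_def using sides_pos sines_pos by simp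

lemma Q_eq: "Q = a * c * sin \<beta>" "Q = b * c * sin \<alpha>"
  unfolding Q_def using law_of_sines by (simp_all add: mult.assoc mult.left_commute[of a b])

lemma heights: "r / (a * sin \<gamma>) = \<kappa> * b" "r / (a * sin \<beta>) = \<kappa> * c" "r / (b * sin \<gamma>) = \<kappa> * a"
proof -
  show "r / (a * sin \<gamma>) = \<kappa> * b" "r / (b * sin \<gamma>) = \<kappa> * a"
    using sides_pos sines_pos by (simp_all add: \<kappa>_def Q_def field_simps)
  show "r / (a * sin \<beta>) = \<kappa> * c"
    using sides_pos sines_pos by (simp add: \<kappa>_def Q_eq(1) field_simps)
qed

lemma fit_periodic: "fit (\<psi> + 2 * pi) = fit \<psi>"
proof -
  have e: "\<psi> + 2 * pi + \<alpha> + \<beta> = \<psi> + \<alpha> + \<beta> + 2 * pi" "\<psi> + 2 * pi + \<alpha> + pi = \<psi> + \<alpha> + pi + 2 * pi"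
    by simp_all
  show ?thesis unfolding fit_def e half_disc_support_periodic ..
qed

text \<open>The contributions of the centre \<open>m\<close> cancel, since the outer normals weighted with the lengths
of the sides sum to 0. So \<open>c\<^sup>*\<close> does not change under translations of the body.\<close>
lemma c_star_eq_fit: "c_star \<alpha> \<beta> (support_fun C) \<phi> = c * fit (\<phi> + \<delta>)"
proof -
  define R S where "R t = fst m * cos t - snd m * sin t" and "S t = fst m * sin t + snd m * cos t" for t
  have rot: "fst (rot t m) = R t" for t by (simp add: rot_def R_def case_prod_beta)
  have sp: "sin \<alpha> \<noteq> 0" "sin \<beta> \<noteq> 0" using sines_pos by auto
  define t where "t = \<phi> + \<alpha>"
  have R1: "R \<phi> = cos \<alpha> * R t + sin \<alpha> * S t"
  proof -
    have "R \<phi> = R (t - \<alpha>)" by (simp add: t_def)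
    then show ?thesis unfolding R_def S_def by (simp add: cos_diff sin_diff algebra_simps)
  qed
  have R2: "R (\<phi> + \<alpha> + \<beta>) = cos \<beta> * R t - sin \<beta> * S t" "R (\<phi> + \<alpha> + pi) = - R t"
    unfolding R_def S_def t_def[symmetric] by (simp_all add: cos_add sin_add algebra_simps)
  have zero: "R \<phi> * (1 / sin \<alpha>) + R (\<phi> + \<alpha> + \<beta>) * (1 / sin \<beta>) + R (\<phi> + \<alpha> + pi) * (cot \<alpha> + cot \<beta>) = 0"
    unfolding R1 R2 cot_def using sp by (simp add: field_simps)
  have k: "r * (1 / sin \<alpha>) = c * \<kappa> * b" "r * (1 / sin \<beta>) = c * \<kappa> * a"
  proof -
    show "r * (1 / sin \<alpha>) = c * \<kappa> * b" unfolding \<kappa>_def Q_eq(2) using sides_pos sp by simp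
    show "r * (1 / sin \<beta>) = c * \<kappa> * a" unfolding \<kappa>_def Q_eq(1) using sides_pos sp by simp
  qed
  have k3: "r * (cot \<alpha> + cot \<beta>) = c * \<kappa> * c"
  proof -
    have "cot \<alpha> + cot \<beta> = sin (\<alpha> + \<beta>) / (sin \<alpha> * sin \<beta>)"
      unfolding sin_add cot_def using sp by (simp add: field_simps)
    also have "sin (\<alpha> + \<beta>) = sin \<gamma>" using angle_sum sin_pi_minus[of \<gamma>] by (metis add_diff_cancel_right')
    also have "sin \<gamma> / (sin \<alpha> * sin \<beta>) = c * c / Q"
    proof -
      have "c * c * (sin \<alpha> * sin \<beta>) = (c * sin \<alpha>) * (c * sin \<beta>)" by simp
      also have "\<dots> = sin \<gamma> * Q" unfolding law_of_sines(1,2)[symmetric] Q_def by simp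
      finally show ?thesis using Q_pos sp by (simp add: field_simps)
    qed
    finally show ?thesis by (simp add: \<kappa>_def)
  qed
  have "c_star \<alpha> \<beta> (support_fun C) \<phi> = (R \<phi> * (1 / sin \<alpha>) + R (\<phi> + \<alpha> + \<beta>) * (1 / sin \<beta>) + R (\<phi> + \<alpha> + pi) * (cot \<alpha> + cot \<beta>))
    + (r * (1 / sin \<alpha>) * g (\<phi> + \<delta>) + r * (1 / sin \<beta>) * g (\<phi> + \<alpha> + \<beta> + \<delta>) + r * (cot \<alpha> + cot \<beta>) * g (\<phi> + \<alpha> + pi + \<delta>))"
    unfolding c_star_def C_def support_fun_half_disc_at[OF less_imp_le[OF radius]] rot
    by (simp only: distrib_left distrib_right mult.assoc mult.left_commute add.assoc add.left_commute add.commute mult.commute)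
  also have "\<dots> = c * fit (\<phi> + \<delta>)"
    unfolding zero k k3 fit_def by (simp add: algebra_simps)
  finally show ?thesis .
qed

lemma fit_le_1: "fit \<psi> \<le> 1"
proof -
  define n where "n = \<lfloor>(\<psi> - \<delta>) / (2 * pi)\<rfloor>"
  define \<phi> where "\<phi> = \<psi> - \<delta> - of_int n * (2 * pi)"
  have nat: "fit (x + of_nat k * (2 * pi)) = fit x" for x k
  proof (induction k)
    case (Suc k)
    have e: "x + of_nat (Suc k) * (2 * pi) = x + of_nat k * (2 * pi) + 2 * pi" by (simp add: algebra_simps)
    show ?case unfolding e fit_periodic by (rule Suc)
  qed simp
  have int: "fit (x + of_int k * (2 * pi)) = fit x" for x k
  proof (cases "0 \<le> k")
    case True
    then show ?thesis using nat[of x "nat k"] by simp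
  next
    case False
    then show ?thesis using nat[of "x + of_int k * (2 * pi)" "nat (- k)"] by simp
  qed
  have "\<phi> \<in> {0..<2 * pi}"
  proof -
    have "of_int n * (2 * pi) \<le> (\<psi> - \<delta>) / (2 * pi) * (2 * pi)" unfolding n_def by (intro mult_right_mono) auto
    moreover have "(\<psi> - \<delta>) / (2 * pi) * (2 * pi) < (of_int n + 1) * (2 * pi)"
      unfolding n_def by (intro mult_strict_right_mono) (linarith, simp)
    moreover have "(\<psi> - \<delta>) / (2 * pi) * (2 * pi) = \<psi> - \<delta>" by simp
    ultimately show ?thesis unfolding \<phi>_def distrib_right by simp
  qed
  then have "c * fit (\<phi> + \<delta>) \<le> c" using fits[of \<phi>] c_star_eq_fit[of \<phi>] by (simp add: C_def)
  then have "fit (\<phi> + \<delta>) \<le> 1" using sides_pos by simp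
  moreover have "fit \<psi> = fit (\<phi> + \<delta>)" using int[of "\<phi> + \<delta>" n] by (simp add: \<phi>_def)
  ultimately show ?thesis by simp
qed

lemma linear_coords_image:
  "fst (to_coords p) = p \<bullet> unit_vector (\<alpha> - pi / 2) / (a * sin \<gamma>)"
  "snd (to_coords p) = p \<bullet> unit_vector (pi / 2) / (a * sin \<beta>)"
  "fst (to_coords p) + snd (to_coords p) = p \<bullet> unit_vector (pi / 2 - \<beta>) / (b * sin \<gamma>)"
  unfolding sum_coords unfolding to_coords_def by (simp_all add: inner_unit_vector cos_diff sin_diff)

text \<open>The three coordinates are inner products with the unit normals of the sides, divided by the
altitudes, so their ranges come from the support function. The condition on \<open>c\<^sup>*\<close> at \<open>\<psi>\<close> and at
\<open>\<psi> + \<pi>\<close> yields the two conditions of fitting.\<close>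
lemma lattice_body_coords:
  fixes \<phi>
  defines "\<psi> \<equiv> \<phi> + \<delta>" and "z \<equiv> to_coords (rot (\<alpha> + pi / 2 + \<phi>) m)"
  shows "lattice_body (body_coords \<phi>) (fst z - \<kappa> * b * g \<psi>) (fst z + \<kappa> * b * g (\<psi> + pi))
    (snd z - \<kappa> * c * g (\<psi> + \<alpha> + pi)) (snd z + \<kappa> * c * g (\<psi> + \<alpha>))
    (fst z + snd z - \<kappa> * a * g (\<psi> + \<alpha> + \<beta> + pi)) (fst z + snd z + \<kappa> * a * g (\<psi> + \<alpha> + \<beta>))"
proof -
  let ?H = "half_disc_at r (rot (\<alpha> + pi / 2 + \<phi>) m) (\<delta> + (\<alpha> + pi / 2 + \<phi>))"
  have K: "body_coords \<phi> = to_coords ` ?H" unfolding body_coords_def C_def rot_half_disc_at ..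
  have pos: "0 < a * sin \<gamma>" "0 < a * sin \<beta>" "0 < b * sin \<gamma>" using sides_pos sines_pos by simp_all
  note img = half_disc_at_image[OF less_imp_le[OF radius]]
  have per: "g (x + pi + pi) = g x" for x using half_disc_support_periodic[of x] by (simp add: add.assoc)
  show ?thesis
  proof
    show "compact (body_coords \<phi>)"
      unfolding K using linear_to_coords
      by (intro compact_continuous_image linear_continuous_on compact_half_disc_at) (simp add: linear_conv_bounded_linear)
    show "convex (body_coords \<phi>)"
      unfolding K by (intro convex_linear_image linear_to_coords convex_half_disc_at)
    show "body_coords \<phi> \<noteq> {}"
      unfolding K using half_disc_at_support(2)[OF less_imp_le[OF radius]] by blast
    have e: "\<delta> + (\<alpha> + pi / 2 + \<phi>) - (\<alpha> - pi / 2) = \<psi> + pi" "\<delta> + (\<alpha> + pi / 2 + \<phi>) - pi / 2 = \<psi> + \<alpha>"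
      "\<delta> + (\<alpha> + pi / 2 + \<phi>) - (pi / 2 - \<beta>) = \<psi> + \<alpha> + \<beta>"
      by (simp_all add: \<psi>_def field_simps)
    show "fst ` body_coords \<phi> = {fst z - \<kappa> * b * g \<psi>..fst z + \<kappa> * b * g (\<psi> + pi)}"
      unfolding K image_image linear_coords_image(1) img[OF pos(1)] heights e per z_def linear_coords_image(1) ..
    show "snd ` body_coords \<phi> = {snd z - \<kappa> * c * g (\<psi> + \<alpha> + pi)..snd z + \<kappa> * c * g (\<psi> + \<alpha>)}"
      unfolding K image_image linear_coords_image(2) img[OF pos(2)] heights e z_def linear_coords_image(2) ..
    show "(\<lambda>p. fst p + snd p) ` body_coords \<phi> = {fst z + snd z - \<kappa> * a * g (\<psi> + \<alpha> + \<beta> + pi)..fst z + snd z + \<kappa> * a * g (\<psi> + \<alpha> + \<beta>)}"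
      unfolding K image_image z_def linear_coords_image(3) img[OF pos(3)] heights e ..
    show "fst z + snd z + \<kappa> * a * g (\<psi> + \<alpha> + \<beta>) - (fst z - \<kappa> * b * g \<psi>) - (snd z - \<kappa> * c * g (\<psi> + \<alpha> + pi)) \<le> 1"
      using fit_le_1[of \<psi>] by (simp add: fit_def algebra_simps)
    have "fit (\<psi> + pi) = \<kappa> * (a * g (\<psi> + \<alpha> + \<beta> + pi) + b * g (\<psi> + pi) + c * g (\<psi> + \<alpha>))"
      using per[of "\<psi> + \<alpha>"] by (simp add: fit_def ac_simps)
    then show "fst z + \<kappa> * b * g (\<psi> + pi) + (snd z + \<kappa> * c * g (\<psi> + \<alpha>)) - (fst z + snd z - \<kappa> * a * g (\<psi> + \<alpha> + \<beta> + pi)) \<le> 1"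
      using fit_le_1[of "\<psi> + pi"] by (simp add: algebra_simps)
  qed
qed

lemma area_body_coords: "measure lborel (body_coords \<phi>) = pi * r\<^sup>2 / 2 / Q"
proof -
  have H: "from_coords ` body_coords \<phi> = half_disc_at r (rot (\<alpha> + pi / 2 + \<phi>) m) (\<delta> + (\<alpha> + pi / 2 + \<phi>))"
    unfolding body_coords_def C_def rot_half_disc_at image_image by simp
  have "compact (body_coords \<phi>)" using lattice_body_coords lattice_body.compact by blast
  then have K: "body_coords \<phi> \<in> sets borel" "emeasure lborel (body_coords \<phi>) = ennreal (measure lborel (body_coords \<phi>))"
    using emeasure_eq_ennreal_measure[OF less_imp_neq[OF emeasure_compact_finite[unfolded infinity_ennreal_def]]]
    by (auto simp: borel_compact)
  have "ennreal (pi * r\<^sup>2 / 2) = ennreal Q * ennreal (measure lborel (body_coords \<phi>))"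
    using emeasure_from_coords(2)[OF K(1)] K(2) area_half_disc_at[OF less_imp_le[OF radius]] unfolding H Q_def by simp
  also have "\<dots> = ennreal (Q * measure lborel (body_coords \<phi>))" using Q_pos by (simp add: ennreal_mult)
  finally have "pi * r\<^sup>2 / 2 = Q * measure lborel (body_coords \<phi>)" using Q_pos by (subst (asm) ennreal_inj) auto
  then show ?thesis using Q_pos by (simp add: field_simps)
qed

text \<open>The conditional probability of hitting \<open>n\<close> triangles, for \<open>n\<close> from 1 to 6, when the direction
is given.\<close>
definition "hit_prob_at n \<psi> =
  (if n = 1 then no_line_prob \<psi>
   else if n = 2 then fit \<psi> + fit (\<psi> + pi) - 2 * pairs \<psi> + 3 * three_line_prob \<psi>
   else if n = 3 then pairs \<psi> - 3 * three_line_prob \<psi>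
   else if n = 4 then three_line_prob \<psi> - pi * r\<^sup>2 / 2 / Q
   else if n = 5 then 0
   else pi * r\<^sup>2 / 2 / Q)" for n :: nat

lemma unit_square_hit_measure:
  assumes "\<And>n. (hit_positions (body_coords \<phi>) n) \<in> sets borel" "n \<in> {1..6}"
  shows "measure lborel (hit_positions (body_coords \<phi>) n) = hit_prob_at n (\<phi> + \<delta>)"
proof -
  define \<psi> z where "\<psi> = \<phi> + \<delta>" and "z = to_coords (rot (\<alpha> + pi / 2 + \<phi>) m)"
  interpret B: lattice_body "body_coords \<phi>" "fst z - \<kappa> * b * g \<psi>" "fst z + \<kappa> * b * g (\<psi> + pi)"
    "snd z - \<kappa> * c * g (\<psi> + \<alpha> + pi)" "snd z + \<kappa> * c * g (\<psi> + \<alpha>)"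
    "fst z + snd z - \<kappa> * a * g (\<psi> + \<alpha> + \<beta> + pi)" "fst z + snd z + \<kappa> * a * g (\<psi> + \<alpha> + \<beta>)"
    unfolding \<psi>_def z_def by (rule lattice_body_coords)
  have per: "g (x + pi + pi) = g x" for x using half_disc_support_periodic[of x] by (simp add: add.assoc)
  have up: "B.t_up = fit \<psi>" unfolding B.t_up_def fit_def by (simp add: algebra_simps)
  have down: "B.t_down = fit (\<psi> + pi)"
    using per[of "\<psi> + \<alpha>"] unfolding B.t_down_def fit_def by (simp add: algebra_simps)
  have wid: "\<kappa> * k * g (x + pi) + \<kappa> * k * g x = \<kappa> * k * width x" for k x
    unfolding width_def half_disc_support_width[symmetric] by (simp add: algebra_simps)
  have w: "fst z + \<kappa> * b * g (\<psi> + pi) - (fst z - \<kappa> * b * g \<psi>) = \<kappa> * b * width \<psi>"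
    "snd z + \<kappa> * c * g (\<psi> + \<alpha>) - (snd z - \<kappa> * c * g (\<psi> + \<alpha> + pi)) = \<kappa> * c * width (\<psi> + \<alpha>)"
    "fst z + snd z + \<kappa> * a * g (\<psi> + \<alpha> + \<beta>) - (fst z + snd z - \<kappa> * a * g (\<psi> + \<alpha> + \<beta> + pi)) = \<kappa> * a * width (\<psi> + \<alpha> + \<beta>)"
    unfolding wid[symmetric] by simp_all
  have pairs: "B.pair_sum = pairs \<psi>"
    unfolding B.pair_sum_def w pairs_def by (simp add: algebra_simps power2_eq_square)
  have none: "B.no_line = no_line_prob \<psi>" unfolding B.no_line_def up down no_line_prob_def ..
  have three: "B.three_lines = three_line_prob \<psi>"
    unfolding B.three_lines_def up down pairs none three_line_prob_def ..
  have "n = 1 \<or> n = 2 \<or> n = 3 \<or> n = 4 \<or> n = 5 \<or> n = 6" using assms(2) by auto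
  then show ?thesis
    using B.hit_measures[OF assms(1)] unfolding up down pairs none three area_body_coords \<psi>_def[symmetric]
    by (auto simp: hit_prob_at_def)
qed

lemma placed_coords: "to_coords ` placed \<alpha> C q \<phi> = (+) (to_coords q) ` body_coords \<phi>"
  unfolding placed_def body_coords_def image_image by (simp add: linear_add[OF linear_to_coords])

definition "hit_event n = {(q, \<phi>). card {T \<in> lattice_triangles a b c \<alpha> \<beta> \<gamma>. placed \<alpha> C q \<phi> \<inter> T \<noteq> {}} = n}"

lemma hit_event_iff: "(q, \<phi>) \<in> hit_event n \<longleftrightarrow> card (hit_cells ((+) (to_coords q) ` body_coords \<phi>)) = n"
  unfolding hit_event_def by (simp add: card_hit_triangles placed_coords)

text \<open>Joint measurability in position and direction is needed for the product measure: the measure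
of a set that is not measurable would be 0.\<close>
lemma hit_event_borel: "hit_event n \<in> sets borel"
proof -
  let ?A = "\<lambda>s. {(q, \<phi>). placed \<alpha> C q \<phi> \<inter> from_coords ` cell s \<noteq> {}}"
  have A: "?A s \<in> sets borel" for s
    using closed_hit_event[of C "from_coords ` cell s" \<alpha>] compact_half_disc_at
      closed_injective_linear_image[OF closed_cell linear_from_coords inj_from_coords]
    by (auto simp: C_def intro!: borel_closed)
  have "hit_event n = {x \<in> space borel. card {s \<in> cell_index. x \<in> ?A s} = n}"
  proof -
    have "{s \<in> cell_index. (q, \<phi>) \<in> ?A s} = hit_cells ((+) (to_coords q) ` body_coords \<phi>)" for q \<phi>
      unfolding hit_cells_def placed_coords[symmetric] by (simp add: meets_from_coords_iff)
    then have "x \<in> hit_event n \<longleftrightarrow> card {s \<in> cell_index. x \<in> ?A s} = n" for x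
      by (cases x) (simp only: hit_event_iff)
    then show ?thesis by auto
  qed
  also have "\<dots> \<in> sets borel" by (rule measurable_card_countable) (rule A)
  finally show ?thesis .
qed

text \<open>In lattice coordinates the parallelogram is the closed unit square, which differs from the
half-open one by a null set.\<close>
lemma hit_section_measure:
  assumes n: "n \<in> {1..6}"
  shows "emeasure (uniform_measure lborel (base_parallelogram a b c \<alpha> \<beta> \<gamma>)) {q. (q, \<phi>) \<in> hit_event n}
    = ennreal (hit_prob_at n (\<phi> + \<delta>))" "0 \<le> hit_prob_at n (\<phi> + \<delta>)"
proof -
  let ?E = "\<lambda>n. {z. card (hit_cells ((+) z ` body_coords \<phi>)) = n}"
  let ?P = "base_parallelogram a b c \<alpha> \<beta> \<gamma>" and ?sq = "{0..1} \<times> {0..1} :: plane set"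
  have sec: "{q. (q, \<phi>) \<in> hit_event n} \<in> sets borel" for n
  proof -
    have [measurable]: "(\<lambda>q::plane. (q, \<phi>)) \<in> borel \<rightarrow>\<^sub>M borel"
      by (intro borel_measurable_continuous_onI continuous_intros)
    show ?thesis using measurable_sets[OF _ hit_event_borel[of n], of "\<lambda>q. (q, \<phi>)" borel] by (simp add: vimage_def)
  qed
  have E: "?E n \<in> sets borel" for n
  proof -
    have "from_coords \<in> borel \<rightarrow>\<^sub>M borel"
      unfolding from_coords_def by (intro borel_measurable_continuous_onI continuous_intros)
    from measurable_sets[OF this sec[of n]] show ?thesis by (simp add: vimage_def hit_event_iff)
  qed
  have sq: "?sq \<in> sets borel" by (intro borel_Times) auto
  note P = base_parallelogram_measure[folded Q_def]
  have "?P \<inter> {q. (q, \<phi>) \<in> hit_event n} = from_coords ` (?sq \<inter> ?E n)"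
    unfolding base_parallelogram_coords by (auto simp: hit_event_iff)
  then have "emeasure lborel (?P \<inter> {q. (q, \<phi>) \<in> hit_event n}) = ennreal Q * emeasure lborel (?sq \<inter> ?E n)"
    using emeasure_from_coords(2)[OF sets.Int[OF sq E]] by (simp add: Q_def)
  also have "emeasure lborel (?sq \<inter> ?E n) = emeasure lborel (hit_positions (body_coords \<phi>) n)"
  proof (rule emeasure_eq_AE)
    show "AE z in lborel. z \<in> ?sq \<inter> ?E n \<longleftrightarrow> z \<in> hit_positions (body_coords \<phi>) n"
      using AE_not_integer_offset(1)[of 0] AE_not_integer_offset(2)[of 0]
    proof eventually_elim
      case (elim z)
      then have "fst z \<noteq> 1" "snd z \<noteq> 1" by auto
      then show ?case by (auto simp: hit_positions_def unit_square_def mem_Times_iff)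
    qed
    show "?sq \<inter> ?E n \<in> sets lborel" using sets.Int[OF sq E] by simp
    show "hit_positions (body_coords \<phi>) n \<in> sets lborel"
      using sets.Int[OF unit_square_borel E[of n]] by (simp add: hit_positions_def Int_def)
  qed
  also have "\<dots> = ennreal (measure lborel (hit_positions (body_coords \<phi>) n))"
  proof (rule emeasure_eq_ennreal_measure)
    show "emeasure lborel (hit_positions (body_coords \<phi>) n) \<noteq> top"
      using emeasure_mono[of "hit_positions (body_coords \<phi>) n" unit_square lborel] emeasure_unit_square
      by (auto simp: hit_positions_def top_unique)
  qed
  also have m: "measure lborel (hit_positions (body_coords \<phi>) n) = hit_prob_at n (\<phi> + \<delta>)"
    using unit_square_hit_measure[of \<phi> n] sets.Int[OF unit_square_borel E] n by (simp add: hit_positions_def Int_def)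
  finally have "emeasure lborel (?P \<inter> {q. (q, \<phi>) \<in> hit_event n}) = ennreal Q * ennreal (hit_prob_at n (\<phi> + \<delta>))" .
  moreover show "0 \<le> hit_prob_at n (\<phi> + \<delta>)" unfolding m[symmetric] by simp
  ultimately show "emeasure (uniform_measure lborel ?P) {q. (q, \<phi>) \<in> hit_event n} = ennreal (hit_prob_at n (\<phi> + \<delta>))"
    using P sec Q_pos by (simp add: emeasure_uniform_measure ennreal_mult[symmetric] divide_ennreal)
qed

lemma hit_prob_eq_average:
  assumes n: "n \<in> {1..6}" and I: "((\<lambda>\<phi>. hit_prob_at n (\<phi> + \<delta>)) has_integral I) {0..2 * pi}"
  shows "hit_prob a b c \<alpha> \<beta> \<gamma> C n = I / (2 * pi)"
proof -
  let ?P = "uniform_measure lborel (base_parallelogram a b c \<alpha> \<beta> \<gamma>)" and ?A = "uniform_measure lborel {0..2 * pi}"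
  note Ppar = base_parallelogram_measure[folded Q_def]
  interpret P: finite_measure ?P
    by (rule finite_measureI) (use Ppar Q_pos in \<open>simp add: emeasure_uniform_measure divide_ennreal\<close>)
  interpret A: finite_measure ?A
    by (rule finite_measureI) (simp add: emeasure_uniform_measure divide_ennreal)
  interpret PA: pair_sigma_finite ?P ?A ..
  have sets: "hit_event n \<in> sets (?P \<Otimes>\<^sub>M ?A)"
  proof -
    have "sets (?P \<Otimes>\<^sub>M ?A) = sets (borel \<Otimes>\<^sub>M borel :: (plane \<times> real) measure)"
      by (rule sets_pair_measure_cong) simp_all
    then show ?thesis using hit_event_borel[of n] by (simp only: borel_prod)
  qed
  have I0: "0 \<le> I" using has_integral_nonneg[OF I] hit_section_measure(2)[OF n] by blast
  have "emeasure (?P \<Otimes>\<^sub>M ?A) (hit_event n) = (\<integral>\<^sup>+\<phi>. ennreal (hit_prob_at n (\<phi> + \<delta>)) \<partial>?A)"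
    unfolding PA.emeasure_pair_measure_alt2[OF sets] vimage_def hit_section_measure(1)[OF n] ..
  also have "\<dots> = (\<integral>\<^sup>+\<phi>. ennreal (hit_prob_at n (\<phi> + \<delta>)) * indicator {0..2 * pi} \<phi> \<partial>lborel) / emeasure lborel {0..2 * pi}"
  proof (rule nn_integral_uniform_measure)
    have "(\<lambda>\<phi>. emeasure ?P ((\<lambda>q. (q, \<phi>)) -` hit_event n)) \<in> borel_measurable ?A"
      by (rule PA.measurable_emeasure_Pair2[OF sets])
    then show "(\<lambda>\<phi>. ennreal (hit_prob_at n (\<phi> + \<delta>))) \<in> borel_measurable lborel"
      unfolding vimage_def hit_section_measure(1)[OF n] by (simp add: measurable_def)
  qed simp
  also have "(\<integral>\<^sup>+\<phi>. ennreal (hit_prob_at n (\<phi> + \<delta>)) * indicator {0..2 * pi} \<phi> \<partial>lborel) = ennreal I"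
    by (rule nn_integral_has_integral_lebesgue'[OF _ I]) (rule hit_section_measure(2)[OF n])
  also have "ennreal I / emeasure lborel {0..2 * pi} = ennreal (I / (2 * pi))"
    using I0 by (simp add: divide_ennreal)
  finally have "emeasure (?P \<Otimes>\<^sub>M ?A) (hit_event n) = ennreal (I / (2 * pi))" .
  then show ?thesis
    using I0 by (simp add: hit_prob_def throw_measure_def hit_event_def[symmetric] measure_def)
qed

end

section \<open>Averaging over the directions\<close>

context half_disc_throw begin

definition "fit_integral = \<kappa> * (a + b + c) * (pi + 2)"
definition "fit_square_integral = \<kappa>\<^sup>2 * (2 * pi * (a\<^sup>2 + b\<^sup>2 + c\<^sup>2) + 8 * (a * b + b * c + c * a)
  - (\<alpha> * a\<^sup>2 + \<beta> * b\<^sup>2 + \<gamma> * c\<^sup>2) + 2 * (\<alpha> * b * c + \<beta> * c * a + \<gamma> * a * b) - 9 * Q)"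
definition "pairs_integral = \<kappa>\<^sup>2 * ((2 * pi + 8) * (a * b + b * c + c * a) - pi / 2 * (a\<^sup>2 + b\<^sup>2 + c\<^sup>2)
  + 2 * (\<alpha> * a\<^sup>2 + \<beta> * b\<^sup>2 + \<gamma> * c\<^sup>2) + 6 * Q)"

lemma integral_fit: "((\<lambda>\<phi>. fit (\<phi> + d)) has_integral fit_integral) {0..2 * pi}"
proof -
  note g = integral_half_disc_support
  have "((\<lambda>\<phi>. \<kappa> * (a * g (\<phi> + (d + \<alpha> + \<beta>)) + b * g (\<phi> + d) + c * g (\<phi> + (d + \<alpha> + pi)))) has_integral
    \<kappa> * (a * (pi + 2) + b * (pi + 2) + c * (pi + 2))) {0..2 * pi}"
    by (intro has_integral_mult_right has_integral_add g)
  moreover have "\<kappa> * (a * (pi + 2) + b * (pi + 2) + c * (pi + 2)) = fit_integral" by (simp add: fit_integral_def algebra_simps)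
  ultimately show ?thesis by (simp add: fit_def add.assoc)
qed

lemma side_products:
  "a * b * sin \<gamma> = Q" "c * a * sin \<beta> = Q" "b * c * sin \<alpha> = Q"
  "a * b * cos \<gamma> = (a\<^sup>2 + b\<^sup>2 - c\<^sup>2) / 2" "c * a * cos \<beta> = (c\<^sup>2 + a\<^sup>2 - b\<^sup>2) / 2" "b * c * cos \<alpha> = (b\<^sup>2 + c\<^sup>2 - a\<^sup>2) / 2"
proof -
  show "a * b * sin \<gamma> = Q" "b * c * sin \<alpha> = Q" by (simp_all only: Q_def[symmetric] Q_eq(2)[symmetric])
  show "c * a * sin \<beta> = Q" unfolding mult.commute[of c a] by (rule Q_eq(1)[symmetric])
  have half: "2 * x = y \<Longrightarrow> x = y / 2" for x y :: real by simp
  show "a * b * cos \<gamma> = (a\<^sup>2 + b\<^sup>2 - c\<^sup>2) / 2" "c * a * cos \<beta> = (c\<^sup>2 + a\<^sup>2 - b\<^sup>2) / 2"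
    "b * c * cos \<alpha> = (b\<^sup>2 + c\<^sup>2 - a\<^sup>2) / 2"
    by (rule half, use law_of_cosines in \<open>simp only: mult.assoc\<close>)+
qed

text \<open>The law of cosines turns \<open>\<Sum> \<gamma> a b cos \<gamma>\<close> into \<open>\<Sum> \<gamma> (a\<^sup>2 + b\<^sup>2 - c\<^sup>2) / 2\<close>, which by the angle sum
is \<open>\<pi> (a\<^sup>2 + b\<^sup>2 + c\<^sup>2) / 2 - (\<alpha> a\<^sup>2 + \<beta> b\<^sup>2 + \<gamma> c\<^sup>2)\<close>.\<close>
lemma integral_fit_square: "((\<lambda>\<phi>. (fit (\<phi> + d))\<^sup>2) has_integral fit_square_integral) {0..2 * pi}"
proof -
  define G where "G x = x + 4 - 3 / 2 * sin x + x * cos x / 2" for x :: real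
  \<comment> \<open>\<open>g4\<close> is \<open>g2\<close> one period later, so that the difference of its argument and that of \<open>g3\<close> is \<open>\<pi> - \<alpha>\<close>\<close>
  define g1 g2 g3 g4 where "g1 \<phi> = g (\<phi> + (d + \<alpha> + \<beta>))" and "g2 \<phi> = g (\<phi> + d)"
    and "g3 \<phi> = g (\<phi> + (d + \<alpha> + pi))" and "g4 \<phi> = g (\<phi> + (d + 2 * pi))" for \<phi>
  note gd = g1_def g2_def g3_def g4_def
  have p12: "((\<lambda>\<phi>. g2 \<phi> * g1 \<phi>) has_integral G \<gamma>) {0..2 * pi}"
    unfolding gd G_def using angles_pos acute angle_sum by (intro integral_half_disc_support_product) auto
  have p13: "((\<lambda>\<phi>. g1 \<phi> * g3 \<phi>) has_integral G \<beta>) {0..2 * pi}"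
    unfolding gd G_def using angles_pos acute angle_sum by (intro integral_half_disc_support_product) auto
  have p23: "((\<lambda>\<phi>. g3 \<phi> * g4 \<phi>) has_integral G \<alpha>) {0..2 * pi}"
    unfolding gd G_def using angles_pos acute angle_sum by (intro integral_half_disc_support_product) auto
  have sq: "((\<lambda>\<phi>. (g1 \<phi>)\<^sup>2) has_integral (3 * pi / 2)) {0..2 * pi}" "((\<lambda>\<phi>. (g2 \<phi>)\<^sup>2) has_integral (3 * pi / 2)) {0..2 * pi}"
    "((\<lambda>\<phi>. (g3 \<phi>)\<^sup>2) has_integral (3 * pi / 2)) {0..2 * pi}"
    unfolding gd by (rule integral_half_disc_support_square)+
  have "((\<lambda>\<phi>. \<kappa>\<^sup>2 * (a\<^sup>2 * (g1 \<phi>)\<^sup>2 + b\<^sup>2 * (g2 \<phi>)\<^sup>2 + c\<^sup>2 * (g3 \<phi>)\<^sup>2 + 2 * (a * b * (g2 \<phi> * g1 \<phi>)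
      + c * a * (g1 \<phi> * g3 \<phi>) + b * c * (g3 \<phi> * g4 \<phi>)))) has_integral
    \<kappa>\<^sup>2 * (a\<^sup>2 * (3 * pi / 2) + b\<^sup>2 * (3 * pi / 2) + c\<^sup>2 * (3 * pi / 2)
      + 2 * (a * b * G \<gamma> + c * a * G \<beta> + b * c * G \<alpha>))) {0..2 * pi}"
    by (intro has_integral_mult_right has_integral_add p12 p13 p23 sq)
  moreover have "\<kappa>\<^sup>2 * (a\<^sup>2 * (g1 \<phi>)\<^sup>2 + b\<^sup>2 * (g2 \<phi>)\<^sup>2 + c\<^sup>2 * (g3 \<phi>)\<^sup>2 + 2 * (a * b * (g2 \<phi> * g1 \<phi>)
      + c * a * (g1 \<phi> * g3 \<phi>) + b * c * (g3 \<phi> * g4 \<phi>))) = (fit (\<phi> + d))\<^sup>2" for \<phi>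
  proof -
    have "g4 \<phi> = g2 \<phi>" using half_disc_support_periodic[of "\<phi> + d"] by (simp add: gd add.assoc)
    moreover have "fit (\<phi> + d) = \<kappa> * (a * g1 \<phi> + b * g2 \<phi> + c * g3 \<phi>)" by (simp add: fit_def gd add.assoc)
    ultimately show ?thesis by (simp add: power2_eq_square algebra_simps)
  qed
  moreover have "\<kappa>\<^sup>2 * (a\<^sup>2 * (3 * pi / 2) + b\<^sup>2 * (3 * pi / 2) + c\<^sup>2 * (3 * pi / 2)
      + 2 * (a * b * G \<gamma> + c * a * G \<beta> + b * c * G \<alpha>)) = fit_square_integral"
  proof -
    have e: "x * y * G t = x * y * t + 4 * (x * y) - 3 / 2 * (x * y * sin t) + t * (x * y * cos t) / 2" for x y t
      by (simp add: G_def algebra_simps)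
    show ?thesis unfolding fit_square_integral_def e side_products unfolding angle_sum[symmetric]
      by (simp add: algebra_simps add_divide_distrib diff_divide_distrib)
  qed
  ultimately show ?thesis by simp
qed

lemma integral_pairs: "((\<lambda>\<phi>. pairs (\<phi> + d)) has_integral pairs_integral) {0..2 * pi}"
proof -
  define J where "J w = 2 * pi + 8 + 2 * ((pi / 2 - w) * cos w + sin w)" for w :: real
  define w1 w2 w3 where "w1 \<phi> = 1 + \<bar>sin (\<phi> + d)\<bar>" and "w2 \<phi> = 1 + \<bar>sin (\<phi> + (d + \<alpha>))\<bar>"
    and "w3 \<phi> = 1 + \<bar>sin (\<phi> + (d + \<alpha> + \<beta>))\<bar>" for \<phi>
  note wd = w1_def w2_def w3_def
  have 12: "((\<lambda>\<phi>. w1 \<phi> * w2 \<phi>) has_integral J \<alpha>) {0..2 * pi}"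
    unfolding wd J_def using angles_pos angle_sum by (intro integral_half_disc_width_product) auto
  have 13: "((\<lambda>\<phi>. w1 \<phi> * w3 \<phi>) has_integral J (\<alpha> + \<beta>)) {0..2 * pi}"
    unfolding wd J_def using angles_pos angle_sum by (intro integral_half_disc_width_product) auto
  have 23: "((\<lambda>\<phi>. w2 \<phi> * w3 \<phi>) has_integral J \<beta>) {0..2 * pi}"
    unfolding wd J_def using angles_pos angle_sum by (intro integral_half_disc_width_product) auto
  have "((\<lambda>\<phi>. \<kappa>\<^sup>2 * (b * c * (w1 \<phi> * w2 \<phi>) + b * a * (w1 \<phi> * w3 \<phi>) + c * a * (w2 \<phi> * w3 \<phi>))) has_integral
    \<kappa>\<^sup>2 * (b * c * J \<alpha> + b * a * J (\<alpha> + \<beta>) + c * a * J \<beta>)) {0..2 * pi}"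
    by (intro has_integral_mult_right has_integral_add 12 13 23)
  moreover have "\<kappa>\<^sup>2 * (b * c * (w1 \<phi> * w2 \<phi>) + b * a * (w1 \<phi> * w3 \<phi>) + c * a * (w2 \<phi> * w3 \<phi>)) = pairs (\<phi> + d)" for \<phi>
    by (simp add: pairs_def width_def wd add.assoc)
  moreover have "\<kappa>\<^sup>2 * (b * c * J \<alpha> + b * a * J (\<alpha> + \<beta>) + c * a * J \<beta>) = pairs_integral"
  proof -
    have ab: "\<alpha> + \<beta> = pi - \<gamma>" using angle_sum by simp
    have "J (\<alpha> + \<beta>) = J \<gamma>" unfolding ab J_def by (simp add: algebra_simps)
    moreover have e: "x * y * J t = (2 * pi + 8) * (x * y) + (pi - 2 * t) * (x * y * cos t) + 2 * (x * y * sin t)" for x y t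
      by (simp add: J_def algebra_simps)
    ultimately show ?thesis unfolding pairs_integral_def e mult.commute[of b a] \<open>J (\<alpha> + \<beta>) = J \<gamma>\<close> e side_products unfolding angle_sum[symmetric]
      by (simp add: algebra_simps add_divide_distrib diff_divide_distrib)
  qed
  ultimately show ?thesis by simp
qed

lemma integral_no_line: "((\<lambda>\<phi>. no_line_prob (\<phi> + d)) has_integral (2 * pi - 2 * fit_integral + fit_square_integral)) {0..2 * pi}"
proof -
  have "((\<lambda>\<phi>. 1 - fit (\<phi> + d) - fit (\<phi> + (d + pi)) + (1 / 2) * ((fit (\<phi> + d))\<^sup>2 + (fit (\<phi> + (d + pi)))\<^sup>2)) has_integral
    (2 * pi - fit_integral - fit_integral + (1 / 2) * (fit_square_integral + fit_square_integral))) {0..2 * pi}"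
    using has_integral_const_real[of "1::real" 0 "2 * pi"]
    by (intro has_integral_add has_integral_diff has_integral_mult_right integral_fit integral_fit_square) simp
  moreover have "1 - fit (\<phi> + d) - fit (\<phi> + (d + pi)) + (1 / 2) * ((fit (\<phi> + d))\<^sup>2 + (fit (\<phi> + (d + pi)))\<^sup>2)
    = no_line_prob (\<phi> + d)" for \<phi>
    by (simp add: no_line_prob_def add.assoc power2_eq_square field_simps)
  ultimately show ?thesis by simp
qed

lemma integral_three_lines: "((\<lambda>\<phi>. three_line_prob (\<phi> + d)) has_integral (pairs_integral - fit_square_integral)) {0..2 * pi}"
proof -
  have "((\<lambda>\<phi>. 1 - (fit (\<phi> + d) + fit (\<phi> + (d + pi))) + pairs (\<phi> + d) - no_line_prob (\<phi> + d)) has_integral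
    (2 * pi - (fit_integral + fit_integral) + pairs_integral - (2 * pi - 2 * fit_integral + fit_square_integral))) {0..2 * pi}"
    using has_integral_const_real[of "1::real" 0 "2 * pi"]
    by (intro has_integral_add has_integral_diff integral_fit integral_pairs integral_no_line) simp
  then show ?thesis by (simp add: three_line_prob_def add.assoc)
qed

abbreviation "hits \<equiv> hit_prob a b c \<alpha> \<beta> \<gamma> C"

lemma hit_prob_values:
  "hits 1 = 1 - fit_integral / pi + fit_square_integral / (2 * pi)"
  "hits 2 = fit_integral / pi + pairs_integral / (2 * pi) - 3 * (fit_square_integral / (2 * pi))"
  "hits 3 = 3 * (fit_square_integral / (2 * pi)) - 2 * (pairs_integral / (2 * pi))"
  "hits 4 = pairs_integral / (2 * pi) - fit_square_integral / (2 * pi) - pi * r\<^sup>2 / 2 / Q"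
  "hits 5 = 0"
  "hits 6 = pi * r\<^sup>2 / 2 / Q"
proof -
  have const: "((\<lambda>\<phi>. k) has_integral (2 * pi * k)) {0..2 * pi}" for k :: real
    using has_integral_const_real[of k 0 "2 * pi"] by simp
  have "hits 1 = (2 * pi - 2 * fit_integral + fit_square_integral) / (2 * pi)"
    by (rule hit_prob_eq_average) (simp_all add: hit_prob_at_def integral_no_line)
  then show "hits 1 = 1 - fit_integral / pi + fit_square_integral / (2 * pi)"
    by (simp add: add_divide_distrib diff_divide_distrib)
  have "((\<lambda>\<phi>. fit (\<phi> + \<delta>) + fit (\<phi> + (\<delta> + pi)) - 2 * pairs (\<phi> + \<delta>) + 3 * three_line_prob (\<phi> + \<delta>)) has_integral
    (fit_integral + fit_integral - 2 * pairs_integral + 3 * (pairs_integral - fit_square_integral))) {0..2 * pi}"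
    by (intro has_integral_add has_integral_diff has_integral_mult_right integral_fit integral_pairs integral_three_lines)
  then have "hits 2 = (fit_integral + fit_integral - 2 * pairs_integral + 3 * (pairs_integral - fit_square_integral)) / (2 * pi)"
    by (intro hit_prob_eq_average) (simp_all add: hit_prob_at_def add.assoc)
  also have "\<dots> = fit_integral / pi + pairs_integral / (2 * pi) - 3 * (fit_square_integral / (2 * pi))" by (simp add: field_simps)
  finally show "hits 2 = fit_integral / pi + pairs_integral / (2 * pi) - 3 * (fit_square_integral / (2 * pi))" .
  have "((\<lambda>\<phi>. pairs (\<phi> + \<delta>) - 3 * three_line_prob (\<phi> + \<delta>)) has_integral (pairs_integral - 3 * (pairs_integral - fit_square_integral))) {0..2 * pi}"
    by (intro has_integral_diff has_integral_mult_right integral_pairs integral_three_lines)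
  then have "hits 3 = (pairs_integral - 3 * (pairs_integral - fit_square_integral)) / (2 * pi)"
    by (intro hit_prob_eq_average) (simp_all add: hit_prob_at_def)
  also have "\<dots> = 3 * (fit_square_integral / (2 * pi)) - 2 * (pairs_integral / (2 * pi))" by (simp add: field_simps)
  finally show "hits 3 = 3 * (fit_square_integral / (2 * pi)) - 2 * (pairs_integral / (2 * pi))" .
  have "((\<lambda>\<phi>. three_line_prob (\<phi> + \<delta>) - pi * r\<^sup>2 / 2 / Q) has_integral (pairs_integral - fit_square_integral - 2 * pi * (pi * r\<^sup>2 / 2 / Q))) {0..2 * pi}"
    by (intro has_integral_diff const integral_three_lines)
  then have "hits 4 = (pairs_integral - fit_square_integral - 2 * pi * (pi * r\<^sup>2 / 2 / Q)) / (2 * pi)"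
    by (intro hit_prob_eq_average) (simp_all add: hit_prob_at_def)
  then show "hits 4 = pairs_integral / (2 * pi) - fit_square_integral / (2 * pi) - pi * r\<^sup>2 / 2 / Q"
    by (simp add: diff_divide_distrib)
  have "hits 5 = 2 * pi * 0 / (2 * pi)"
    by (rule hit_prob_eq_average) (use const[of 0] in \<open>simp_all add: hit_prob_at_def\<close>)
  then show "hits 5 = 0" by simp
  have "hits 6 = 2 * pi * (pi * r\<^sup>2 / 2 / Q) / (2 * pi)"
    by (rule hit_prob_eq_average) (use const[of "pi * r\<^sup>2 / 2 / Q"] in \<open>simp_all add: hit_prob_at_def\<close>)
  then show "hits 6 = pi * r\<^sup>2 / 2 / Q" by simp
qed

lemma normalized_integrals:
  "fit_integral / pi = (a + b + c) * ((pi + 2) * r) / (pi * Q)"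
  "fit_square_integral / (2 * pi) = (a\<^sup>2 + b\<^sup>2 + c\<^sup>2) * r\<^sup>2 / Q\<^sup>2 + 4 * (a * b + b * c + c * a) * r\<^sup>2 / (pi * Q\<^sup>2)
    - (\<alpha> * a\<^sup>2 + \<beta> * b\<^sup>2 + \<gamma> * c\<^sup>2) * r\<^sup>2 / (2 * pi * Q\<^sup>2)
    + (\<alpha> * b * c + \<beta> * c * a + \<gamma> * a * b) * r\<^sup>2 / (pi * Q\<^sup>2) - 9 * r\<^sup>2 / (2 * pi * Q)"
  "pairs_integral / (2 * pi) = (a * b + b * c + c * a) * r\<^sup>2 / Q\<^sup>2 + 4 * (a * b + b * c + c * a) * r\<^sup>2 / (pi * Q\<^sup>2)
    - (a\<^sup>2 + b\<^sup>2 + c\<^sup>2) * r\<^sup>2 / (4 * Q\<^sup>2) + (\<alpha> * a\<^sup>2 + \<beta> * b\<^sup>2 + \<gamma> * c\<^sup>2) * r\<^sup>2 / (pi * Q\<^sup>2) + 3 * r\<^sup>2 / (pi * Q)"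
proof -
  have Q0: "Q \<noteq> 0" using Q_pos by simp
  define A P W X where "A = a\<^sup>2 + b\<^sup>2 + c\<^sup>2" and "P = a * b + b * c + c * a"
    and "W = \<alpha> * a\<^sup>2 + \<beta> * b\<^sup>2 + \<gamma> * c\<^sup>2" and "X = \<alpha> * b * c + \<beta> * c * a + \<gamma> * a * b"
  note fold = A_def[symmetric] P_def[symmetric] W_def[symmetric] X_def[symmetric]
  show "fit_integral / pi = (a + b + c) * ((pi + 2) * r) / (pi * Q)" by (simp add: fit_integral_def \<kappa>_def ac_simps)
  show "fit_square_integral / (2 * pi) = (a\<^sup>2 + b\<^sup>2 + c\<^sup>2) * r\<^sup>2 / Q\<^sup>2 + 4 * (a * b + b * c + c * a) * r\<^sup>2 / (pi * Q\<^sup>2)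
    - (\<alpha> * a\<^sup>2 + \<beta> * b\<^sup>2 + \<gamma> * c\<^sup>2) * r\<^sup>2 / (2 * pi * Q\<^sup>2)
    + (\<alpha> * b * c + \<beta> * c * a + \<gamma> * a * b) * r\<^sup>2 / (pi * Q\<^sup>2) - 9 * r\<^sup>2 / (2 * pi * Q)"
    unfolding fit_square_integral_def \<kappa>_def fold using Q0 by (simp add: field_simps power2_eq_square)
  show "pairs_integral / (2 * pi) = (a * b + b * c + c * a) * r\<^sup>2 / Q\<^sup>2 + 4 * (a * b + b * c + c * a) * r\<^sup>2 / (pi * Q\<^sup>2)
    - (a\<^sup>2 + b\<^sup>2 + c\<^sup>2) * r\<^sup>2 / (4 * Q\<^sup>2) + (\<alpha> * a\<^sup>2 + \<beta> * b\<^sup>2 + \<gamma> * c\<^sup>2) * r\<^sup>2 / (pi * Q\<^sup>2) + 3 * r\<^sup>2 / (pi * Q)"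
    unfolding pairs_integral_def \<kappa>_def fold using Q0 by (simp add: field_simps power2_eq_square)
qed

end

theorem corollary4:
  fixes a b c \<alpha> \<beta> \<gamma> r u F Q :: real
    and C :: "plane set"
    and p :: "nat \<Rightarrow> real"
  assumes triangle: "triangle_data a b c \<alpha> \<beta> \<gamma>"
    and acute_or_right: "\<alpha> \<le> pi / 2" "\<beta> \<le> pi / 2" "\<gamma> \<le> pi / 2"
    and radius: "r > 0"
    and body: "half_disc r C"
    and reference_point: "0 \<in> C"
    and fits: "\<forall>\<phi>\<in>{0..<2 * pi}. c_star \<alpha> \<beta> (support_fun C) \<phi> \<le> c"
    and u: "u = (pi + 2) * r"
    and F: "F = pi * r\<^sup>2 / 2"
    and Q: "Q = a * b * sin \<gamma>"
    and p: "p = hit_prob a b c \<alpha> \<beta> \<gamma> C"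
  shows
    "p 1 = 1 - (a + b + c) * u / (pi * Q)
         + (a\<^sup>2 + b\<^sup>2 + c\<^sup>2) * r\<^sup>2 / Q\<^sup>2
         + 4 * (a * b + b * c + c * a) * r\<^sup>2 / (pi * Q\<^sup>2)
         - (\<alpha> * a\<^sup>2 + \<beta> * b\<^sup>2 + \<gamma> * c\<^sup>2) * r\<^sup>2 / (2 * pi * Q\<^sup>2)
         + (\<alpha> * b * c + \<beta> * c * a + \<gamma> * a * b) * r\<^sup>2 / (pi * Q\<^sup>2)
         - 9 * r\<^sup>2 / (2 * pi * Q)
   \<and> p 2 = (a + b + c) * u / (pi * Q)
         - 13 * (a\<^sup>2 + b\<^sup>2 + c\<^sup>2) * r\<^sup>2 / (4 * Q\<^sup>2)
         - (8 - pi) * (a * b + b * c + c * a) * r\<^sup>2 / (pi * Q\<^sup>2)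
         + 5 * (\<alpha> * a\<^sup>2 + \<beta> * b\<^sup>2 + \<gamma> * c\<^sup>2) * r\<^sup>2 / (2 * pi * Q\<^sup>2)
         - 3 * (\<alpha> * b * c + \<beta> * c * a + \<gamma> * a * b) * r\<^sup>2 / (pi * Q\<^sup>2)
         + 33 * r\<^sup>2 / (2 * pi * Q)
   \<and> p 3 = 7 * (a\<^sup>2 + b\<^sup>2 + c\<^sup>2) * r\<^sup>2 / (2 * Q\<^sup>2)
         + (4 - 2 * pi) * (a * b + b * c + c * a) * r\<^sup>2 / (pi * Q\<^sup>2)
         - 7 * (\<alpha> * a\<^sup>2 + \<beta> * b\<^sup>2 + \<gamma> * c\<^sup>2) * r\<^sup>2 / (2 * pi * Q\<^sup>2)
         + 3 * (\<alpha> * b * c + \<beta> * c * a + \<gamma> * a * b) * r\<^sup>2 / (pi * Q\<^sup>2)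
         - 39 * r\<^sup>2 / (2 * pi * Q)
   \<and> p 4 = (a * b + b * c + c * a) * r\<^sup>2 / Q\<^sup>2
         - 5 * (a\<^sup>2 + b\<^sup>2 + c\<^sup>2) * r\<^sup>2 / (4 * Q\<^sup>2)
         + 3 * (\<alpha> * a\<^sup>2 + \<beta> * b\<^sup>2 + \<gamma> * c\<^sup>2) * r\<^sup>2 / (2 * pi * Q\<^sup>2)
         - (\<alpha> * b * c + \<beta> * c * a + \<gamma> * a * b) * r\<^sup>2 / (pi * Q\<^sup>2)
         + 15 * r\<^sup>2 / (2 * pi * Q)
         - F / Q
   \<and> p 5 = 0
   \<and> p 6 = F / Q"
proof -
  obtain m \<delta> where C: "C = half_disc_at r m \<delta>" using half_disc_at_of_half_disc[OF body] .
  interpret T: triangle_sides_angles a b c \<alpha> \<beta> \<gamma> by (rule triangle_data_imp_sides_angles[OF triangle])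
  interpret H: half_disc_throw a b c \<alpha> \<beta> \<gamma> r \<delta> m
    by unfold_locales (use acute_or_right radius fits in \<open>auto simp: C\<close>)
  have HC: "H.C = C" and HQ: "H.Q = Q" by (simp_all add: H.C_def C H.Q_def Q)
  define R A P W X where "R = r\<^sup>2" and "A = a\<^sup>2 + b\<^sup>2 + c\<^sup>2" and "P = a * b + b * c + c * a"
    and "W = \<alpha> * a\<^sup>2 + \<beta> * b\<^sup>2 + \<gamma> * c\<^sup>2" and "X = \<alpha> * b * c + \<beta> * c * a + \<gamma> * a * b"
  note fold = R_def[symmetric] A_def[symmetric] P_def[symmetric] W_def[symmetric] X_def[symmetric]
  have "Q \<noteq> 0" using H.Q_pos HQ by simp
  then show ?thesis
    unfolding p u F H.hit_prob_values[unfolded HC HQ] H.normalized_integrals[unfolded HQ] fold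
    by (simp add: field_simps)
qed

end
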